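(* Let $(x_i,y_j)=(x_i^*+v_0h,\,y_j^*+w_0h)$ be an interior irregular grid point with $(x_i^*,y_j^* )\in\Gamma$ and $-1<v_0,w_0<1$. Then the following 13-point scheme centered at $(x_i,y_j)$, $$h^{-1}\mathcal{L}_hu_h:=h^{-1}\Big(\sum_{k=-1}^{1}\sum_{\ell=-1}^{1}C_{k,\ell}(u_h)_{i+k,j+\ell}+\sum_{k=-2,2}C_{k,0}(u_h)_{i+k,j}+\sum_{\ell=-2,2}C_{0,\ell}(u_h)_{i,j+\ell}\Big)$$ $$=\sum_{(m,n)\in\Lambda_3}f_+^{(m,n)}J^+_{m,n}+\sum_{(m,n)\in\Lambda_3}f_-^{(m,n)}J^-_{m,n}+\sum_{p=0}^{5}g^{(p)}J^g_p+\sum_{p=0}^{4}g_\Gamma^{(p)}J^{g_\Gamma}_p,$$ achieves the fifth-order consistency for $[u]=g$ and $[a\nabla u\cdot\vec n]=g_\Gamma$ at $(x_i^*,y_j^* )\in\Gamma$, where the thirteen stencil coefficients are $C_{k,\ell}:=\sum_{p=0}^{5}c_{k,\ell,p}h^p$ and $\{c_{k,\ell,p}\}\subset\mathbb{R}$ (over the thirteen stencil indices $(k,\ell)$ and $p=0,\ldots,5$) is any nontrivial solution of the linear system induced by $$I^+_{m,n}+\sum_{\substack{(m',n')\in\Lambda_5^1\\ m'+n'\ge m+n}}I^-_{m',n'}T^{u_+}_{m',n',m,n}=\mathcal{O}(h^6)\qquad\text{for all }(m,n)\in\Lambda_5^1,$$ and where, with $v_1=v_0+k$, $w_1=w_0+\ell$,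 $$I^\pm_{m,n}:=\sum_{(k,\ell)\in\tilde d^{\pm}_{i,j}}C_{k,\ell}G^\pm_{5,m,n}(v_1h,w_1h),\qquad J^\pm_{m,n}:=h^{-1}\sum_{(k,\ell)\in\tilde d^\pm_{i,j}}C_{k,\ell}H^\pm_{5,m,n}(v_1h,w_1h)+h^{-1}\sum_{(m',n')\in\Lambda_5^1}I^-_{m',n'}T^\pm_{m',n',m,n},$$ $$J^g_p:=h^{-1}\sum_{(m',n')\in\Lambda_5^1}I^-_{m',n'}T^g_{m',n',p},\qquad J^{g_\Gamma}_p:=h^{-1}\sum_{(m',n')\in\Lambda_5^1}I^-_{m',n'}T^{g_\Gamma}_{m',n',p}.$$
   Context: **Elliptic interface problem.** $\Omega=(l_1,l_2)\times(l_3,l_4)$ with $l_4-l_3=N_0(l_2-l_1)$, $N_0\in\mathbb{N}$; $\psi$ is a smooth two-variable function, $\Gamma=\{(x,y)\in\Omega:\psi(x,y)=0\}$ is a smooth curve, $\Omega_+=\{\psi>0\}\cap\Omega$, $\Omega_-=\{\psi<0\}\cap\Omega$; $a_\pm,u_\pm,f_\pm$ are the restrictions of $a,u,f$ to $\Omega_\pm$. The function $u$ satisfies $-\nabla\cdot(a\nabla u)=f$ in $\Omega\setminus\Gamma$, $[u]=g$ and $[a\nabla u\cdot\vec n]=g_\Gamma$ on $\Gamma$, where $[\cdot]$ is the limit from $\Omega_+$ minus the limit from $\Omega_-$ and $\vec n$ is the unit normal of $\Gamma$ pointing towards $\Omega_+$. **Standing assumptions.** $a>0$ has uniformly continuous partial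 derivatives of total order up to six in each of $\Omega_\pm$; $u$ and $f$ have uniformly continuous partial derivatives of total orders up to seven and five, respectively, in each of $\Omega_\pm$; $a,u,f$ may be discontinuous across $\Gamma$; near $(x_i^*,y_j^* )$, $\Gamma$ has a parametric equation $(r(t),s(t))$ with $(r(t_k^* ),s(t_k^* ))=(x_i^*,y_j^* )$, $(r'(t_k^* ),s'(t_k^* ))\ne(0,0)$, with uniformly continuous derivatives up to order five; $g$, $g_\Gamma$ have uniformly continuous derivatives along $\Gamma$ up to orders five and four. The parametrization is oriented so that $(s',-r')$ is a positive multiple of $\vec n$. **Grid.** For $N_1\in\mathbb{N}$, $h=(l_2-l_1)/N_1$, $x_i=l_1+ih$, $y_j=l_3+jh$; $(u_h)_{i,j}$ is the numerical approximation of $u(x_i,y_j)$. Put $d^+_{i,j}=\{(k,\ell):k,\ell\in\{-1,0,1\},\ \psi(x_i+kh,y_j+\ell h)>0\}$, $d^-_{i,j}=\{(k,\ell):k,\ell\in\{-1,0,1\},\ \psi(x_i+kh,y_j+\ell h)\le0\}$, and let $e^\pm_{i,j}$ be defined in the same way with $(k,\ell)\in\{(-2,0),(2,0),(0,-2),(0,2)\}$; $\tilde d^\pm_{i,j}=d^\pm_{i,j}\cup e^\pm_{i,j}$. The point $(x_i,y_j)$ is irregular if $d^+_{i,j}$ and $d^-_{i,j}$ are both nonempty. **Notation.** $a_\pm^{(m,n)},u_\pm^{(m,n)},f_\pm^{(m,n)}$ are the (one-sided) partial derivatives $\partial_x^m\partial_y^n$ of $a_\pm,u_\pm,f_\pm$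 at $(x_i^*,y_j^* )$. $\Lambda_K=\{(m,n)\in\mathbb{N}_0^2:m+n\le K\}$, $\Lambda_K^1=\{(m,n)\in\Lambda_K:m\in\{0,1\}\}$, $\Lambda_K^2=\Lambda_K\setminus\Lambda_K^1$. With $g(t),g_\Gamma(t)$ the values of $g,g_\Gamma$ at $(r(t),s(t))$, $$g^{(p)}=\frac1{p!}\frac{d^p}{dt^p}g(t)\Big|_{t_k^*},\qquad g_\Gamma^{(p)}=\frac1{p!}\frac{d^p}{dt^p}\Big(g_\Gamma(t)\sqrt{(r'(t))^2+(s'(t))^2}\Big)\Big|_{t_k^*}.$$ **Coefficients $a^{u_\pm},a^{f_\pm}$.** These are the coefficients in $u_\pm^{(p,q)}=\sum_{(m,n)\in\Lambda_{p+q}^1}a^{u_\pm}_{p,q,m,n}u_\pm^{(m,n)}+\sum_{(m,n)\in\Lambda_{p+q-2}}a^{f_\pm}_{p,q,m,n}f_\pm^{(m,n)}$ obtained by repeatedly using the differentiated equation. Explicitly (write $a$ for $a_\pm$, all derivatives at $(x_i^*,y_j^* )$): if $p\in\{0,1\}$, then $a^{u_\pm}_{p,q,m,n}=1$ when $(m,n)=(p,q)$ and $0$ otherwise, and $a^{f_\pm}_{p,q,m,n}=0$; for $p\ge2$, recursively in $p$, both $w=a^{u_\pm}_{\cdot,\cdot,m,n}$ and $w=a^{f_\pm}_{\cdot,\cdot,m,n}$ satisfy $$w_{p,q}=-\epsilon_{p,q}-w_{p-2,q+2}-\sum_{\mathsf i=0}^{p-2}\sum_{\mathsf j=0}^{q}\binom{p-2}{\mathsf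 i}\binom{q}{\mathsf j}\Big[\big(\tfrac{a_x}{a}\big)^{(p-2-\mathsf i,q-\mathsf j)}w_{\mathsf i+1,\mathsf j}+\big(\tfrac{a_y}{a}\big)^{(p-2-\mathsf i,q-\mathsf j)}w_{\mathsf i,\mathsf j+1}\Big],$$ with $\epsilon_{p,q}=0$ for $a^{u_\pm}$, and for $a^{f_\pm}$, $\epsilon_{p,q}=\binom{p-2}{m}\binom qn(1/a)^{(p-2-m,q-n)}$ if $m\le p-2$, $n\le q$, and $0$ otherwise. Set $$G^\pm_{5,m,n}(x,y)=\sum_{(p,q)\in\Lambda_5}\frac{a^{u_\pm}_{p,q,m,n}}{p!q!}x^py^q,\qquad H^\pm_{5,m,n}(x,y)=\sum_{(p,q)\in\Lambda_5^2}\frac{a^{f_\pm}_{p,q,m,n}}{p!q!}x^py^q.$$ **Transmission coefficients.** $T^{u_+},T^\pm,T^g,T^{g_\Gamma}$ are the coefficients, uniquely determined by $r^{(p)}(t_k^* ),s^{(p)}(t_k^* )$ ($0\le p\le5$) and $\{a_\pm^{(m,n)}:(m,n)\in\Lambda_4\}$, in the identity valid for all $(m',n')\in\Lambda_5^1$: $$u_-^{(m',n')}=\sum_{\substack{(m,n)\in\Lambda_5^1\\ m+n\le m'+n'}}T^{u_+}_{m',n',m,n}u_+^{(m,n)}+\sum_{(m,n)\in\Lambda_3}\big(T^+_{m',n',m,n}f_+^{(m,n)}+T^-_{m',n',m,n}f_-^{(m,n)}\big)+\sum_{p=0}^5T^g_{m',n',p}g^{(p)}+\sum_{p=0}^4T^{g_\Gamma}_{m',n',p}g_\Gamma^{(p)}.$$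 This identity is obtained by differentiating at $t=t_k^*$ the relation $u_+(r,s)-u_-(r,s)=g$ up to order five and the relation $(a_+\nabla u_+-a_-\nabla u_-)(r,s)\cdot(s',-r')=g_\Gamma\sqrt{(r')^2+(s')^2}$ up to order four, expressing all $u_\pm^{(p,q)}$ with $p\ge2$ through the coefficients $a^{u_\pm},a^{f_\pm}$, and solving the resulting (uniquely solvable) linear system for $\{u_-^{(m',n')}\}_{(m',n')\in\Lambda_5^1}$. **Terminology.** The system "$=\mathcal{O}(h^6)$" means that the left-hand sides, which are polynomials in $h$ (with $v_0,w_0$ treated as parameters), have vanishing coefficients of $h^0,\ldots,h^5$. "Nontrivial" means $c_{k,\ell,0}\neq0$ for at least one stencil index. "Fifth-order consistency" means that, replacing $(u_h)_{i+k,j+\ell}$ by the exact values $u(x_i+kh,y_j+\ell h)$, where $u=u_+$ at points with $(k,\ell)\in\tilde d^+_{i,j}$ and $u=u_-$ (extended continuously to $\Gamma$) at points with $(k,\ell)\in\tilde d^-_{i,j}$, the difference between the left-hand and right-hand sides of the scheme is $\mathcal{O}(h^5)$ (with $v_0,w_0,c_{k,\ell,p}$ treated as bounded parameters). "Interior" includes that the thirteen stencil points lie in $\overline\Omega$. *)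

theory Defs
  imports "HOL-Analysis.Analysis"
begin

section \<open>Partial derivatives and one-sided values\<close>

definition Dx :: "(real \<times> real \<Rightarrow> real) \<Rightarrow> real \<times> real \<Rightarrow> real" where
  "Dx F = (\<lambda>z. deriv (\<lambda>x. F (x, snd z)) (fst z))"

definition Dy :: "(real \<times> real \<Rightarrow> real) \<Rightarrow> real \<times> real \<Rightarrow> real" where
  "Dy F = (\<lambda>z. deriv (\<lambda>y. F (fst z, y)) (snd z))"

definition Dxy :: "nat \<Rightarrow> nat \<Rightarrow> (real \<times> real \<Rightarrow> real) \<Rightarrow> real \<times> real \<Rightarrow> real" where
  "Dxy m n F = (Dx ^^ m) ((Dy ^^ n) F)"

(* On an open set S: every iterated partial derivative of F of total order at most K (in any
   order of differentiation) exists at all points of S and has the property Q, where Q is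
   continuity or uniform continuity on S. *)
primrec has_partials :: "((real \<times> real \<Rightarrow> real) \<Rightarrow> bool) \<Rightarrow> (real \<times> real) set \<Rightarrow> nat
    \<Rightarrow> (real \<times> real \<Rightarrow> real) \<Rightarrow> bool" where
  "has_partials Q S 0 F \<longleftrightarrow> Q F"
| "has_partials Q S (Suc K) F \<longleftrightarrow> Q F \<and>
     (\<forall>z\<in>S. (\<lambda>x. F (x, snd z)) differentiable (at (fst z)) \<and>
            (\<lambda>y. F (fst z, y)) differentiable (at (snd z))) \<and>
     has_partials Q S K (Dx F) \<and> has_partials Q S K (Dy F)"

definition smooth_fun :: "(real \<times> real \<Rightarrow> real) \<Rightarrow> bool" where
  "smooth_fun F \<longleftrightarrow> (\<forall>K. has_partials (continuous_on UNIV) UNIV K F)"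

definition uc_partials :: "nat \<Rightarrow> (real \<times> real) set \<Rightarrow> (real \<times> real \<Rightarrow> real) \<Rightarrow> bool" where
  "uc_partials K S F \<longleftrightarrow> has_partials (uniformly_continuous_on S) S K F"

definition uc_derivs :: "nat \<Rightarrow> real set \<Rightarrow> (real \<Rightarrow> real) \<Rightarrow> bool" where
  "uc_derivs K T \<phi> \<longleftrightarrow>
     (\<forall>p\<le>K. uniformly_continuous_on T ((deriv ^^ p) \<phi>)) \<and>
     (\<forall>p<K. \<forall>t\<in>T. (deriv ^^ p) \<phi> differentiable (at t))"

(* Value at z of the restriction of F to S, extended by its limit from within S to z outside S. *)
definition side_val :: "(real \<times> real) set \<Rightarrow> (real \<times> real \<Rightarrow> real) \<Rightarrow> real \<times> real \<Rightarrow> real" where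
  "side_val S F z = (if z \<in> S then F z else Lim (at z within S) F)"

definition side_deriv :: "(real \<times> real) set \<Rightarrow> (real \<times> real \<Rightarrow> real) \<Rightarrow> real \<times> real
    \<Rightarrow> nat \<Rightarrow> nat \<Rightarrow> real" where
  "side_deriv S F z m n = side_val S (Dxy m n F) z"

section \<open>The interface\<close>

definition interface_jump :: "(real \<times> real) set \<Rightarrow> (real \<times> real) set \<Rightarrow> (real \<times> real \<Rightarrow> real)
    \<Rightarrow> real \<times> real \<Rightarrow> real" where
  "interface_jump Op Om F z = side_val Op F z - side_val Om F z"

(* Regular parametrisation of \<Gamma> near (r t0, s t0): t \<mapsto> (r t, s t) is a homeomorphism of the open
   interval J onto a relatively open subset of \<Gamma>. *)
definition local_param :: "(real \<times> real) set \<Rightarrow> (real \<Rightarrow> real) \<Rightarrow> (real \<Rightarrow> real) \<Rightarrow> real set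
    \<Rightarrow> real \<Rightarrow> bool" where
  "local_param \<Gamma> r s J t0 \<longleftrightarrow>
     open J \<and> connected J \<and> t0 \<in> J \<and> uc_derivs 5 J r \<and> uc_derivs 5 J s \<and>
     (deriv r t0, deriv s t0) \<noteq> (0, 0) \<and>
     (\<exists>W \<eta>. openin (top_of_set \<Gamma>) W \<and> homeomorphism J W (\<lambda>t. (r t, s t)) \<eta>)"

(* Of the smoothness of \<Gamma> only derivatives of the parametrisations up to order five are required. *)
definition smooth_curve :: "(real \<times> real) set \<Rightarrow> bool" where
  "smooth_curve \<Gamma> \<longleftrightarrow> (\<forall>z\<in>\<Gamma>. \<exists>r s J t. local_param \<Gamma> r s J t \<and> (r t, s t) = z)"

(* v is the unit normal of \<Gamma> at z pointing towards Op, hence away from Om on the other side. *)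
definition unit_normal_towards :: "(real \<times> real) set \<Rightarrow> (real \<times> real) set \<Rightarrow> (real \<times> real) set
    \<Rightarrow> real \<times> real \<Rightarrow> real \<times> real \<Rightarrow> bool" where
  "unit_normal_towards \<Gamma> Op Om z v \<longleftrightarrow> norm v = 1 \<and>
     (\<forall>r s J t. local_param \<Gamma> r s J t \<and> (r t, s t) = z \<longrightarrow> v \<bullet> (deriv r t, deriv s t) = 0) \<and>
     (\<forall>\<^sub>F \<epsilon> in at_right 0. z + \<epsilon> *\<^sub>R v \<in> Op \<and> z - \<epsilon> *\<^sub>R v \<in> Om)"

section \<open>Index sets\<close>

definition Lam :: "nat \<Rightarrow> (nat \<times> nat) set" where
  "Lam K = {(m, n). m + n \<le> K}"

definition Lam1 :: "nat \<Rightarrow> (nat \<times> nat) set" where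
  "Lam1 K = {(m, n) \<in> Lam K. m \<in> {0, 1}}"

definition Lam2 :: "nat \<Rightarrow> (nat \<times> nat) set" where
  "Lam2 K = Lam K - Lam1 K"

definition near_idx :: "(int \<times> int) set" where
  "near_idx = {-1, 0, 1} \<times> {-1, 0, 1}"

definition far_idx :: "(int \<times> int) set" where
  "far_idx = {(-2, 0), (2, 0), (0, -2), (0, 2)}"

definition stencil :: "(int \<times> int) set" where
  "stencil = near_idx \<union> far_idx"

(* The point (x + k h, y + l h) for z = (x, y). *)
definition shift :: "real \<Rightarrow> real \<times> real \<Rightarrow> int \<times> int \<Rightarrow> real \<times> real" where
  "shift h z kl = (fst z + real_of_int (fst kl) * h, snd z + real_of_int (snd kl) * h)"

definition pos_idx :: "(real \<times> real \<Rightarrow> real) \<Rightarrow> real \<Rightarrow> real \<times> real \<Rightarrow> (int \<times> int) set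
    \<Rightarrow> (int \<times> int) set" where
  "pos_idx \<psi> h z A = {kl \<in> A. \<psi> (shift h z kl) > 0}"

definition neg_idx :: "(real \<times> real \<Rightarrow> real) \<Rightarrow> real \<Rightarrow> real \<times> real \<Rightarrow> (int \<times> int) set
    \<Rightarrow> (int \<times> int) set" where
  "neg_idx \<psi> h z A = {kl \<in> A. \<psi> (shift h z kl) \<le> 0}"

definition dp :: "(real \<times> real \<Rightarrow> real) \<Rightarrow> real \<Rightarrow> real \<times> real \<Rightarrow> (int \<times> int) set" where
  "dp \<psi> h z = pos_idx \<psi> h z near_idx"

definition dm :: "(real \<times> real \<Rightarrow> real) \<Rightarrow> real \<Rightarrow> real \<times> real \<Rightarrow> (int \<times> int) set" where
  "dm \<psi> h z = neg_idx \<psi> h z near_idx"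

definition dp' :: "(real \<times> real \<Rightarrow> real) \<Rightarrow> real \<Rightarrow> real \<times> real \<Rightarrow> (int \<times> int) set" where
  "dp' \<psi> h z = dp \<psi> h z \<union> pos_idx \<psi> h z far_idx"

definition dm' :: "(real \<times> real \<Rightarrow> real) \<Rightarrow> real \<Rightarrow> real \<times> real \<Rightarrow> (int \<times> int) set" where
  "dm' \<psi> h z = dm \<psi> h z \<union> neg_idx \<psi> h z far_idx"

definition irregular :: "(real \<times> real \<Rightarrow> real) \<Rightarrow> real \<Rightarrow> real \<times> real \<Rightarrow> bool" where
  "irregular \<psi> h z \<longleftrightarrow> dp \<psi> h z \<noteq> {} \<and> dm \<psi> h z \<noteq> {}"

section \<open>The coefficients expressing all derivatives of u by those in Lam1 and those of f\<close>

(* The common recursion: wrec ini \<alpha> \<beta> \<epsilon> p q is w_{p,q}, where ini gives the values for p < 2 and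
   \<alpha>, \<beta> are the derivatives of a_x/a and a_y/a. *)
function wrec :: "(nat \<Rightarrow> nat \<Rightarrow> real) \<Rightarrow> (nat \<Rightarrow> nat \<Rightarrow> real) \<Rightarrow> (nat \<Rightarrow> nat \<Rightarrow> real)
    \<Rightarrow> (nat \<Rightarrow> nat \<Rightarrow> real) \<Rightarrow> nat \<Rightarrow> nat \<Rightarrow> real" where
  "wrec ini \<alpha> \<beta> \<epsilon> p q =
     (if p < 2 then ini p q
      else - \<epsilon> p q - wrec ini \<alpha> \<beta> \<epsilon> (p - 2) (q + 2)
        - (\<Sum>i=0..p-2. \<Sum>j=0..q. real ((p - 2) choose i) * real (q choose j) *
             (\<alpha> (p - 2 - i) (q - j) * wrec ini \<alpha> \<beta> \<epsilon> (i + 1) j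
              + \<beta> (p - 2 - i) (q - j) * wrec ini \<alpha> \<beta> \<epsilon> i (j + 1))))"
  by pat_completeness auto
termination
  by (relation "Wellfounded.measure (\<lambda>(ini, \<alpha>, \<beta>, \<epsilon>, p, q). p)") auto

declare wrec.simps [simp del]

definition au :: "(real \<times> real) set \<Rightarrow> (real \<times> real \<Rightarrow> real) \<Rightarrow> real \<times> real
    \<Rightarrow> nat \<Rightarrow> nat \<Rightarrow> nat \<Rightarrow> nat \<Rightarrow> real" where
  "au S a z p q m n =
     wrec (\<lambda>p' q'. if (m, n) = (p', q') then 1 else 0)
       (side_deriv S (\<lambda>x. Dx a x / a x) z) (side_deriv S (\<lambda>x. Dy a x / a x) z)
       (\<lambda>_ _. 0) p q"

definition af :: "(real \<times> real) set \<Rightarrow> (real \<times> real \<Rightarrow> real) \<Rightarrow> real \<times> real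
    \<Rightarrow> nat \<Rightarrow> nat \<Rightarrow> nat \<Rightarrow> nat \<Rightarrow> real" where
  "af S a z p q m n =
     wrec (\<lambda>_ _. 0)
       (side_deriv S (\<lambda>x. Dx a x / a x) z) (side_deriv S (\<lambda>x. Dy a x / a x) z)
       (\<lambda>p' q'. if m \<le> p' - 2 \<and> n \<le> q'
          then real ((p' - 2) choose m) * real (q' choose n)
               * side_deriv S (\<lambda>x. 1 / a x) z (p' - 2 - m) (q' - n)
          else 0) p q"

(* G and H are polynomials; their arguments are taken in real poly because they are only used at
   (v_1 h, w_1 h) with the polynomial variable h. *)
definition G5 :: "(real \<times> real) set \<Rightarrow> (real \<times> real \<Rightarrow> real) \<Rightarrow> real \<times> real \<Rightarrow> nat \<Rightarrow> nat
    \<Rightarrow> real poly \<Rightarrow> real poly \<Rightarrow> real poly" where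
  "G5 S a z m n x y = (\<Sum>(p, q)\<in>Lam 5. smult (au S a z p q m n / (fact p * fact q)) (x ^ p * y ^ q))"

definition H5 :: "(real \<times> real) set \<Rightarrow> (real \<times> real \<Rightarrow> real) \<Rightarrow> real \<times> real \<Rightarrow> nat \<Rightarrow> nat
    \<Rightarrow> real poly \<Rightarrow> real poly \<Rightarrow> real poly" where
  "H5 S a z m n x y = (\<Sum>(p, q)\<in>Lam2 5. smult (af S a z p q m n / (fact p * fact q)) (x ^ p * y ^ q))"

section \<open>Transmission coefficients\<close>

(* u^(p,q) in terms of U = (u^(m,n)) on Lam1 5 and F = (f^(m,n)) on Lam 3. For p + q < 2 the
   truncated subtraction leaves Lam 0, but then af vanishes. *)
definition full_jet :: "(real \<times> real) set \<Rightarrow> (real \<times> real \<Rightarrow> real) \<Rightarrow> real \<times> real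
    \<Rightarrow> (nat \<Rightarrow> nat \<Rightarrow> real) \<Rightarrow> (nat \<Rightarrow> nat \<Rightarrow> real) \<Rightarrow> nat \<Rightarrow> nat \<Rightarrow> real" where
  "full_jet S a z U F p q =
     (\<Sum>(m, n)\<in>Lam1 (p + q). au S a z p q m n * U m n)
     + (\<Sum>(m, n)\<in>Lam (p + q - 2). af S a z p q m n * F m n)"

definition taylor_poly :: "nat \<Rightarrow> (nat \<Rightarrow> nat \<Rightarrow> real) \<Rightarrow> real \<times> real \<Rightarrow> real" where
  "taylor_poly K c d = (\<Sum>(m, n)\<in>Lam K. c m n / (fact m * fact n) * fst d ^ m * snd d ^ n)"

(* The linear system obtained by differentiating the two jump relations at t0, for arbitrary data
   U (the u_+^(m,n)), Fp, Fm (the f_\<plusminus>^(m,n)), g, gG, with unknown V (the u_-^(m,n)).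
   By the chain rule the p-th derivative along the curve involves only the derivatives of
   order \<le> p of the functions of (x,y), which are therefore replaced by the
   Taylor polynomials with the given coefficients; for the gradients the indices are shifted by
   (1,0) and (0,1). *)
definition transmission_system :: "(real \<times> real) set \<Rightarrow> (real \<times> real) set \<Rightarrow> (real \<times> real \<Rightarrow> real)
    \<Rightarrow> (real \<Rightarrow> real) \<Rightarrow> (real \<Rightarrow> real) \<Rightarrow> real
    \<Rightarrow> (nat \<Rightarrow> nat \<Rightarrow> real) \<Rightarrow> (nat \<Rightarrow> nat \<Rightarrow> real) \<Rightarrow> (nat \<Rightarrow> nat \<Rightarrow> real)
    \<Rightarrow> (nat \<Rightarrow> real) \<Rightarrow> (nat \<Rightarrow> real) \<Rightarrow> (nat \<Rightarrow> nat \<Rightarrow> real) \<Rightarrow> bool" where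
  "transmission_system Op Om a r s t0 U Fp Fm g gG V \<longleftrightarrow>
     (let z = (r t0, s t0);
          d = (\<lambda>t. (r t - r t0, s t - s t0));
          up = full_jet Op a z U Fp;
          um = full_jet Om a z V Fm;
          ap = (\<lambda>t. taylor_poly 4 (side_deriv Op a z) (d t));
          am = (\<lambda>t. taylor_poly 4 (side_deriv Om a z) (d t));
          ux = (\<lambda>w t. taylor_poly 4 (\<lambda>m n. w (m + 1) n) (d t));
          uy = (\<lambda>w t. taylor_poly 4 (\<lambda>m n. w m (n + 1)) (d t))
      in (\<forall>p\<le>5. (deriv ^^ p) (\<lambda>t. taylor_poly 5 up (d t) - taylor_poly 5 um (d t)) t0 / fact p
                 = g p) \<and>
         (\<forall>p\<le>4. (deriv ^^ p) (\<lambda>t. (ap t * ux up t - am t * ux um t) * deriv s t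
                   + (ap t * uy up t - am t * uy um t) * (- deriv r t)) t0 / fact p
                 = gG p))"

(* The solution of that system, normalised to vanish at the irrelevant indices outside Lam1 5. *)
definition transmission_solution :: "(real \<times> real) set \<Rightarrow> (real \<times> real) set \<Rightarrow> (real \<times> real \<Rightarrow> real)
    \<Rightarrow> (real \<Rightarrow> real) \<Rightarrow> (real \<Rightarrow> real) \<Rightarrow> real
    \<Rightarrow> (nat \<Rightarrow> nat \<Rightarrow> real) \<Rightarrow> (nat \<Rightarrow> nat \<Rightarrow> real) \<Rightarrow> (nat \<Rightarrow> nat \<Rightarrow> real)
    \<Rightarrow> (nat \<Rightarrow> real) \<Rightarrow> (nat \<Rightarrow> real) \<Rightarrow> nat \<Rightarrow> nat \<Rightarrow> real" where
  "transmission_solution Op Om a r s t0 U Fp Fm g gG =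
     (THE V. (\<forall>m n. (m, n) \<notin> Lam1 5 \<longrightarrow> V m n = 0) \<and>
             transmission_system Op Om a r s t0 U Fp Fm g gG V)"

definition unit2 :: "nat \<Rightarrow> nat \<Rightarrow> nat \<Rightarrow> nat \<Rightarrow> real" where
  "unit2 m n = (\<lambda>m' n'. if (m', n') = (m, n) then 1 else 0)"

definition unit1 :: "nat \<Rightarrow> nat \<Rightarrow> real" where
  "unit1 p = (\<lambda>p'. if p' = p then 1 else 0)"

(* Being the coefficients of the solution as a linear function of the data, the transmission
   coefficients are the solutions for unit data. In Tu etc. the first two indices are (m',n'). *)
definition Tu :: "(real \<times> real) set \<Rightarrow> (real \<times> real) set \<Rightarrow> (real \<times> real \<Rightarrow> real)
    \<Rightarrow> (real \<Rightarrow> real) \<Rightarrow> (real \<Rightarrow> real) \<Rightarrow> real \<Rightarrow> nat \<Rightarrow> nat \<Rightarrow> nat \<Rightarrow> nat \<Rightarrow> real" where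
  "Tu Op Om a r s t0 m' n' m n =
     transmission_solution Op Om a r s t0 (unit2 m n) (\<lambda>_ _. 0) (\<lambda>_ _. 0) (\<lambda>_. 0) (\<lambda>_. 0) m' n'"

definition Tp :: "(real \<times> real) set \<Rightarrow> (real \<times> real) set \<Rightarrow> (real \<times> real \<Rightarrow> real)
    \<Rightarrow> (real \<Rightarrow> real) \<Rightarrow> (real \<Rightarrow> real) \<Rightarrow> real \<Rightarrow> nat \<Rightarrow> nat \<Rightarrow> nat \<Rightarrow> nat \<Rightarrow> real" where
  "Tp Op Om a r s t0 m' n' m n =
     transmission_solution Op Om a r s t0 (\<lambda>_ _. 0) (unit2 m n) (\<lambda>_ _. 0) (\<lambda>_. 0) (\<lambda>_. 0) m' n'"

definition Tm :: "(real \<times> real) set \<Rightarrow> (real \<times> real) set \<Rightarrow> (real \<times> real \<Rightarrow> real)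
    \<Rightarrow> (real \<Rightarrow> real) \<Rightarrow> (real \<Rightarrow> real) \<Rightarrow> real \<Rightarrow> nat \<Rightarrow> nat \<Rightarrow> nat \<Rightarrow> nat \<Rightarrow> real" where
  "Tm Op Om a r s t0 m' n' m n =
     transmission_solution Op Om a r s t0 (\<lambda>_ _. 0) (\<lambda>_ _. 0) (unit2 m n) (\<lambda>_. 0) (\<lambda>_. 0) m' n'"

definition Tg :: "(real \<times> real) set \<Rightarrow> (real \<times> real) set \<Rightarrow> (real \<times> real \<Rightarrow> real)
    \<Rightarrow> (real \<Rightarrow> real) \<Rightarrow> (real \<Rightarrow> real) \<Rightarrow> real \<Rightarrow> nat \<Rightarrow> nat \<Rightarrow> nat \<Rightarrow> real" where
  "Tg Op Om a r s t0 m' n' p =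
     transmission_solution Op Om a r s t0 (\<lambda>_ _. 0) (\<lambda>_ _. 0) (\<lambda>_ _. 0) (unit1 p) (\<lambda>_. 0) m' n'"

definition TgG :: "(real \<times> real) set \<Rightarrow> (real \<times> real) set \<Rightarrow> (real \<times> real \<Rightarrow> real)
    \<Rightarrow> (real \<Rightarrow> real) \<Rightarrow> (real \<Rightarrow> real) \<Rightarrow> real \<Rightarrow> nat \<Rightarrow> nat \<Rightarrow> nat \<Rightarrow> real" where
  "TgG Op Om a r s t0 m' n' p =
     transmission_solution Op Om a r s t0 (\<lambda>_ _. 0) (\<lambda>_ _. 0) (\<lambda>_ _. 0) (\<lambda>_. 0) (unit1 p) m' n'"

definition g_coef :: "(real \<Rightarrow> real) \<Rightarrow> (real \<Rightarrow> real) \<Rightarrow> real \<Rightarrow> (real \<times> real \<Rightarrow> real) \<Rightarrow> nat \<Rightarrow> real" where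
  "g_coef r s t0 g p = (deriv ^^ p) (\<lambda>t. g (r t, s t)) t0 / fact p"

definition gG_coef :: "(real \<Rightarrow> real) \<Rightarrow> (real \<Rightarrow> real) \<Rightarrow> real \<Rightarrow> (real \<times> real \<Rightarrow> real) \<Rightarrow> nat \<Rightarrow> real" where
  "gG_coef r s t0 gG p =
     (deriv ^^ p) (\<lambda>t. gG (r t, s t) * sqrt ((deriv r t)\<^sup>2 + (deriv s t)\<^sup>2)) t0 / fact p"

section \<open>The scheme\<close>

(* C_{k,l} as a polynomial in h, where c (k, l) p is c_{k,l,p}. *)
definition Cpoly :: "(int \<times> int \<Rightarrow> nat \<Rightarrow> real) \<Rightarrow> int \<times> int \<Rightarrow> real poly" where
  "Cpoly c kl = (\<Sum>p=0..5. monom (c kl p) p)"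

(* I_{m,n} and the first term of h J_{m,n}, as polynomials in h with v_0, w_0 and the
   index set D fixed. *)
definition Ipoly :: "(real \<times> real) set \<Rightarrow> (real \<times> real \<Rightarrow> real) \<Rightarrow> real \<times> real
    \<Rightarrow> (int \<times> int) set \<Rightarrow> real \<Rightarrow> real \<Rightarrow> (int \<times> int \<Rightarrow> nat \<Rightarrow> real) \<Rightarrow> nat \<Rightarrow> nat \<Rightarrow> real poly" where
  "Ipoly S a z D v0 w0 c m n =
     (\<Sum>(k, l)\<in>D. Cpoly c (k, l) * G5 S a z m n [:0, v0 + real_of_int k:] [:0, w0 + real_of_int l:])"

definition Hpoly :: "(real \<times> real) set \<Rightarrow> (real \<times> real \<Rightarrow> real) \<Rightarrow> real \<times> real
    \<Rightarrow> (int \<times> int) set \<Rightarrow> real \<Rightarrow> real \<Rightarrow> (int \<times> int \<Rightarrow> nat \<Rightarrow> real) \<Rightarrow> nat \<Rightarrow> nat \<Rightarrow> real poly" where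
  "Hpoly S a z D v0 w0 c m n =
     (\<Sum>(k, l)\<in>D. Cpoly c (k, l) * H5 S a z m n [:0, v0 + real_of_int k:] [:0, w0 + real_of_int l:])"

(* The linear system for c; IP, IM are the families I^+, I^-. *)
definition coeff_system :: "(nat \<Rightarrow> nat \<Rightarrow> real poly) \<Rightarrow> (nat \<Rightarrow> nat \<Rightarrow> real poly)
    \<Rightarrow> (nat \<Rightarrow> nat \<Rightarrow> nat \<Rightarrow> nat \<Rightarrow> real) \<Rightarrow> bool" where
  "coeff_system IP IM T \<longleftrightarrow>
     (\<forall>(m, n)\<in>Lam1 5. \<forall>e<6.
        coeff (IP m n + (\<Sum>(m', n')\<in>{(m', n') \<in> Lam1 5. m' + n' \<ge> m + n}.
                            smult (T m' n' m n) (IM m' n'))) e = 0)"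

definition nontrivial :: "(int \<times> int \<Rightarrow> nat \<Rightarrow> real) \<Rightarrow> bool" where
  "nontrivial c \<longleftrightarrow> (\<exists>kl\<in>stencil. c kl 0 \<noteq> 0)"

(* L_h applied to the grid values U (k, l) at the stencil points. *)
definition Lh :: "real \<Rightarrow> (int \<times> int \<Rightarrow> nat \<Rightarrow> real) \<Rightarrow> (int \<times> int \<Rightarrow> real) \<Rightarrow> real" where
  "Lh h c U =
     (\<Sum>k\<in>{-1..1}. \<Sum>l\<in>{-1..1}. poly (Cpoly c (k, l)) h * U (k, l))
     + (\<Sum>k\<in>{-2, 2}. poly (Cpoly c (k, 0)) h * U (k, 0))
     + (\<Sum>l\<in>{-2, 2}. poly (Cpoly c (0, l)) h * U (0, l))"

definition exact_val :: "(real \<times> real) set \<Rightarrow> (real \<times> real) set \<Rightarrow> (real \<times> real \<Rightarrow> real)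
    \<Rightarrow> (real \<times> real \<Rightarrow> real) \<Rightarrow> real \<Rightarrow> real \<times> real \<Rightarrow> int \<times> int \<Rightarrow> real" where
  "exact_val Op Om \<psi> u h z kl =
     (if kl \<in> dp' \<psi> h z then side_val Op u (shift h z kl) else side_val Om u (shift h z kl))"

(* J^+ and J^- (D is the family Hpoly of the respective side, T is T^+ or T^-), and J^g, J^{g_\<Gamma>}. *)
definition Jf :: "real \<Rightarrow> (nat \<Rightarrow> nat \<Rightarrow> real poly) \<Rightarrow> (nat \<Rightarrow> nat \<Rightarrow> real poly)
    \<Rightarrow> (nat \<Rightarrow> nat \<Rightarrow> nat \<Rightarrow> nat \<Rightarrow> real) \<Rightarrow> nat \<Rightarrow> nat \<Rightarrow> real" where
  "Jf h D IM T m n =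
     inverse h * poly (D m n) h
     + inverse h * (\<Sum>(m', n')\<in>Lam1 5. poly (IM m' n') h * T m' n' m n)"

definition Jg :: "real \<Rightarrow> (nat \<Rightarrow> nat \<Rightarrow> real poly) \<Rightarrow> (nat \<Rightarrow> nat \<Rightarrow> nat \<Rightarrow> real) \<Rightarrow> nat \<Rightarrow> real" where
  "Jg h IM T p = inverse h * (\<Sum>(m', n')\<in>Lam1 5. poly (IM m' n') h * T m' n' p)"

end

theory Submission
  imports Defs "HOL-Library.Landau_Symbols"
begin

text \<open>The exact values at the stencil points are expanded around the interface point, separately on
  each side. The Taylor estimate on a side needs only a path of comparable length that is parallel
  to the axes and stays on that side; the interface being a Lipschitz graph over one of the axes
  near the point, such paths exist. The equation reduces all one-sided derivatives to those with at
  most one differentiation in \<open>x\<close>, up to derivatives of \<open>f\<close>. Since the jump relations along the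
  curve agree with those of the Taylor polynomials to high order, the one-sided jets solve the
  transmission system. That system is triangular in the order of differentiation, and its diagonal
  blocks are rotations by powers of \<open>s' + \<i>r'\<close>, because a solution is harmonic to leading order.
  Hence it is uniquely solvable, derivatives of \<open>u\<^sub>+\<close> of higher order do not enter, and eliminating
  \<open>u\<^sub>-\<close> leaves exactly the polynomials which the linear system for \<open>c\<close> makes vanish to sixth order.\<close>

section \<open>Differentiable functions of one variable\<close>

text \<open>Each \<open>has_partials\<close> hypothesis speaks of derivatives along the axes at
  points of an open side, never at the interface, and a side need not be convex near
  \<open>P\<close>. Hence the paths parallel to the axes: on each leg a mean value bound in one
  variable applies, and only the start at \<open>P\<close> has to be reached by a limit. Along the
  curve neither one-sided trace of \<open>u\<close> is known in advance to be differentiable; only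
  the jumps are, through the regularity of \<open>g\<close> and \<open>gG\<close>. The jumps are
  therefore compared as a whole with those of the Taylor polynomials, and derivatives at
  \<open>t0\<close> are read off from orders of vanishing. The value relation of order
  \<open>N + 1\<close> and the flux relation of order \<open>N\<close> form one complex equation for
  the leading coefficient: the former is its real part, the latter its imaginary part up to a factor
  containing \<open>a\<close> on the minus side. The final constant has to be fixed before
  \<open>h\<close>, the position of the grid point, the splitting of the stencil and
  \<open>c\<close>. A norm on polynomials in \<open>h\<close> supplies bounds that depend on
  \<open>c\<close> only through \<open>M\<close>.\<close>

primrec Ck_on :: "nat \<Rightarrow> real set \<Rightarrow> (real \<Rightarrow> real) \<Rightarrow> bool" where
  "Ck_on 0 J f \<longleftrightarrow> continuous_on J f"
| "Ck_on (Suc n) J f \<longleftrightarrow> (\<forall>t\<in>J. f differentiable (at t)) \<and> Ck_on n J (deriv f)"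

lemma deriv_eq_on_open:
  assumes "open J" "\<And>t. t \<in> J \<Longrightarrow> f t = g t" "t \<in> J"
  shows "deriv f t = deriv g t"
  by (rule deriv_cong_ev) (use eventually_nhds_in_open[OF assms(1,3)] assms(2) in
      \<open>auto elim: eventually_mono\<close>)

lemma differentiable_eq_on_open:
  fixes f g :: "real \<Rightarrow> real"
  assumes "open J" "\<And>t. t \<in> J \<Longrightarrow> f t = g t" "t \<in> J" "g differentiable (at t)"
  shows "f differentiable (at t)"
proof -
  obtain D where "(g has_real_derivative D) (at t)"
    using assms(4) by (auto simp: real_differentiable_def)
  then have "(f has_real_derivative D) (at t)"
    by (rule has_field_derivative_transform_within_open) (use assms in auto)
  then show ?thesis by (auto simp: real_differentiable_def)
qed

lemma higher_deriv_eq_on_open: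
  assumes "open J" "\<And>t. t \<in> J \<Longrightarrow> f t = g t" "t \<in> J"
  shows "(deriv ^^ p) f t = (deriv ^^ p) g t"
  using assms(3)
proof (induction p arbitrary: t)
  case (Suc p)
  then show ?case by (auto intro: deriv_eq_on_open[OF assms(1)])
qed (use assms in auto)

lemma Ck_on_cong:
  assumes "open J" "\<And>t. t \<in> J \<Longrightarrow> f t = g t" "Ck_on n J g"
  shows "Ck_on n J f"
  using assms(2,3)
proof (induction n arbitrary: f g)
  case 0
  then show ?case using continuous_on_cong by (metis Ck_on.simps(1))
next
  case (Suc n)
  have "deriv f t = deriv g t" if "t \<in> J" for t
    by (rule deriv_eq_on_open[OF assms(1)]) (use Suc.prems that in auto)
  then have "Ck_on n J (deriv f)"
    using Suc.IH[of "deriv f" "deriv g"] Suc.prems by auto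
  moreover have "f differentiable (at t)" if "t \<in> J" for t
    by (rule differentiable_eq_on_open[OF assms(1) _ that]) (use Suc.prems that in auto)
  ultimately show ?case by simp
qed

lemma Ck_on_continuous: "Ck_on n J f \<Longrightarrow> continuous_on J f"
  by (cases n) (auto simp: continuous_on_eq_continuous_within
      intro: differentiable_imp_continuous_within continuous_at_imp_continuous_at_within)

lemma Ck_on_Suc_imp: "Ck_on (Suc n) J f \<Longrightarrow> Ck_on n J f"
  by (induction n arbitrary: f) (metis Ck_on_continuous Ck_on.simps(1), simp)

lemma Ck_on_le: "Ck_on n J f \<Longrightarrow> m \<le> n \<Longrightarrow> Ck_on m J f"
  by (induction n) (use Ck_on_Suc_imp le_Suc_eq in blast)+

lemma Ck_on_DERIV:
  "Ck_on (Suc n) J f \<Longrightarrow> t \<in> J \<Longrightarrow> (f has_real_derivative deriv f t) (at t)"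
  by (simp add: DERIV_deriv_iff_real_differentiable)

lemma Ck_on_const: "Ck_on n J (\<lambda>_. c)"
  by (induction n arbitrary: c) auto

text \<open>The closure properties below all use this form: a derivative formula valid on the open
  set \<open>J\<close> suffices, since neither \<open>deriv\<close> at points of \<open>J\<close>
  nor \<open>Ck_on\<close> sees values outside \<open>J\<close>.\<close>

lemma Ck_on_SucI:
  assumes "open J" "\<And>t. t \<in> J \<Longrightarrow> (f has_real_derivative f' t) (at t)" "Ck_on n J f'"
  shows "Ck_on (Suc n) J f"
proof -
  have "Ck_on n J (deriv f)"
    by (rule Ck_on_cong[OF assms(1) _ assms(3)]) (use assms(2) DERIV_imp_deriv in blast)
  then show ?thesis using assms(2) by (auto simp: real_differentiable_def)
qed

lemma Ck_on_add:
  assumes "open J" "Ck_on n J f" "Ck_on n J g" shows "Ck_on n J (\<lambda>t. f t + g t)"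
  using assms(2,3)
proof (induction n arbitrary: f g)
  case (Suc n)
  show ?case
    by (rule Ck_on_SucI[OF assms(1), where f' = "\<lambda>t. deriv f t + deriv g t"])
      (use Suc Ck_on_DERIV in \<open>auto intro!: DERIV_add\<close>)
qed (auto intro: continuous_intros)

lemma Ck_on_mult:
  assumes "open J" "Ck_on n J f" "Ck_on n J g" shows "Ck_on n J (\<lambda>t. f t * g t)"
  using assms(2,3)
proof (induction n arbitrary: f g)
  case (Suc n)
  show ?case
  proof (rule Ck_on_SucI[OF assms(1), where f' = "\<lambda>t. deriv f t * g t + deriv g t * f t"])
    show "Ck_on n J (\<lambda>t. deriv f t * g t + deriv g t * f t)"
      using Suc Ck_on_Suc_imp by (intro Ck_on_add[OF assms(1)]) (auto simp del: Ck_on.simps(2) simp: Ck_on.simps(2)[of _ _ f] Ck_on.simps(2)[of _ _ g])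
  qed (use Suc.prems Ck_on_DERIV in \<open>blast intro: DERIV_mult\<close>)
qed (auto intro: continuous_intros)

lemma Ck_on_cmult: "open J \<Longrightarrow> Ck_on n J f \<Longrightarrow> Ck_on n J (\<lambda>t. c * f t)"
  by (intro Ck_on_mult Ck_on_const)

lemma Ck_on_diff:
  assumes "open J" "Ck_on n J f" "Ck_on n J g" shows "Ck_on n J (\<lambda>t. f t - g t)"
  using Ck_on_add[OF assms(1,2) Ck_on_cmult[OF assms(1,3), of "-1"]] by simp

lemma Ck_on_power: "open J \<Longrightarrow> Ck_on n J f \<Longrightarrow> Ck_on n J (\<lambda>t. f t ^ k)"
  by (induction k) (auto intro: Ck_on_const Ck_on_mult)

lemma Ck_on_sum:
  "open J \<Longrightarrow> (\<And>i. i \<in> A \<Longrightarrow> Ck_on n J (f i)) \<Longrightarrow> Ck_on n J (\<lambda>t. \<Sum>i\<in>A. f i t)"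
  by (induction A rule: infinite_finite_induct) (auto intro: Ck_on_const Ck_on_add)

lemma Ck_on_inverse:
  assumes "open J" "Ck_on n J f" "\<And>t. t \<in> J \<Longrightarrow> f t \<noteq> 0" shows "Ck_on n J (\<lambda>t. inverse (f t))"
  using assms(2)
proof (induction n)
  case (Suc n)
  have IH: "Ck_on n J (\<lambda>t. inverse (f t))" using Suc Ck_on_Suc_imp by blast
  show ?case
  proof (rule Ck_on_SucI[OF assms(1), where f' = "\<lambda>t. -1 * (inverse (f t) * deriv f t * inverse (f t))"])
    show "Ck_on n J (\<lambda>t. -1 * (inverse (f t) * deriv f t * inverse (f t)))"
      using Suc.prems by (intro Ck_on_cmult Ck_on_mult IH assms(1)) simp
  qed (use Suc.prems Ck_on_DERIV assms(3) in \<open>force intro: DERIV_inverse'\<close>)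
qed (use assms in \<open>auto intro: continuous_intros\<close>)

text \<open>Serves the arc length factor in \<open>gG_coef\<close>. Writing the derivative through
  the inverse of the root itself lets the induction hypothesis apply to it.\<close>

lemma Ck_on_sqrt:
  assumes "open J" "Ck_on n J f" "\<And>t. t \<in> J \<Longrightarrow> f t > 0" shows "Ck_on n J (\<lambda>t. sqrt (f t))"
  using assms(2)
proof (induction n)
  case (Suc n)
  have IH: "Ck_on n J (\<lambda>t. sqrt (f t))" using Suc Ck_on_Suc_imp by blast
  have pos: "sqrt (f t) \<noteq> 0" if "t \<in> J" for t using assms(3)[OF that] by simp
  show ?case
  proof (rule Ck_on_SucI[OF assms(1), where f' = "\<lambda>t. inverse 2 * (inverse (sqrt (f t)) * deriv f t)"])
    show "Ck_on n J (\<lambda>t. inverse 2 * (inverse (sqrt (f t)) * deriv f t))"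
      using Suc.prems pos by (intro Ck_on_cmult Ck_on_mult Ck_on_inverse IH assms(1)) simp_all
    fix t assume t: "t \<in> J"
    have "((\<lambda>t. sqrt (f t)) has_real_derivative (inverse (sqrt (f t)) / 2) * deriv f t) (at t)"
      by (rule DERIV_chain2[OF DERIV_real_sqrt[OF assms(3)[OF t]] Ck_on_DERIV[OF Suc.prems t]])
    then show "((\<lambda>t. sqrt (f t)) has_real_derivative inverse 2 * (inverse (sqrt (f t)) * deriv f t)) (at t)"
      by (simp add: field_simps)
  qed
qed (use assms in \<open>auto intro: continuous_intros\<close>)

text \<open>\<open>deriv\<close> is additive only where both functions are differentiable, and the
  next derivative needs the identity on a neighbourhood; so \<open>t\<close> ranges over all of
  \<open>J\<close> in the induction.\<close>

lemma higher_deriv_linear: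
  assumes "open J" "Ck_on p J f" "Ck_on p J g" "t \<in> J"
  shows "(deriv ^^ p) (\<lambda>t. x * f t + y * g t) t = x * (deriv ^^ p) f t + y * (deriv ^^ p) g t"
  using assms(2-4)
proof (induction p arbitrary: f g t)
  case (Suc p)
  have "deriv (\<lambda>t. x * f t + y * g t) t = x * deriv f t + y * deriv g t" if "t \<in> J" for t
    by (intro DERIV_imp_deriv DERIV_add DERIV_cmult
        Ck_on_DERIV[OF Suc.prems(1) that] Ck_on_DERIV[OF Suc.prems(2) that])
  then have "(deriv ^^ p) (deriv (\<lambda>t. x * f t + y * g t)) t
      = (deriv ^^ p) (\<lambda>t. x * deriv f t + y * deriv g t) t"
    by (rule higher_deriv_eq_on_open[OF assms(1)]) (use Suc.prems in auto)
  also have "\<dots> = x * (deriv ^^ p) (deriv f) t + y * (deriv ^^ p) (deriv g) t"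
    using Suc by simp
  finally show ?case by (simp add: funpow_Suc_right del: funpow.simps)
qed simp

lemma uc_derivs_Ck_on:
  assumes "open J" "uc_derivs K J f" shows "Ck_on K J f"
  using assms(2)
proof (induction K arbitrary: f)
  case 0
  then show ?case by (auto simp: uc_derivs_def intro: uniformly_continuous_imp_continuous)
next
  case (Suc K)
  have "uc_derivs K J (deriv f)"
    unfolding uc_derivs_def
  proof (intro conjI allI impI ballI)
    fix p assume "p \<le> K"
    then show "uniformly_continuous_on J ((deriv ^^ p) (deriv f))"
      using Suc.prems unfolding uc_derivs_def
      by (metis Suc_le_mono comp_apply funpow_Suc_right)
  next
    fix p t assume "p < K" "t \<in> J"
    then show "(deriv ^^ p) (deriv f) differentiable at t"
      using Suc.prems unfolding uc_derivs_def
      by (metis Suc_less_eq comp_apply funpow_Suc_right)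
  qed
  moreover have "\<forall>t\<in>J. f differentiable at t"
    using Suc.prems unfolding uc_derivs_def by (metis funpow_0 zero_less_Suc)
  ultimately show ?case using Suc.IH by simp
qed

text \<open>Iterated l'Hopital: each step trades one power of \<open>t - t0\<close> for one
  derivative, and continuity of the \<open>n\<close>-th derivative settles the last
  quotient.\<close>

lemma lower_derivs_zero_imp_tendsto:
  assumes "open J" "t0 \<in> J" "Ck_on n J f" "\<And>q. q < n \<Longrightarrow> (deriv ^^ q) f t0 = 0"
  shows "((\<lambda>t. f t / (t - t0) ^ n) \<longlongrightarrow> (deriv ^^ n) f t0 / fact n) (at t0)"
  using assms(3,4)
proof (induction n arbitrary: f)
  case 0
  then have "isCont f t0" using assms(1,2) by (simp add: continuous_on_eq_continuous_at)
  then show ?case by (simp add: isCont_def)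
next
  case (Suc n)
  have nhd: "\<forall>\<^sub>F t in at t0. t \<in> J"
    using assms(1,2) by (simp add: eventually_at_topological) blast
  have ne: "\<forall>\<^sub>F t in at t0. t \<noteq> t0" by (simp add: eventually_at_filter)
  have IH: "((\<lambda>t. deriv f t / (t - t0) ^ n) \<longlongrightarrow> (deriv ^^ n) (deriv f) t0 / fact n) (at t0)"
  proof (rule Suc.IH)
    show "(deriv ^^ q) (deriv f) t0 = 0" if "q < n" for q
      using Suc.prems(2)[of "Suc q"] that by (simp add: funpow_Suc_right del: funpow.simps)
  qed (use Suc.prems in simp)
  have "isCont f t0"
    using Ck_on_continuous[OF Suc.prems(1)] assms(1,2) by (simp add: continuous_on_eq_continuous_at)
  moreover have "f t0 = 0" using Suc.prems(2)[of 0] by simp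
  ultimately have f0: "(f \<longlongrightarrow> 0) (at t0)" by (simp add: isCont_def)
  have "((\<lambda>t. f t / (t - t0) ^ Suc n) \<longlongrightarrow> (deriv ^^ n) (deriv f) t0 / fact n / real (Suc n)) (at t0)"
  proof (rule lhopital[OF f0])
    have "((\<lambda>t. (t - t0) ^ Suc n) \<longlongrightarrow> (t0 - t0) ^ Suc n) (at t0)" by (intro tendsto_intros)
    then show "((\<lambda>t. (t - t0) ^ Suc n) \<longlongrightarrow> 0) (at t0)" by simp
    show "\<forall>\<^sub>F t in at t0. (t - t0) ^ Suc n \<noteq> 0" using ne by eventually_elim simp
    show "\<forall>\<^sub>F t in at t0. real (Suc n) * (t - t0) ^ n \<noteq> 0" using ne by eventually_elim simp
    show "\<forall>\<^sub>F t in at t0. (f has_real_derivative deriv f t) (at t)"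
      using nhd by eventually_elim (use Suc.prems Ck_on_DERIV in blast)
    have "((\<lambda>t. (t - t0) ^ Suc n) has_real_derivative real (Suc n) * (t - t0) ^ n) (at t)" for t
      by (rule DERIV_cong[OF DERIV_power_Suc[where f = "\<lambda>t. t - t0" and D = 1]])
         (auto intro!: derivative_eq_intros)
    then show "\<forall>\<^sub>F t in at t0. ((\<lambda>t. (t - t0) ^ Suc n) has_real_derivative
        real (Suc n) * (t - t0) ^ n) (at t)" by simp
    have "((\<lambda>t. deriv f t / (t - t0) ^ n / real (Suc n)) \<longlongrightarrow>
        (deriv ^^ n) (deriv f) t0 / fact n / real (Suc n)) (at t0)"
      by (intro tendsto_divide IH tendsto_const) simp
    then show "((\<lambda>t. deriv f t / (real (Suc n) * (t - t0) ^ n)) \<longlongrightarrow>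
        (deriv ^^ n) (deriv f) t0 / fact n / real (Suc n)) (at t0)"
      by (simp add: divide_divide_eq_left mult.commute)
  qed
  then show ?case by (simp add: funpow_Suc_right fact_Suc divide_divide_eq_left mult.commute del: funpow.simps)
qed

text \<open>By strong induction the quotient by the \<open>q\<close>-th power tends to the scaled
  \<open>q\<close>-th derivative; it also tends to zero, being the given quotient times a positive
  power of \<open>t - t0\<close>. Higher derivatives of compositions with the curve are computed
  from this, without a chain rule.\<close>

lemma tendsto_imp_derivs:
  assumes "open J" "t0 \<in> J" "Ck_on n J f" "((\<lambda>t. f t / (t - t0) ^ n) \<longlongrightarrow> c) (at t0)"
  shows "\<And>q. q < n \<Longrightarrow> (deriv ^^ q) f t0 = 0" and "(deriv ^^ n) f t0 / fact n = c"
proof -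
  show zero: "(deriv ^^ q) f t0 = 0" if "q < n" for q
    using that
  proof (induction q rule: less_induct)
    case (less q)
    have "((\<lambda>t. f t / (t - t0) ^ q) \<longlongrightarrow> (deriv ^^ q) f t0 / fact q) (at t0)"
      by (rule lower_derivs_zero_imp_tendsto[OF assms(1,2)])
         (use less assms(3) Ck_on_le in \<open>auto intro: Ck_on_le\<close>)
    moreover have "((\<lambda>t. f t / (t - t0) ^ n * (t - t0) ^ (n - q)) \<longlongrightarrow> c * (t0 - t0) ^ (n - q)) (at t0)"
      by (intro tendsto_intros assms(4))
    then have "((\<lambda>t. f t / (t - t0) ^ n * (t - t0) ^ (n - q)) \<longlongrightarrow> 0) (at t0)"
      using less.prems by (simp add: zero_power)
    then have "((\<lambda>t. f t / (t - t0) ^ q) \<longlongrightarrow> 0) (at t0)"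
    proof (rule Lim_transform_eventually)
      have "f t / (t - t0) ^ n * (t - t0) ^ (n - q) = f t / (t - t0) ^ q" if "t \<noteq> t0" for t
      proof -
        have "(t - t0) ^ n = (t - t0) ^ q * (t - t0) ^ (n - q)"
          using less.prems by (simp flip: power_add)
        then show ?thesis using that by simp
      qed
      then show "\<forall>\<^sub>F t in at t0. f t / (t - t0) ^ n * (t - t0) ^ (n - q) = f t / (t - t0) ^ q"
        by (simp add: eventually_at_filter)
    qed
    ultimately have "(deriv ^^ q) f t0 / fact q = 0" by (rule LIM_unique)
    then show ?case by simp
  qed
  show "(deriv ^^ n) f t0 / fact n = c"
    by (rule LIM_unique[OF lower_derivs_zero_imp_tendsto[OF assms(1-3) zero] assms(4)])
qed

text \<open>One order of vanishing more than there are derivatives makes the quotient by the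
  \<open>n\<close>-th power tend to zero. Applied to the difference between jump data and Taylor
  polynomials.\<close>

lemma bigo_imp_derivs_zero:
  assumes "open J" "t0 \<in> J" "Ck_on n J f" "p \<le> n" "f \<in> O[at t0](\<lambda>t. (t - t0) ^ Suc n)"
  shows "(deriv ^^ p) f t0 = 0"
proof -
  obtain C where "\<forall>\<^sub>F t in at t0. norm (f t) \<le> C * norm ((t - t0) ^ Suc n)"
    using assms(5) unfolding bigo_def by blast
  then have ev: "\<forall>\<^sub>F t in at t0. \<bar>f t\<bar> \<le> C * \<bar>t - t0\<bar> ^ Suc n"
    by (simp add: power_abs abs_mult)
  have "((\<lambda>t. f t / (t - t0) ^ n) \<longlongrightarrow> 0) (at t0)"
  proof (rule Lim_null_comparison)
    show "\<forall>\<^sub>F t in at t0. norm (f t / (t - t0) ^ n) \<le> C * \<bar>t - t0\<bar>"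
      using ev eventually_neq_at_within[of t0]
    proof eventually_elim
      case (elim t)
      then show ?case by (simp add: abs_divide power_abs divide_le_eq algebra_simps)
    qed
    have "((\<lambda>t. C * \<bar>t - t0\<bar>) \<longlongrightarrow> C * \<bar>t0 - t0\<bar>) (at t0)" by (intro tendsto_intros)
    then show "((\<lambda>t. C * \<bar>t - t0\<bar>) \<longlongrightarrow> 0) (at t0)" by simp
  qed
  from tendsto_imp_derivs[OF assms(1-3) this] show ?thesis
    using assms(4) by (cases "p < n") auto
qed

section \<open>Partial derivatives and one-sided values\<close>

lemma has_partials_imp: "has_partials Q S K F \<Longrightarrow> Q F"
  by (cases K) auto

lemma has_partials_Suc_imp: "has_partials Q S (Suc K) F \<Longrightarrow> has_partials Q S K F"
proof (induction K arbitrary: F)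
  case (Suc K)
  then show ?case by (metis has_partials.simps(2))
qed simp

lemma has_partials_le: "has_partials Q S K F \<Longrightarrow> k \<le> K \<Longrightarrow> has_partials Q S k F"
  by (induction K) (use has_partials_Suc_imp le_Suc_eq in blast)+

lemma has_partials_mono:
  "(\<And>F. Q F \<Longrightarrow> Q' F) \<Longrightarrow> has_partials Q S K F \<Longrightarrow> has_partials Q' S K F"
  by (induction K arbitrary: F) auto

lemma has_partials_Dy_pow: "has_partials Q S (n + K) F \<Longrightarrow> has_partials Q S K ((Dy ^^ n) F)"
proof (induction n arbitrary: K)
  case (Suc n)
  then have "has_partials Q S (Suc K) ((Dy ^^ n) F)" by (metis add_Suc add_Suc_right)
  then show ?case by simp
qed simp

lemma has_partials_Dxy: "has_partials Q S (m + n + K) F \<Longrightarrow> has_partials Q S K (Dxy m n F)"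
  unfolding Dxy_def
proof (induction m arbitrary: K)
  case (Suc m)
  then have "has_partials Q S (Suc K) ((Dx ^^ m) ((Dy ^^ n) F))"
    by (metis add_Suc add_Suc_right)
  then show ?case by simp
qed (auto intro: has_partials_Dy_pow)

lemma has_partials_DERIV_x:
  "has_partials Q S (Suc K) F \<Longrightarrow> z \<in> S \<Longrightarrow>
    ((\<lambda>x. F (x, snd z)) has_real_derivative Dx F z) (at (fst z))"
  by (auto simp: Dx_def DERIV_deriv_iff_real_differentiable)

lemma has_partials_DERIV_y:
  "has_partials Q S (Suc K) F \<Longrightarrow> z \<in> S \<Longrightarrow>
    ((\<lambda>y. F (fst z, y)) has_real_derivative Dy F z) (at (snd z))"
  by (auto simp: Dy_def DERIV_deriv_iff_real_differentiable)

lemma Dx_eqI: "((\<lambda>x. F (x, snd z)) has_real_derivative D) (at (fst z)) \<Longrightarrow> Dx F z = D"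
  unfolding Dx_def by (rule DERIV_imp_deriv)

lemma Dy_eqI: "((\<lambda>y. F (fst z, y)) has_real_derivative D) (at (snd z)) \<Longrightarrow> Dy F z = D"
  unfolding Dy_def by (rule DERIV_imp_deriv)

section \<open>Partial derivatives on open sets: locality and symmetry\<close>

lemma open_x_slice: "open S \<Longrightarrow> open {x::real. (x, y::real) \<in> S}"
  using open_vimage[of S "\<lambda>x. (x, y)"] by (simp add: vimage_def continuous_on_Pair)

lemma open_y_slice: "open S \<Longrightarrow> open {y::real. (x::real, y) \<in> S}"
  using open_vimage[of S "\<lambda>y. (x, y)"] by (simp add: vimage_def continuous_on_Pair)

lemma Dx_cong: "open S \<Longrightarrow> (\<And>z. z \<in> S \<Longrightarrow> F z = G z) \<Longrightarrow> z \<in> S \<Longrightarrow> Dx F z = Dx G z"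
  unfolding Dx_def by (rule deriv_eq_on_open[OF open_x_slice[of S "snd z"]]) auto

lemma Dy_cong: "open S \<Longrightarrow> (\<And>z. z \<in> S \<Longrightarrow> F z = G z) \<Longrightarrow> z \<in> S \<Longrightarrow> Dy F z = Dy G z"
  unfolding Dy_def by (rule deriv_eq_on_open[OF open_y_slice[of S "fst z"]]) auto

lemma Dy_pow_cong:
  "open S \<Longrightarrow> (\<And>z. z \<in> S \<Longrightarrow> F z = G z) \<Longrightarrow> z \<in> S \<Longrightarrow> (Dy ^^ n) F z = (Dy ^^ n) G z"
  by (induction n arbitrary: z) (auto intro: Dy_cong)

lemma Dxy_cong:
  "open S \<Longrightarrow> (\<And>z. z \<in> S \<Longrightarrow> F z = G z) \<Longrightarrow> z \<in> S \<Longrightarrow> Dxy m n F z = Dxy m n G z"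
  unfolding Dxy_def by (induction m arbitrary: z) (auto intro: Dx_cong Dy_pow_cong)

text \<open>\<open>Dx F\<close> and the formula \<open>Fx\<close> agree only on \<open>S\<close>, so
  one may replace the other only under a property \<open>Q\<close> that depends on the values on
  \<open>S\<close> alone; this is the assumption \<open>cong\<close>.\<close>

lemma has_partials_SucI:
  assumes "open S" and cong: "\<And>F G. (\<And>z. z \<in> S \<Longrightarrow> F z = G z) \<Longrightarrow> Q F \<Longrightarrow> Q G"
    and "Q F"
    and x: "\<And>z. z \<in> S \<Longrightarrow> ((\<lambda>x. F (x, snd z)) has_real_derivative Fx z) (at (fst z))"
    and y: "\<And>z. z \<in> S \<Longrightarrow> ((\<lambda>y. F (fst z, y)) has_real_derivative Fy z) (at (snd z))"
    and "has_partials Q S K Fx" "has_partials Q S K Fy"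
  shows "has_partials Q S (Suc K) F"
proof -
  have *: "has_partials Q S K G" if "has_partials Q S K F" "\<And>z. z \<in> S \<Longrightarrow> F z = G z" for F G
    using that
  proof (induction K arbitrary: F G)
    case 0
    then show ?case using cong by (metis has_partials.simps(1))
  next
    case (Suc K)
    have Q: "Q G" by (rule cong[OF Suc.prems(2) has_partials_imp[OF Suc.prems(1)]])
    have "has_partials Q S K (Dx G)"
      by (rule Suc.IH[of "Dx F"]) (use Suc.prems(1) Dx_cong[OF assms(1) Suc.prems(2)] in \<open>simp_all\<close>)
    moreover have "has_partials Q S K (Dy G)"
      by (rule Suc.IH[of "Dy F"]) (use Suc.prems(1) Dy_cong[OF assms(1) Suc.prems(2)] in \<open>simp_all\<close>)
    moreover have "(\<lambda>x. G (x, snd z)) differentiable (at (fst z))" if "z \<in> S" for z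
      by (rule differentiable_eq_on_open[OF open_x_slice[OF assms(1), of "snd z"], where g = "\<lambda>x. F (x, snd z)"])
        (use Suc.prems that in auto)
    moreover have "(\<lambda>y. G (fst z, y)) differentiable (at (snd z))" if "z \<in> S" for z
      by (rule differentiable_eq_on_open[OF open_y_slice[OF assms(1), of "fst z"], where g = "\<lambda>y. F (fst z, y)"])
        (use Suc.prems that in auto)
    ultimately show ?case using Q by simp
  qed
  have "has_partials Q S K (Dx F)" by (rule *[OF assms(6)]) (use x Dx_eqI in metis)
  moreover have "has_partials Q S K (Dy F)" by (rule *[OF assms(7)]) (use y Dy_eqI in metis)
  ultimately show ?thesis using assms(3) x y
    unfolding real_differentiable_def has_partials.simps by blast
qed

text \<open>The mean value theorem in the first variable for the difference of two sections, then in
  the second variable. With the variables exchanged, the same second difference is expressed by the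
  other mixed derivative.\<close>

lemma rectangle_difference:
  fixes f fx fxy :: "real \<Rightarrow> real \<Rightarrow> real"
  assumes fx: "\<And>s t. s \<in> {x..x+k} \<Longrightarrow> t \<in> {y..y+k} \<Longrightarrow> ((\<lambda>s. f s t) has_real_derivative fx s t) (at s)"
    and fxy: "\<And>s t. s \<in> {x..x+k} \<Longrightarrow> t \<in> {y..y+k} \<Longrightarrow> (fx s has_real_derivative fxy s t) (at t)" and "k > 0"
  shows "\<exists>s\<in>{x..x+k}. \<exists>t\<in>{y..y+k}. f (x+k) (y+k) - f (x+k) y - f x (y+k) + f x y = k * k * fxy s t"
proof -
  have "\<exists>s. x < s \<and> s < x + k \<and> (f (x+k) (y+k) - f (x+k) y) - (f x (y+k) - f x y) = (x + k - x) * (fx s (y+k) - fx s y)"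
    by (rule MVT2) (use \<open>k > 0\<close> in \<open>auto intro!: DERIV_diff fx\<close>)
  then obtain s where s: "x < s" "s < x + k" "(f (x+k) (y+k) - f (x+k) y) - (f x (y+k) - f x y) = k * (fx s (y+k) - fx s y)"
    by auto
  have "\<exists>t. y < t \<and> t < y + k \<and> fx s (y+k) - fx s y = (y + k - y) * fxy s t"
    by (rule MVT2) (use \<open>k > 0\<close> s in \<open>auto intro!: fxy\<close>)
  then obtain t where "y < t" "t < y + k" "fx s (y+k) - fx s y = k * fxy s t" by auto
  with s show ?thesis by (intro bexI[of _ s] bexI[of _ t]) (auto simp: algebra_simps)
qed

text \<open>Both mixed derivatives represent the second difference over one small square, at two
  points so close to \<open>z\<close> that continuity contradicts a gap of
  \<open>2 * \<epsilon>\<close>. The symmetry is needed because \<open>has_partials\<close> admits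
  every order of differentiation while \<open>Dxy\<close> fixes one.\<close>

lemma mixed_partials_commute:
  assumes "open S" "has_partials Q S 2 F" and Q: "\<And>F. Q F \<Longrightarrow> continuous_on S F" and "z \<in> S"
  shows "Dx (Dy F) z = Dy (Dx F) z"
proof (rule ccontr)
  obtain x y where z: "z = (x, y)" by (cases z)
  assume ne: "Dx (Dy F) z \<noteq> Dy (Dx F) z"
  define \<epsilon> where "\<epsilon> = \<bar>Dx (Dy F) z - Dy (Dx F) z\<bar> / 2"
  have \<epsilon>: "\<epsilon> > 0" using ne by (simp add: \<epsilon>_def)
  have "continuous_on S (Dx (Dy F))" "continuous_on S (Dy (Dx F))"
    using assms(2) Q by (auto simp: numeral_2_eq_2)
  then have "isCont (Dx (Dy F)) z" "isCont (Dy (Dx F)) z"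
    using assms(1,4) by (auto simp: continuous_on_eq_continuous_at)
  then obtain d1 d2 where d: "d1 > 0" "d2 > 0"
    "\<And>w. dist w z < d1 \<Longrightarrow> dist (Dx (Dy F) w) (Dx (Dy F) z) < \<epsilon>"
    "\<And>w. dist w z < d2 \<Longrightarrow> dist (Dy (Dx F) w) (Dy (Dx F) z) < \<epsilon>"
    using \<epsilon> unfolding continuous_at_eps_delta by metis
  obtain d3 where d3: "d3 > 0" "ball z d3 \<subseteq> S" using assms(1,4) open_contains_ball by blast
  \<comment> \<open>A third of the smallest radius: points of the square are at distance at most
    \<open>2 * k\<close> from its corner \<open>z\<close>, strictly below that radius.\<close>
  define k where "k = min d1 (min d2 d3) / 3"
  have k: "k > 0" using d d3 by (simp add: k_def)
  have box: "dist w z < min d1 (min d2 d3)" if "w \<in> {x..x+k} \<times> {y..y+k}" for w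
  proof -
    have "dist w z \<le> \<bar>fst w - x\<bar> + \<bar>snd w - y\<bar>"
      using norm_Pair_le[of "fst w - x" "snd w - y"] by (cases w) (simp add: dist_norm z)
    also have "\<dots> \<le> 2 * k" using that by auto
    also have "\<dots> < min d1 (min d2 d3)" using k unfolding k_def by linarith
    finally show ?thesis .
  qed
  have sub: "{x..x+k} \<times> {y..y+k} \<subseteq> S"
  proof
    fix w assume "w \<in> {x..x+k} \<times> {y..y+k}"
    then have "dist w z < d3" using box by fastforce
    then show "w \<in> S" using d3(2) by (auto simp: dist_commute)
  qed
  have hp: "has_partials Q S (Suc (Suc 0)) F" "has_partials Q S (Suc 0) (Dx F)" "has_partials Q S (Suc 0) (Dy F)"
    using assms(2) by (auto simp: numeral_2_eq_2)
  have inS: "(u, v) \<in> S" if "u \<in> {x..x+k}" "v \<in> {y..y+k}" for u v using that sub by blast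
  obtain u1 v1 where w1: "u1 \<in> {x..x+k}" "v1 \<in> {y..y+k}"
    "F (x+k, y+k) - F (x+k, y) - F (x, y+k) + F (x, y) = k * k * Dy (Dx F) (u1, v1)"
    using rectangle_difference[of x k y "\<lambda>u v. F (u, v)" "\<lambda>u v. Dx F (u, v)" "\<lambda>u v. Dy (Dx F) (u, v)"]
      has_partials_DERIV_x[OF hp(1) inS] has_partials_DERIV_y[OF hp(2) inS] k by auto
  obtain v2 u2 where w2: "v2 \<in> {y..y+k}" "u2 \<in> {x..x+k}"
    "F (x+k, y+k) - F (x, y+k) - F (x+k, y) + F (x, y) = k * k * Dx (Dy F) (u2, v2)"
    using rectangle_difference[of y k x "\<lambda>v u. F (u, v)" "\<lambda>v u. Dy F (u, v)" "\<lambda>v u. Dx (Dy F) (u, v)"]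
      has_partials_DERIV_y[OF hp(1) inS] has_partials_DERIV_x[OF hp(3) inS] k by auto
  define w1 where "w1 = (u1, v1)"
  define w2 where "w2 = (u2, v2)"
  have w: "w1 \<in> {x..x+k} \<times> {y..y+k}" "w2 \<in> {x..x+k} \<times> {y..y+k}" "k * k * Dy (Dx F) w1 = k * k * Dx (Dy F) w2"
    using w1(1,2) w2(1,2) unfolding w1_def w2_def by (blast, blast, use w1(3) w2(3) in linarith)
  then have "Dy (Dx F) w1 = Dx (Dy F) w2" using k by simp
  moreover have "\<bar>Dy (Dx F) w1 - Dy (Dx F) z\<bar> < \<epsilon>" "\<bar>Dx (Dy F) w2 - Dx (Dy F) z\<bar> < \<epsilon>"
    using d(3)[of w2] d(4)[of w1] box[OF w(1)] box[OF w(2)] by (auto simp: dist_real_def)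
  ultimately show False unfolding \<epsilon>_def by (simp add: abs_if split: if_splits)
qed

lemma Dxy_Suc_x: "Dxy (Suc m) n F = Dx (Dxy m n F)"
  by (simp add: Dxy_def)

lemma Dxy_Dy: "Dxy m n (Dy F) = Dxy m (Suc n) F"
  by (simp add: Dxy_def funpow_Suc_right del: funpow.simps)

lemma Dxy_0_0 [simp]: "Dxy 0 0 F = F"
  by (simp add: Dxy_def)

lemma Dxy_Dx:
  assumes "open S" "has_partials Q S (m + n + 1) F" "\<And>F. Q F \<Longrightarrow> continuous_on S F" "z \<in> S"
  shows "Dxy m n (Dx F) z = Dxy (Suc m) n F z"
proof -
  have "(Dy ^^ n) (Dx F) z = Dx ((Dy ^^ n) F) z" if "z \<in> S" "has_partials Q S (n + 1) F" for z
    using that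
  proof (induction n arbitrary: z)
    case (Suc n)
    have "has_partials Q S (n + 1) F" by (rule has_partials_le[OF Suc.prems(2)]) simp
    then have "Dy ((Dy ^^ n) (Dx F)) z = Dy (Dx ((Dy ^^ n) F)) z"
      by (intro Dy_cong[OF assms(1) _ Suc.prems(1)]) (use Suc in auto)
    also have "\<dots> = Dx (Dy ((Dy ^^ n) F)) z"
      by (rule mixed_partials_commute[OF assms(1) _ assms(3) Suc.prems(1), symmetric])
         (use Suc.prems has_partials_Dy_pow[of Q S n 2 F] in auto)
    finally show ?case by simp
  qed simp
  moreover have "has_partials Q S (n + 1) F" by (rule has_partials_le[OF assms(2)]) simp
  ultimately have "Dxy m 0 ((Dy ^^ n) (Dx F)) z = Dxy m 0 (Dx ((Dy ^^ n) F)) z"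
    by (intro Dxy_cong[OF assms(1) _ assms(4)]) auto
  then show ?thesis by (simp add: Dxy_def funpow_Suc_right del: funpow.simps)
qed

text \<open>The one-sided limits at the interface only make sense for functions that are well behaved
  near \<open>P\<close>; this weakening of uniform continuity is closed under products and inverses.\<close>

definition tame :: "(real \<times> real) set \<Rightarrow> real \<times> real \<Rightarrow> (real \<times> real \<Rightarrow> real) \<Rightarrow> bool" where
  "tame S P F \<longleftrightarrow> continuous_on S F \<and> (\<exists>l. (F \<longlongrightarrow> l) (at P within S))"

abbreviation tame_partials :: "(real \<times> real) set \<Rightarrow> real \<times> real \<Rightarrow> nat \<Rightarrow> (real \<times> real \<Rightarrow> real) \<Rightarrow> bool" where
  "tame_partials S P \<equiv> has_partials (tame S P) S"

lemma uc_partials_tame_partials: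
  assumes "uc_partials K S F" "P \<in> closure S" shows "tame_partials S P K F"
  using assms(1) unfolding uc_partials_def
proof (rule has_partials_mono[rotated])
  fix F :: "real \<times> real \<Rightarrow> real" assume F: "uniformly_continuous_on S F"
  obtain l where "(F \<longlongrightarrow> l) (at P within S)"
    using uniformly_continuous_on_extension_at_closure[OF F assms(2)] .
  then show "tame S P F"
    unfolding tame_def using F uniformly_continuous_imp_continuous by blast
qed

text \<open>The limit branch of \<open>side_val\<close>; both agree at a point outside
  \<open>S\<close>.\<close>

definition bval :: "(real \<times> real) set \<Rightarrow> real \<times> real \<Rightarrow> (real \<times> real \<Rightarrow> real) \<Rightarrow> real" where
  "bval S P F = Lim (at P within S) F"

section \<open>Calculus of one-sided limits at a boundary point\<close>

locale boundary_point =
  fixes S :: "(real \<times> real) set" and P :: "real \<times> real"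
  assumes open_S: "open S" and P_notin: "P \<notin> S" and P_closure: "P \<in> closure S"
begin

lemma at_P_nontrivial: "at P within S \<noteq> bot"
  using P_notin P_closure by (auto simp: closure_def trivial_limit_within)

lemma side_val_eq_bval: "side_val S F P = bval S P F"
  using P_notin by (simp add: side_val_def bval_def)

lemma side_deriv_eq_bval: "side_deriv S F P m n = bval S P (Dxy m n F)"
  by (simp add: side_deriv_def side_val_eq_bval)

lemma bval_eqI: "(F \<longlongrightarrow> l) (at P within S) \<Longrightarrow> bval S P F = l"
  unfolding bval_def by (rule tendsto_Lim[OF at_P_nontrivial])

lemma tame_tendsto: "tame S P F \<Longrightarrow> (F \<longlongrightarrow> bval S P F) (at P within S)"
  unfolding tame_def using bval_eqI[of F] by auto

lemma eventually_eq_at_P: "(\<And>z. z \<in> S \<Longrightarrow> F z = G z) \<Longrightarrow> \<forall>\<^sub>F z in at P within S. F z = G z"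
  by (simp add: eventually_at_filter)

lemma bval_cong: 
  assumes "\<And>z. z \<in> S \<Longrightarrow> F z = G z" shows "bval S P F = bval S P G"
  unfolding bval_def t2_space_class.Lim_def using tendsto_cong[OF eventually_eq_at_P[of F G]] assms by simp

lemma tame_cong:
  assumes "\<And>z. z \<in> S \<Longrightarrow> F z = G z" "tame S P F" shows "tame S P G"
  using assms(2) tendsto_cong[OF eventually_eq_at_P[of F G]] continuous_on_cong[of S S F G] assms(1)
  unfolding tame_def by simp

lemma tame_const: "tame S P (\<lambda>_. c)"
  by (auto simp: tame_def)

lemma tame_add: "tame S P F \<Longrightarrow> tame S P G \<Longrightarrow> tame S P (\<lambda>z. F z + G z)"
  unfolding tame_def by (blast intro: continuous_on_add tendsto_add)

lemma tame_mult: "tame S P F \<Longrightarrow> tame S P G \<Longrightarrow> tame S P (\<lambda>z. F z * G z)"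
  unfolding tame_def by (blast intro: continuous_on_mult tendsto_mult)

lemma tame_inverse:
  "tame S P F \<Longrightarrow> (\<And>z. z \<in> S \<Longrightarrow> F z \<noteq> 0) \<Longrightarrow> bval S P F \<noteq> 0 \<Longrightarrow> tame S P (\<lambda>z. inverse (F z))"
  using tame_tendsto[of F] unfolding tame_def by (blast intro: continuous_on_inverse tendsto_inverse)

lemma bval_add: "tame S P F \<Longrightarrow> tame S P G \<Longrightarrow> bval S P (\<lambda>z. F z + G z) = bval S P F + bval S P G"
  by (intro bval_eqI tendsto_add tame_tendsto)

lemma tame_partials_SucI:
  assumes "tame S P F"
    "\<And>z. z \<in> S \<Longrightarrow> ((\<lambda>x. F (x, snd z)) has_real_derivative Fx z) (at (fst z))"
    "\<And>z. z \<in> S \<Longrightarrow> ((\<lambda>y. F (fst z, y)) has_real_derivative Fy z) (at (snd z))"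
    "tame_partials S P K Fx" "tame_partials S P K Fy"
  shows "tame_partials S P (Suc K) F"
  using open_S _ assms
proof (rule has_partials_SucI)
  show "tame S P G" if "\<And>z. z \<in> S \<Longrightarrow> F z = G z" "tame S P F" for F G
    using tame_cong[of F G] that by blast
qed

lemma tame_partials_const: "tame_partials S P K (\<lambda>_. c)"
proof (induction K arbitrary: c)
  case (Suc K)
  show ?case by (rule tame_partials_SucI[where Fx = "\<lambda>_. 0" and Fy = "\<lambda>_. 0"])
    (auto intro: tame_const Suc)
qed (simp add: tame_const)

lemma tame_partials_add:
  "tame_partials S P K F \<Longrightarrow> tame_partials S P K G \<Longrightarrow> tame_partials S P K (\<lambda>z. F z + G z)"
proof (induction K arbitrary: F G)
  case (Suc K)
  have "tame S P F" "tame S P G" using Suc.prems by auto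
  show ?case
    by (intro tame_partials_SucI[where Fx = "\<lambda>z. Dx F z + Dx G z" and Fy = "\<lambda>z. Dy F z + Dy G z"]
        tame_add DERIV_add has_partials_DERIV_x[OF Suc.prems(1)] has_partials_DERIV_x[OF Suc.prems(2)]
        has_partials_DERIV_y[OF Suc.prems(1)] has_partials_DERIV_y[OF Suc.prems(2)] Suc.IH) (use Suc.prems \<open>tame S P F\<close> \<open>tame S P G\<close> in auto)
qed (simp add: tame_add)

lemma tame_partials_mult:
  "tame_partials S P K F \<Longrightarrow> tame_partials S P K G \<Longrightarrow> tame_partials S P K (\<lambda>z. F z * G z)"
proof (induction K arbitrary: F G)
  case (Suc K)
  have t: "tame S P F" "tame S P G" using Suc.prems by auto
  have l: "tame_partials S P K F" "tame_partials S P K G"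
    using Suc.prems has_partials_Suc_imp by blast+
  show ?case
  proof (rule tame_partials_SucI[where Fx = "\<lambda>z. Dx F z * G z + Dx G z * F z"
        and Fy = "\<lambda>z. Dy F z * G z + Dy G z * F z"])
    fix z assume z: "z \<in> S"
    show "((\<lambda>x. F (x, snd z) * G (x, snd z)) has_real_derivative Dx F z * G z + Dx G z * F z) (at (fst z))"
      using DERIV_mult[OF has_partials_DERIV_x[OF Suc.prems(1) z] has_partials_DERIV_x[OF Suc.prems(2) z]]
      by simp
    show "((\<lambda>y. F (fst z, y) * G (fst z, y)) has_real_derivative Dy F z * G z + Dy G z * F z) (at (snd z))"
      using DERIV_mult[OF has_partials_DERIV_y[OF Suc.prems(1) z] has_partials_DERIV_y[OF Suc.prems(2) z]]
      by simp
  next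
    show "tame_partials S P K (\<lambda>z. Dx F z * G z + Dx G z * F z)"
      using Suc.prems l by (intro tame_partials_add Suc.IH) simp_all
    show "tame_partials S P K (\<lambda>z. Dy F z * G z + Dy G z * F z)"
      using Suc.prems l by (intro tame_partials_add Suc.IH) simp_all
  qed (rule tame_mult[OF t])
qed (simp add: tame_mult)

lemma tame_partials_inverse:
  assumes "tame_partials S P K F" "\<And>z. z \<in> S \<Longrightarrow> F z \<noteq> 0" "bval S P F \<noteq> 0"
  shows "tame_partials S P K (\<lambda>z. inverse (F z))"
  using assms(1)
proof (induction K)
  case 0
  then show ?case using assms by (simp add: tame_inverse)
next
  case (Suc K)
  have IH: "tame_partials S P K (\<lambda>z. inverse (F z))" using Suc has_partials_Suc_imp by blast
  have t: "tame S P F" using Suc.prems by auto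
  show ?case
  proof (rule tame_partials_SucI[where Fx = "\<lambda>z. (-1) * (inverse (F z) * Dx F z * inverse (F z))"
        and Fy = "\<lambda>z. (-1) * (inverse (F z) * Dy F z * inverse (F z))"])
    fix z assume z: "z \<in> S"
    show "((\<lambda>x. inverse (F (x, snd z))) has_real_derivative
        (-1) * (inverse (F z) * Dx F z * inverse (F z))) (at (fst z))"
      using DERIV_inverse'[OF has_partials_DERIV_x[OF Suc.prems z]] assms(2) z by simp
    show "((\<lambda>y. inverse (F (fst z, y))) has_real_derivative
        (-1) * (inverse (F z) * Dy F z * inverse (F z))) (at (snd z))"
      using DERIV_inverse'[OF has_partials_DERIV_y[OF Suc.prems z]] assms(2) z by simp
  next
    show "tame_partials S P K (\<lambda>z. (-1) * (inverse (F z) * Dx F z * inverse (F z)))"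
      using Suc.prems by (intro tame_partials_mult tame_partials_const IH) simp
    show "tame_partials S P K (\<lambda>z. (-1) * (inverse (F z) * Dy F z * inverse (F z)))"
      using Suc.prems by (intro tame_partials_mult tame_partials_const IH) simp
  qed (use t assms tame_inverse in blast)
qed

lemma tame_partials_continuous: "tame S P F \<Longrightarrow> continuous_on S F"
  by (simp add: tame_def)

lemma tame_Dxy: "tame_partials S P (m + n) F \<Longrightarrow> tame S P (Dxy m n F)"
  using has_partials_Dxy[of "tame S P" S m n 0 F] by simp

lemma bval_Dxy_Dx:
  "tame_partials S P (m + n + 1) F \<Longrightarrow> bval S P (Dxy m n (Dx F)) = bval S P (Dxy (Suc m) n F)"
  by (intro bval_cong Dxy_Dx[OF open_S _ tame_partials_continuous]) auto

section \<open>Leibniz' rule for mixed derivatives and their boundary values\<close>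

lemma Dx_sum_prod:
  assumes "\<And>i. i \<in> A \<Longrightarrow> tame_partials S P (Suc 0) (f i)" "\<And>i. i \<in> A \<Longrightarrow> tame_partials S P (Suc 0) (g i)" "z \<in> S"
  shows "Dx (\<lambda>z. \<Sum>i\<in>A. c i * (f i z * g i z)) z = (\<Sum>i\<in>A. c i * (Dx (f i) z * g i z + f i z * Dx (g i) z))"
proof (rule Dx_eqI, rule DERIV_sum, rule DERIV_cmult)
  fix i assume i: "i \<in> A"
  show "((\<lambda>x. f i (x, snd z) * g i (x, snd z)) has_real_derivative
      Dx (f i) z * g i z + f i z * Dx (g i) z) (at (fst z))"
    using DERIV_mult[OF has_partials_DERIV_x[OF assms(1)[OF i] assms(3)]
        has_partials_DERIV_x[OF assms(2)[OF i] assms(3)]] by (simp add: mult.commute)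
qed

lemma Dy_sum_prod:
  assumes "\<And>i. i \<in> A \<Longrightarrow> tame_partials S P (Suc 0) (f i)" "\<And>i. i \<in> A \<Longrightarrow> tame_partials S P (Suc 0) (g i)" "z \<in> S"
  shows "Dy (\<lambda>z. \<Sum>i\<in>A. c i * (f i z * g i z)) z = (\<Sum>i\<in>A. c i * (Dy (f i) z * g i z + f i z * Dy (g i) z))"
proof (rule Dy_eqI, rule DERIV_sum, rule DERIV_cmult)
  fix i assume i: "i \<in> A"
  show "((\<lambda>y. f i (fst z, y) * g i (fst z, y)) has_real_derivative
      Dy (f i) z * g i z + f i z * Dy (g i) z) (at (snd z))"
    using DERIV_mult[OF has_partials_DERIV_y[OF assms(1)[OF i] assms(3)]
        has_partials_DERIV_y[OF assms(2)[OF i] assms(3)]] by (simp add: mult.commute)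
qed

text \<open>Pascal's rule, after shifting the index in the second half of the sum. It is the
  inductive step of Leibniz' rule in either variable.\<close>

lemma leibniz_sum:
  fixes f g :: "nat \<Rightarrow> real"
  shows "(\<Sum>i\<le>n. real (n choose i) * (f (Suc (n - i)) * g i + f (n - i) * g (Suc i)))
    = (\<Sum>i\<le>Suc n. real (Suc n choose i) * (f (Suc n - i) * g i))"
proof -
  define t where "t i = f (Suc n - i) * g i" for i
  have "(\<Sum>i\<le>n. real (n choose i) * (f (Suc (n - i)) * g i + f (n - i) * g (Suc i)))
      = (\<Sum>i\<le>n. real (n choose i) * t i) + (\<Sum>i\<le>n. real (n choose i) * t (Suc i))"
    by (simp add: t_def Suc_diff_le sum.distrib algebra_simps)
  also have "(\<Sum>i\<le>n. real (n choose i) * t i) = (\<Sum>i\<le>Suc n. real (n choose i) * t i)" by simp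
  also have "\<dots> = t 0 + (\<Sum>i\<le>n. real (n choose Suc i) * t (Suc i))"
    by (subst sum.atMost_Suc_shift) simp
  also have "t 0 + (\<Sum>i\<le>n. real (n choose Suc i) * t (Suc i)) + (\<Sum>i\<le>n. real (n choose i) * t (Suc i))
      = (\<Sum>i\<le>Suc n. real (Suc n choose i) * t i)"
    by (subst sum.atMost_Suc_shift) (simp add: sum.distrib algebra_simps)
  finally show ?thesis by (simp add: t_def)
qed

lemma Dy_pow_mult:
  assumes "tame_partials S P n F" "tame_partials S P n G" "z \<in> S"
  shows "(Dy ^^ n) (\<lambda>z. F z * G z) z = (\<Sum>i\<le>n. real (n choose i) * ((Dy ^^ (n - i)) F z * (Dy ^^ i) G z))"
  using assms
proof (induction n arbitrary: z)
  case (Suc n)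
  have l: "tame_partials S P n F" "tame_partials S P n G"
    using Suc.prems has_partials_Suc_imp by blast+
  have d: "tame_partials S P (Suc 0) ((Dy ^^ j) F)" "tame_partials S P (Suc 0) ((Dy ^^ j) G)" if "j \<le> n" for j
    by (rule has_partials_Dy_pow, rule has_partials_le[OF Suc.prems(1)], use that in simp,
        rule has_partials_Dy_pow, rule has_partials_le[OF Suc.prems(2)], use that in simp)
  have "(Dy ^^ Suc n) (\<lambda>z. F z * G z) z = Dy ((Dy ^^ n) (\<lambda>z. F z * G z)) z" by simp
  also have "\<dots> = Dy (\<lambda>z. \<Sum>i\<le>n. real (n choose i) * ((Dy ^^ (n - i)) F z * (Dy ^^ i) G z)) z"
    by (rule Dy_cong[OF open_S Suc.IH[OF l] Suc.prems(3)])
  also have "\<dots> = (\<Sum>i\<le>n. real (n choose i) *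
      ((Dy ^^ Suc (n - i)) F z * (Dy ^^ i) G z + (Dy ^^ (n - i)) F z * (Dy ^^ Suc i) G z))"
    by (subst Dy_sum_prod[OF d(1) d(2) Suc.prems(3)]) simp_all
  also have "\<dots> = (\<Sum>i\<le>Suc n. real (Suc n choose i) * ((Dy ^^ (Suc n - i)) F z * (Dy ^^ i) G z))"
    by (rule leibniz_sum)
  finally show ?case .
qed simp

lemma Dxy_mult:
  assumes "tame_partials S P (m + n) F" "tame_partials S P (m + n) G" "z \<in> S"
  shows "Dxy m n (\<lambda>z. F z * G z) z = (\<Sum>i\<le>m. \<Sum>j\<le>n. real (m choose i) * real (n choose j) *
      (Dxy (m - i) (n - j) F z * Dxy i j G z))"
  using assms
proof (induction m arbitrary: z)
  case 0
  then show ?case using Dy_pow_mult[of n F G z] by (simp add: Dxy_def)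
next
  case (Suc m)
  have l: "tame_partials S P (m + n) F" "tame_partials S P (m + n) G"
    using Suc.prems(1,2) by (auto intro: has_partials_le simp del: has_partials.simps)
  have d: "tame_partials S P (Suc 0) (Dxy i j F)" "tame_partials S P (Suc 0) (Dxy i j G)"
    if "i \<le> m" "j \<le> n" for i j
    by (rule has_partials_Dxy, rule has_partials_le[OF Suc.prems(1)], use that in simp,
        rule has_partials_Dxy, rule has_partials_le[OF Suc.prems(2)], use that in simp)
  \<comment> \<open>The pairs carry the \<open>y\<close>-index first. After \<open>Dx\<close> the
    inner sum then runs over the \<open>x\<close>-index, where \<open>leibniz_sum\<close>
    applies.\<close>
  define c where "c p = real (m choose snd p) * real (n choose fst p)" for p
  have "Dxy (Suc m) n (\<lambda>z. F z * G z) z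
      = Dx (\<lambda>z. \<Sum>p\<in>{..n}\<times>{..m}. c p * (Dxy (m - snd p) (n - fst p) F z * Dxy (snd p) (fst p) G z)) z"
    unfolding Dxy_Suc_x
  proof (rule Dx_cong[OF open_S _ Suc.prems(3)])
    fix z assume z: "z \<in> S"
    have "Dxy m n (\<lambda>z. F z * G z) z = (\<Sum>i\<le>m. \<Sum>j\<le>n. real (m choose i) * real (n choose j) *
      (Dxy (m - i) (n - j) F z * Dxy i j G z))"
      by (rule Suc.IH[OF l z])
    also have "\<dots> = (\<Sum>j\<le>n. \<Sum>i\<le>m. real (m choose i) * real (n choose j) *
      (Dxy (m - i) (n - j) F z * Dxy i j G z))" by (rule sum.swap)
    finally show "Dxy m n (\<lambda>z. F z * G z) z = (\<Sum>p\<in>{..n}\<times>{..m}. c p * (Dxy (m - snd p) (n - fst p) F z * Dxy (snd p) (fst p) G z))"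
      by (simp add: sum.cartesian_product c_def case_prod_unfold)
  qed
  also have "\<dots> = (\<Sum>p\<in>{..n}\<times>{..m}. c p * (Dx (Dxy (m - snd p) (n - fst p) F) z * Dxy (snd p) (fst p) G z
      + Dxy (m - snd p) (n - fst p) F z * Dx (Dxy (snd p) (fst p) G) z))"
    by (rule Dx_sum_prod[OF d(1) d(2) Suc.prems(3)]) auto
  also have "\<dots> = (\<Sum>j\<le>n. \<Sum>i\<le>m. real (m choose i) * real (n choose j) *
      (Dxy (Suc (m - i)) (n - j) F z * Dxy i j G z + Dxy (m - i) (n - j) F z * Dxy (Suc i) j G z))"
    by (simp add: sum.cartesian_product c_def case_prod_unfold Dxy_Suc_x)
  also have "\<dots> = (\<Sum>j\<le>n. real (n choose j) * (\<Sum>i\<le>m. real (m choose i) *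
      (Dxy (Suc (m - i)) (n - j) F z * Dxy i j G z + Dxy (m - i) (n - j) F z * Dxy (Suc i) j G z)))"
    by (simp add: sum_distrib_left mult_ac)
  also have "\<dots> = (\<Sum>j\<le>n. real (n choose j) * (\<Sum>i\<le>Suc m. real (Suc m choose i) *
      (Dxy (Suc m - i) (n - j) F z * Dxy i j G z)))"
    by (subst leibniz_sum) simp
  also have "\<dots> = (\<Sum>j\<le>n. \<Sum>i\<le>Suc m. real (Suc m choose i) * real (n choose j) *
      (Dxy (Suc m - i) (n - j) F z * Dxy i j G z))"
    by (simp only: sum_distrib_left mult_ac)
  also have "\<dots> = (\<Sum>i\<le>Suc m. \<Sum>j\<le>n. real (Suc m choose i) * real (n choose j) *
      (Dxy (Suc m - i) (n - j) F z * Dxy i j G z))"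
    by (rule sum.swap)
  finally show ?case .
qed

lemma bval_Dxy_mult:
  assumes "tame_partials S P (m + n) F" "tame_partials S P (m + n) G"
  shows "bval S P (Dxy m n (\<lambda>z. F z * G z)) = (\<Sum>i\<le>m. \<Sum>j\<le>n. real (m choose i) * real (n choose j) *
      (bval S P (Dxy (m - i) (n - j) F) * bval S P (Dxy i j G)))"
proof -
  have t: "tame S P (Dxy (m - i) (n - j) F)" "tame S P (Dxy i j G)" if "i \<le> m" "j \<le> n" for i j
    by (rule tame_Dxy, rule has_partials_le[OF assms(1)], use that in simp,
        rule tame_Dxy, rule has_partials_le[OF assms(2)], use that in simp)
  have "bval S P (Dxy m n (\<lambda>z. F z * G z)) = bval S P (\<lambda>z. \<Sum>i\<le>m. \<Sum>j\<le>n. real (m choose i) * real (n choose j) *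
      (Dxy (m - i) (n - j) F z * Dxy i j G z))"
    by (rule bval_cong) (rule Dxy_mult[OF assms])
  also have "\<dots> = (\<Sum>i\<le>m. \<Sum>j\<le>n. real (m choose i) * real (n choose j) *
      (bval S P (Dxy (m - i) (n - j) F) * bval S P (Dxy i j G)))"
    by (intro bval_eqI tendsto_sum tendsto_mult tendsto_const tame_tendsto t) auto
  finally show ?thesis .
qed

end

section \<open>Taylor expansion up to the interface\<close>

definition taxi :: "real \<times> real \<Rightarrow> real \<times> real \<Rightarrow> real" where
  "taxi P z = \<bar>fst z - fst P\<bar> + \<bar>snd z - snd P\<bar>"

definition axis_parallel :: "real \<times> real \<Rightarrow> real \<times> real \<Rightarrow> bool" where
  "axis_parallel v w \<longleftrightarrow> fst v = fst w \<or> snd v = snd w"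

text \<open>Three legs suffice where the boundary is a Lipschitz graph: away from \<open>P\<close>,
  across, and back to \<open>z\<close>. Only the corners are bounded by \<open>B\<close>; convexity
  of \<open>taxi\<close> extends the bound to the legs. \<open>P\<close> is removed because it will
  be a boundary point.\<close>

definition axis_path :: "(real \<times> real) set \<Rightarrow> real \<times> real \<Rightarrow> real \<Rightarrow> real \<times> real \<Rightarrow> bool" where
  "axis_path S P B z \<longleftrightarrow> (\<exists>w1 w2. axis_parallel P w1 \<and> axis_parallel w1 w2 \<and> axis_parallel w2 z \<and>
     taxi P w1 \<le> B \<and> taxi P w2 \<le> B \<and>
     closed_segment P w1 - {P} \<subseteq> S \<and> closed_segment w1 w2 \<subseteq> S \<and> closed_segment w2 z \<subseteq> S)"

definition axis_accessible :: "(real \<times> real) set \<Rightarrow> real \<times> real \<Rightarrow> bool" where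
  "axis_accessible S P \<longleftrightarrow> (\<exists>c \<delta>. c \<ge> 1 \<and> \<delta> > 0 \<and> (\<forall>z\<in>S. taxi P z < \<delta> \<longrightarrow> axis_path S P (c * taxi P z) z))"

lemma taxi_nonneg [simp]: "taxi P z \<ge> 0"
  by (simp add: taxi_def)

lemma taxi_pos: "z \<noteq> P \<Longrightarrow> taxi P z > 0"
  by (cases z; cases P) (auto simp: taxi_def)

lemma dist_le_taxi: "dist z P \<le> taxi P z"
  using norm_Pair_le[of "fst z - fst P" "snd z - snd P"]
  by (cases z; cases P) (simp add: dist_norm taxi_def)

lemma taxi_closed_segment:
  assumes "w \<in> closed_segment v v'" "taxi P v \<le> B" "taxi P v' \<le> B" shows "taxi P w \<le> B"
proof -
  obtain t where t: "0 \<le> t" "t \<le> 1" "w = (1 - t) *\<^sub>R v + t *\<^sub>R v'"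
    using assms(1) by (auto simp: in_segment)
  have *: "\<bar>(1 - t) * x + t * y - p\<bar> \<le> (1 - t) * \<bar>x - p\<bar> + t * \<bar>y - p\<bar>" for x y p :: real
  proof -
    have "(1 - t) * x + t * y - p = (1 - t) * (x - p) + t * (y - p)" by (simp add: algebra_simps)
    then show ?thesis using t abs_triangle_ineq[of "(1 - t) * (x - p)" "t * (y - p)"]
      by (simp add: abs_mult)
  qed
  have "taxi P w \<le> (1 - t) * taxi P v + t * taxi P v'"
    using *[of "fst v" "fst v'" "fst P"] *[of "snd v" "snd v'" "snd P"]
    unfolding t(3) taxi_def by (simp add: algebra_simps)
  also have "\<dots> \<le> (1 - t) * B + t * B"
    using t assms by (intro add_mono mult_left_mono) auto
  finally show ?thesis by (simp add: algebra_simps)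
qed

text \<open>On a segment parallel to an axis only one variable moves, so the one-dimensional mean
  value inequality with the corresponding partial derivative controls the increment.\<close>

lemma axis_mean_value_bound:
  assumes "axis_parallel v w"
    and x: "\<And>z. z \<in> closed_segment v w \<Longrightarrow> ((\<lambda>x. R (x, snd z)) has_real_derivative Rx z) (at (fst z))"
    and y: "\<And>z. z \<in> closed_segment v w \<Longrightarrow> ((\<lambda>y. R (fst z, y)) has_real_derivative Ry z) (at (snd z))"
    and bx: "\<And>z. z \<in> closed_segment v w \<Longrightarrow> \<bar>Rx z\<bar> \<le> E"
    and bY: "\<And>z. z \<in> closed_segment v w \<Longrightarrow> \<bar>Ry z\<bar> \<le> E"
  shows "\<bar>R v - R w\<bar> \<le> E * taxi w v"
proof (cases "fst v = fst w")
  case True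
  have seg: "(fst w, t) \<in> closed_segment v w" if t: "t \<in> closed_segment (snd v) (snd w)" for t
  proof -
    obtain \<tau> where "0 \<le> \<tau>" "\<tau> \<le> 1" "t = (1 - \<tau>) * snd v + \<tau> * snd w"
      using t by (auto simp: in_segment)
    then show ?thesis using True
      by (auto simp: in_segment prod_eq_iff algebra_simps intro!: exI[of _ \<tau>])
  qed
  have "norm (R (fst w, snd v) - R (fst w, snd w)) \<le> E * norm (snd v - snd w)"
    by (rule field_differentiable_bound[OF convex_closed_segment[of "snd v" "snd w"],
          where f' = "\<lambda>t. Ry (fst w, t)"])
      (use y[OF seg] bY[OF seg] in \<open>auto intro: has_field_derivative_at_within\<close>)
  then show ?thesis using True by (metis abs_0 add_0 diff_self prod.collapse real_norm_def taxi_def)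
next
  case False
  then have eq: "snd v = snd w" using assms(1) by (simp add: axis_parallel_def)
  have seg: "(t, snd w) \<in> closed_segment v w" if t: "t \<in> closed_segment (fst v) (fst w)" for t
  proof -
    obtain \<tau> where "0 \<le> \<tau>" "\<tau> \<le> 1" "t = (1 - \<tau>) * fst v + \<tau> * fst w"
      using t by (auto simp: in_segment)
    then show ?thesis using eq
      by (auto simp: in_segment prod_eq_iff algebra_simps intro!: exI[of _ \<tau>])
  qed
  have "norm (R (fst v, snd w) - R (fst w, snd w)) \<le> E * norm (fst v - fst w)"
    by (rule field_differentiable_bound[OF convex_closed_segment[of "fst v" "fst w"],
          where f' = "\<lambda>t. Rx (t, snd w)"])
      (use x[OF seg] bx[OF seg] in \<open>auto intro: has_field_derivative_at_within\<close>)
  then show ?thesis using eq by (metis abs_0 add.right_neutral diff_self prod.collapse real_norm_def taxi_def)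
qed

text \<open>All terms of degree strictly below \<open>k\<close>, so that \<open>k = 0\<close> gives
  the zero polynomial and the induction for the Taylor estimate can start from mere
  boundedness.\<close>

definition tpoly :: "nat \<Rightarrow> (nat \<Rightarrow> nat \<Rightarrow> real) \<Rightarrow> real \<times> real \<Rightarrow> real" where
  "tpoly k c d = (\<Sum>(m, n)\<in>{(m, n). m + n < k}. c m n / (fact m * fact n) * fst d ^ m * snd d ^ n)"

lemma tpoly_Suc: "tpoly (Suc K) = taylor_poly K"
  by (auto simp: tpoly_def taylor_poly_def Lam_def less_Suc_eq_le fun_eq_iff)

lemma tpoly_0 [simp]: "tpoly 0 c d = 0"
  by (simp add: tpoly_def)

lemma finite_degree_less: "finite {(m::nat, n). m + n < k}"
  by (rule finite_subset[of _ "{..k} \<times> {..k}"]) auto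

text \<open>Differentiation shifts the coefficient array and lowers the degree bound by one; this is
  what makes derivatives of Taylor remainders Taylor remainders again.\<close>

lemma tpoly_DERIV_x:
  "((\<lambda>x. tpoly (Suc k) c (x - a, y)) has_real_derivative tpoly k (\<lambda>m n. c (Suc m) n) (x - a, y)) (at x)"
proof -
  let ?t = "\<lambda>m n. c m n / (fact m * fact n) * (real m * (x - a) ^ (m - 1)) * y ^ n"
  have "((\<lambda>x. tpoly (Suc k) c (x - a, y)) has_real_derivative
      (\<Sum>(m, n)\<in>{(m, n). m + n < Suc k}. ?t m n)) (at x)"
    unfolding tpoly_def case_prod_beta
    by (rule DERIV_sum) (auto intro!: derivative_eq_intros)
  also have "(\<Sum>(m, n)\<in>{(m, n). m + n < Suc k}. ?t m n) = (\<Sum>(m, n)\<in>{(m, n). m + n < Suc k \<and> m > 0}. ?t m n)"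
    by (rule sum.mono_neutral_right) (use finite_degree_less in \<open>auto\<close>)
  also have "\<dots> = (\<Sum>(m, n)\<in>{(m, n). m + n < k}. ?t (Suc m) n)"
    by (rule sum.reindex_bij_witness[of _ "\<lambda>(m, n). (Suc m, n)" "\<lambda>(m, n). (m - 1, n)"])
      (auto simp: gr0_conv_Suc field_simps simp del: of_nat_Suc)
  also have "\<dots> = tpoly k (\<lambda>m n. c (Suc m) n) (x - a, y)"
    unfolding tpoly_def by (rule sum.cong) (auto simp: field_simps simp del: of_nat_Suc)
  finally show ?thesis .
qed

lemma tpoly_DERIV_y:
  "((\<lambda>y. tpoly (Suc k) c (x, y - b)) has_real_derivative tpoly k (\<lambda>m n. c m (Suc n)) (x, y - b)) (at y)"
proof -
  let ?t = "\<lambda>m n. c m n / (fact m * fact n) * x ^ m * (real n * (y - b) ^ (n - 1))"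
  have "((\<lambda>y. tpoly (Suc k) c (x, y - b)) has_real_derivative
      (\<Sum>(m, n)\<in>{(m, n). m + n < Suc k}. ?t m n)) (at y)"
    unfolding tpoly_def case_prod_beta
    by (rule DERIV_sum) (auto intro!: derivative_eq_intros)
  also have "(\<Sum>(m, n)\<in>{(m, n). m + n < Suc k}. ?t m n) = (\<Sum>(m, n)\<in>{(m, n). m + n < Suc k \<and> n > 0}. ?t m n)"
    by (rule sum.mono_neutral_right) (use finite_degree_less in \<open>auto\<close>)
  also have "\<dots> = (\<Sum>(m, n)\<in>{(m, n). m + n < k}. ?t m (Suc n))"
    by (rule sum.reindex_bij_witness[of _ "\<lambda>(m, n). (m, Suc n)" "\<lambda>(m, n). (m, n - 1)"])
      (auto simp: gr0_conv_Suc field_simps simp del: of_nat_Suc)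
  also have "\<dots> = tpoly k (\<lambda>m n. c m (Suc n)) (x, y - b)"
    unfolding tpoly_def by (rule sum.cong) (auto simp: field_simps simp del: of_nat_Suc)
  finally show ?thesis .
qed

lemma tpoly_cong: "(\<And>m n. m + n < k \<Longrightarrow> c m n = c' m n) \<Longrightarrow> tpoly k c d = tpoly k c' d"
  unfolding tpoly_def by (rule sum.cong) auto

lemma continuous_tpoly: "isCont (\<lambda>z. tpoly k c (z - P)) z"
  unfolding tpoly_def case_prod_beta by (intro continuous_intros)

lemma tpoly_at_0: "tpoly (Suc k) c (0, 0) = c 0 0"
proof -
  have "tpoly (Suc k) c (0, 0) = (\<Sum>(m, n)\<in>{(0, 0)}. c m n / (fact m * fact n) * fst (0::real, 0::real) ^ m * snd (0::real, 0::real) ^ n)"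
    unfolding tpoly_def
    by (rule sum.mono_neutral_right) (use finite_degree_less in \<open>auto simp: power_0_left split: if_splits\<close>)
  then show ?thesis by simp
qed

section \<open>Taylor estimates on a side and on its closure\<close>

locale accessible_boundary_point = boundary_point +
  assumes accessible: "axis_accessible S P"
begin

abbreviation jet :: "(real \<times> real \<Rightarrow> real) \<Rightarrow> nat \<Rightarrow> nat \<Rightarrow> real" where
  "jet F \<equiv> \<lambda>m n. bval S P (Dxy m n F)"

text \<open>Induction on the order: a partial derivative of the remainder of \<open>F\<close> is the
  remainder of that derivative of \<open>F\<close>, one order lower. The mean value bound along a
  path of length comparable to \<open>taxi P z\<close> gains the missing power. At order zero the
  existence of the limit at \<open>P\<close> gives boundedness.\<close>

lemma taylor_bound:
  "tame_partials S P k F \<Longrightarrow> \<exists>C \<delta>. \<delta> > 0 \<and> C \<ge> 0 \<and>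
    (\<forall>z\<in>S. taxi P z < \<delta> \<longrightarrow> \<bar>F z - tpoly k (jet F) (z - P)\<bar> \<le> C * taxi P z ^ k)"
proof (induction k arbitrary: F)
  case 0
  then have "(F \<longlongrightarrow> bval S P F) (at P within S)" by (simp add: tame_tendsto)
  then obtain \<delta> where \<delta>: "\<delta> > 0"
    "\<And>z. z \<in> S \<Longrightarrow> 0 < dist z P \<Longrightarrow> dist z P < \<delta> \<Longrightarrow> dist (F z) (bval S P F) < 1"
    unfolding Lim_within by (metis zero_less_one)
  have "\<bar>F z\<bar> \<le> \<bar>bval S P F\<bar> + 1" if "z \<in> S" "taxi P z < \<delta>" for z
  proof -
    have "z \<noteq> P" using that P_notin by auto
    then have "dist (F z) (bval S P F) < 1"
      using that dist_le_taxi[of z P] by (intro \<delta>(2)) auto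
    then show ?thesis by (simp add: dist_real_def)
  qed
  then show ?case using \<delta>(1) by (intro exI[of _ "\<bar>bval S P F\<bar> + 1"] exI[of _ \<delta>]) auto
next
  case (Suc k)
  define R where "R z = F z - tpoly (Suc k) (jet F) (z - P)" for z
  define Rx where "Rx z = Dx F z - tpoly k (jet (Dx F)) (z - P)" for z
  define Ry where "Ry z = Dy F z - tpoly k (jet (Dy F)) (z - P)" for z
  have "tame_partials S P k (Dx F)" "tame_partials S P k (Dy F)" using Suc.prems by auto
  from Suc.IH[OF this(1)] Suc.IH[OF this(2)] obtain Cx \<delta>x Cy \<delta>y where IH:
    "\<delta>x > 0" "\<And>z. z \<in> S \<Longrightarrow> taxi P z < \<delta>x \<Longrightarrow> \<bar>Rx z\<bar> \<le> Cx * taxi P z ^ k"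
    "\<delta>y > 0" "\<And>z. z \<in> S \<Longrightarrow> taxi P z < \<delta>y \<Longrightarrow> \<bar>Ry z\<bar> \<le> Cy * taxi P z ^ k" "Cx \<ge> 0" "Cy \<ge> 0"
    unfolding Rx_def Ry_def by metis
  obtain c \<delta>0 where acc: "c \<ge> 1" "\<delta>0 > 0" "\<And>z. z \<in> S \<Longrightarrow> taxi P z < \<delta>0 \<Longrightarrow> axis_path S P (c * taxi P z) z"
    using accessible unfolding axis_accessible_def by blast
  \<comment> \<open>\<open>Dx\<close> has to be commuted with the \<open>y\<close>-derivatives to
    identify the shifted coefficients with the jet of \<open>Dx F\<close>; for \<open>Dy\<close>
    below the order in \<open>Dxy\<close> already fits.\<close>
  have jx: "tpoly k (\<lambda>m n. jet F (Suc m) n) d = tpoly k (jet (Dx F)) d" for d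
  proof (rule tpoly_cong)
    fix m n assume "m + n < k"
    then have "tame_partials S P (m + n + 1) F" by (intro has_partials_le[OF Suc.prems]) simp
    then show "jet F (Suc m) n = jet (Dx F) m n" by (simp only: bval_Dxy_Dx)
  qed
  have jy: "tpoly k (\<lambda>m n. jet F m (Suc n)) d = tpoly k (jet (Dy F)) d" for d
    by (simp add: Dxy_Dy)
  have Rx: "((\<lambda>x. R (x, snd z)) has_real_derivative Rx z) (at (fst z))" if "z \<in> S" for z
    unfolding R_def Rx_def
    using DERIV_diff[OF has_partials_DERIV_x[OF Suc.prems that]
        tpoly_DERIV_x[of k "jet F" "fst P" "snd z - snd P" "fst z"]] jx
    by (cases P; cases z) (auto simp: minus_prod_def)
  have Ry: "((\<lambda>y. R (fst z, y)) has_real_derivative Ry z) (at (snd z))" if "z \<in> S" for z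
    unfolding R_def Ry_def
    using DERIV_diff[OF has_partials_DERIV_y[OF Suc.prems that]
        tpoly_DERIV_y[of k "jet F" "fst z - fst P" "snd P" "snd z"]] jy
    by (cases P; cases z) (auto simp: minus_prod_def)
  have "(F \<longlongrightarrow> jet F 0 0) (at P within S)" using Suc.prems by (simp add: tame_tendsto)
  moreover have "((\<lambda>z. tpoly (Suc k) (jet F) (z - P)) \<longlongrightarrow> tpoly (Suc k) (jet F) (P - P)) (at P within S)"
    using continuous_tpoly[where k = "Suc k" and c = "jet F" and P = P and z = P] isCont_def tendsto_within_subset by blast
  ultimately have "(R \<longlongrightarrow> jet F 0 0 - tpoly (Suc k) (jet F) (P - P)) (at P within S)"
    unfolding R_def by (rule tendsto_diff)
  then have R0: "(R \<longlongrightarrow> 0) (at P within S)" by (simp add: tpoly_at_0 zero_prod_def)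
  \<comment> \<open>Division by \<open>c\<close> keeps the whole path inside the radii of the
    induction hypothesis.\<close>
  define \<delta> where "\<delta> = min \<delta>0 (min \<delta>x \<delta>y / c)"
  have \<delta>: "\<delta> > 0" using acc IH by (simp add: \<delta>_def)
  \<comment> \<open>Three legs, each of length at most \<open>2 * c * taxi P z\<close>, times the
    bound \<open>(Cx + Cy) * (c * taxi P z) ^ k\<close> for the derivatives.\<close>
  define C where "C = 6 * c * ((Cx + Cy) * c ^ k)"
  have "\<bar>R z\<bar> \<le> C * taxi P z ^ Suc k" if z: "z \<in> S" "taxi P z < \<delta>" for z
  proof -
    obtain w1 w2 where w: "axis_parallel P w1" "axis_parallel w1 w2" "axis_parallel w2 z"
      "taxi P w1 \<le> c * taxi P z" "taxi P w2 \<le> c * taxi P z"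
      "closed_segment P w1 - {P} \<subseteq> S" "closed_segment w1 w2 \<subseteq> S" "closed_segment w2 z \<subseteq> S"
      using acc(3)[OF z(1)] z(2) unfolding axis_path_def by (auto simp: \<delta>_def)
    have cz: "taxi P z \<le> c * taxi P z" using acc(1) mult_right_mono[of 1 c "taxi P z"] by simp
    define E where "E = (Cx + Cy) * (c * taxi P z) ^ k"
    have E0: "E \<ge> 0" using IH acc(1) by (simp add: E_def)
    have "c * taxi P z < min \<delta>x \<delta>y"
      using z(2) acc(1) by (simp add: \<delta>_def pos_less_divide_eq mult.commute)
    then have bnd: "\<bar>Rx w\<bar> \<le> E" "\<bar>Ry w\<bar> \<le> E" if "w \<in> S" "taxi P w \<le> c * taxi P z" for w
    proof -
      have p: "taxi P w ^ k \<le> (c * taxi P z) ^ k" by (rule power_mono[OF that(2) taxi_nonneg])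
      have "\<bar>Rx w\<bar> \<le> Cx * taxi P w ^ k" "\<bar>Ry w\<bar> \<le> Cy * taxi P w ^ k"
        using that \<open>c * taxi P z < min \<delta>x \<delta>y\<close> by (auto intro!: IH)
      moreover have "Cx * taxi P w ^ k \<le> E" "Cy * taxi P w ^ k \<le> E"
        unfolding E_def using p IH(5,6) by (intro mult_mono; simp)+
      ultimately show "\<bar>Rx w\<bar> \<le> E" "\<bar>Ry w\<bar> \<le> E" by linarith+
    qed
    have mv: "\<bar>R v - R w\<bar> \<le> E * (2 * (c * taxi P z))"
      if "axis_parallel v w" "closed_segment v w \<subseteq> S" "taxi P v \<le> c * taxi P z" "taxi P w \<le> c * taxi P z" for v w
    proof -
      have "\<bar>R v - R w\<bar> \<le> E * taxi w v"
        by (rule axis_mean_value_bound[OF that(1) Rx Ry bnd(1) bnd(2)])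
           (use that taxi_closed_segment in blast)+
      also have "taxi w v \<le> taxi P v + taxi P w" by (simp add: taxi_def)
      then have "E * taxi w v \<le> E * (2 * (c * taxi P z))"
        using that E0 by (intro mult_left_mono) auto
      finally show ?thesis .
    qed
    have "w1 \<in> S" using w(7) by auto
    then have "w1 \<noteq> P" using P_notin by auto
    \<comment> \<open>At \<open>P\<close> itself neither the derivatives of \<open>R\<close> nor its
      continuity are available. The bound is therefore applied from points \<open>v i\<close> of the
      first leg that tend to \<open>P\<close>, and \<open>R0\<close> supplies the limit.\<close>
    define \<tau> where "\<tau> i = inverse (real (Suc i))" for i
    define v where "v i = P + \<tau> i *\<^sub>R (w1 - P)" for i
    have \<tau>: "0 < \<tau> i" "\<tau> i \<le> 1" for i by (auto simp: \<tau>_def divide_simps)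
    have vseg: "v i \<in> closed_segment P w1" "v i \<noteq> P" for i
      using \<tau>[of i] \<open>w1 \<noteq> P\<close> by (auto simp: v_def in_segment algebra_simps intro!: exI[of _ "\<tau> i"])
    have vS: "v i \<in> S" for i using vseg w(6) by auto
    have "\<tau> \<longlonglongrightarrow> 0" unfolding \<tau>_def by (rule LIMSEQ_inverse_real_of_nat)
    then have "v \<longlonglongrightarrow> P + 0 *\<^sub>R (w1 - P)" unfolding v_def by (intro tendsto_intros)
    then have "v \<longlonglongrightarrow> P" by simp
    then have "(\<lambda>i. R (v i)) \<longlonglongrightarrow> 0"
      using R0 vS vseg(2) unfolding tendsto_at_iff_sequentially comp_def by auto
    then have lim: "(\<lambda>i. \<bar>R (v i) - R w1\<bar>) \<longlonglongrightarrow> \<bar>0 - R w1\<bar>" by (intro tendsto_intros)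
    have "\<bar>R (v i) - R w1\<bar> \<le> E * (2 * (c * taxi P z))" for i
    proof (rule mv)
      show "axis_parallel (v i) w1" using w(1) by (auto simp: axis_parallel_def v_def)
      have "P \<notin> closed_segment (v i) w1"
      proof
        assume "P \<in> closed_segment (v i) w1"
        then obtain u where u: "0 \<le> u" "u \<le> 1" "P = (1 - u) *\<^sub>R v i + u *\<^sub>R w1"
          by (auto simp: in_segment)
        then have "((1 - u) * \<tau> i + u) *\<^sub>R (w1 - P) = 0" by (simp add: v_def algebra_simps)
        then have "(1 - u) * \<tau> i + u = 0" using \<open>w1 \<noteq> P\<close> by simp
        then show False using u \<tau>[of i]
          by (metis add_nonneg_eq_0_iff diff_zero less_numeral_extra(3) less_eq_real_def mult_1 mult_nonneg_nonneg diff_ge_0_iff_ge)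
      qed
      moreover have "closed_segment (v i) w1 \<subseteq> closed_segment P w1"
        by (rule subset_closed_segment[THEN iffD2]) (use vseg in auto)
      ultimately show "closed_segment (v i) w1 \<subseteq> S" using w(6) by blast
      show "taxi P (v i) \<le> c * taxi P z"
        by (rule taxi_closed_segment[OF vseg(1) _ w(4)]) (use cz taxi_nonneg[of P z] in \<open>simp add: taxi_def\<close>)
    qed (rule w(4))
    then have "\<bar>0 - R w1\<bar> \<le> E * (2 * (c * taxi P z))" by (intro LIMSEQ_le_const2[OF lim]) auto
    moreover have "\<bar>R w1 - R w2\<bar> \<le> E * (2 * (c * taxi P z))" by (rule mv[OF w(2,7,4,5)])
    moreover have "\<bar>R w2 - R z\<bar> \<le> E * (2 * (c * taxi P z))" by (rule mv[OF w(3,8,5) cz])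
    ultimately have "\<bar>R z\<bar> \<le> 3 * (E * (2 * (c * taxi P z)))" by linarith
    also have "\<dots> = C * taxi P z ^ Suc k"
      by (simp add: C_def E_def power_mult_distrib)
    finally show ?thesis .
  qed
  moreover have "C \<ge> 0" using IH acc by (simp add: C_def)
  ultimately show ?case using \<delta> unfolding R_def by blast
qed

text \<open>At a boundary point \<open>side_val\<close> is the limit from within \<open>S\<close>,
  so the estimate passes to the limit. Both the traces along the curve and stencil points on the
  interface require the closure.\<close>

lemma taylor_bound_closure:
  assumes "uc_partials (Suc K) S F"
  shows "\<exists>C \<delta>. \<delta> > 0 \<and> C \<ge> 0 \<and> (\<forall>z\<in>closure S. taxi P z < \<delta> \<longrightarrow>
    \<bar>side_val S F z - taylor_poly K (side_deriv S F P) (z - P)\<bar> \<le> C * taxi P z ^ Suc K)"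
proof -
  obtain C \<delta> where C: "\<delta> > 0" "C \<ge> 0"
    "\<And>z. z \<in> S \<Longrightarrow> taxi P z < \<delta> \<Longrightarrow> \<bar>F z - taylor_poly K (side_deriv S F P) (z - P)\<bar> \<le> C * taxi P z ^ Suc K"
    using taylor_bound[OF uc_partials_tame_partials[OF assms P_closure]]
    unfolding tpoly_Suc side_deriv_eq_bval by auto
  have "\<bar>side_val S F z - taylor_poly K (side_deriv S F P) (z - P)\<bar> \<le> C * taxi P z ^ Suc K"
    if z: "z \<in> closure S" "taxi P z < \<delta>" for z
  proof (cases "z \<in> S")
    case True
    then show ?thesis using C z by (simp add: side_val_def)
  next
    case False
    interpret z: boundary_point S z by unfold_locales (use open_S z False in auto)
    have "tame S z F"
      using has_partials_imp[OF uc_partials_tame_partials[OF assms z(1)]] .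
    then have lim: "(F \<longlongrightarrow> side_val S F z) (at z within S)"
      by (simp add: z.side_val_eq_bval z.tame_tendsto)
    have cont: "((\<lambda>w. g w) \<longlongrightarrow> g z) (at z within S)" if "isCont g z" for g :: "real \<times> real \<Rightarrow> real"
      using that isCont_def tendsto_within_subset by blast
    have t: "isCont (taxi P) z" unfolding taxi_def by (intro continuous_intros)
    have p: "isCont (\<lambda>w. taylor_poly K (side_deriv S F P) (w - P)) z"
      unfolding tpoly_Suc[symmetric] by (rule continuous_tpoly)
    have "\<forall>\<^sub>F w in at z within S. taxi P w < \<delta>"
      by (rule order_tendstoD(2)[OF cont[OF t] z(2)])
    moreover have "\<forall>\<^sub>F w in at z within S. w \<in> S" by (simp add: eventually_at_filter)
    ultimately have "\<forall>\<^sub>F w in at z within S.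
        \<bar>F w - taylor_poly K (side_deriv S F P) (w - P)\<bar> \<le> C * taxi P w ^ Suc K"
      by eventually_elim (rule C)
    then show ?thesis
      by (rule tendsto_le[OF z.at_P_nontrivial, rotated 2])
         (intro tendsto_intros lim cont[OF t] cont[OF p])+
  qed
  then show ?thesis using C by blast
qed

end

section \<open>Geometry of the sides near an interface point\<close>

text \<open>Intermediate values: the sign of \<open>\<psi>\<close> is transported along every leg
  that avoids the zeros.\<close>

lemma positive_on_connected:
  fixes \<psi> :: "real \<times> real \<Rightarrow> real"
  assumes "connected X" "continuous_on X \<psi>" "\<And>w. w \<in> X \<Longrightarrow> \<psi> w \<noteq> 0" "z \<in> X" "\<psi> z > 0" "w \<in> X"
  shows "\<psi> w > 0"
proof (rule ccontr)
  assume "\<not> \<psi> w > 0"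
  moreover have "connected (\<psi> ` X)" by (rule connected_continuous_image[OF assms(2,1)])
  ultimately have "0 \<in> \<psi> ` X"
    using connectedD_interval[of "\<psi> ` X" "\<psi> w" "\<psi> z" 0] assms by auto
  then show False using assms(3) by auto
qed

lemma vertical_closed_segment:
  "closed_segment (x::real, y1) (x, y2) = {x} \<times> closed_segment y1 (y2::real)"
proof -
  have "closed_segment (x, y1) (x, y2) = (\<lambda>y. (x, y)) ` closed_segment y1 y2"
    by (auto simp: in_segment image_iff algebra_simps prod_eq_iff)
  then show ?thesis by auto
qed

lemma horizontal_closed_segment:
  "closed_segment (x1, y::real) (x2, y) = closed_segment x1 (x2::real) \<times> {y}"
proof -
  have "closed_segment (x1, y) (x2, y) = (\<lambda>x. (x, y)) ` closed_segment x1 x2"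
    by (auto simp: in_segment image_iff algebra_simps prod_eq_iff)
  then show ?thesis by auto
qed

text \<open>Leave \<open>z\<close> vertically, away from the only zero of \<open>\<psi>\<close> on that line, up to a height at which the
  Lipschitz bound excludes zeros; then move horizontally and come down on \<open>P\<close>.\<close>
lemma axis_accessible_superlevel:
  fixes \<psi> :: "real \<times> real \<Rightarrow> real" and a b :: real
  assumes cont: "continuous_on UNIV \<psi>" and "\<delta> > 0" "L \<ge> 0" "\<psi> (a, b) = 0"
    and box: "\<And>x y. \<bar>x - a\<bar> < \<delta> \<Longrightarrow> \<bar>y - b\<bar> < \<delta> \<Longrightarrow> (x, y) \<in> \<Omega>"
    and lip: "\<And>x y x' y'. \<lbrakk>\<bar>x - a\<bar> < \<delta>; \<bar>y - b\<bar> < \<delta>; \<bar>x' - a\<bar> < \<delta>; \<bar>y' - b\<bar> < \<delta>;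
        \<psi> (x, y) = 0; \<psi> (x', y') = 0\<rbrakk> \<Longrightarrow> \<bar>y - y'\<bar> \<le> L * \<bar>x - x'\<bar>"
  shows "axis_accessible {z \<in> \<Omega>. \<psi> z > 0} (a, b)"
  unfolding axis_accessible_def
\<comment> \<open>A corner lies at height \<open>(L + 1) * taxi\<close> above or below
  \<open>b\<close> with horizontal offset at most \<open>taxi\<close>, which adds up to the factor
  \<open>L + 2\<close>; the radius keeps this height below \<open>\<delta>\<close>.\<close>
proof (rule exI[of _ "L + 2"], rule exI[of _ "\<delta> / (L + 1)"], intro conjI ballI impI)
  show "1 \<le> L + 2" using assms by simp
  show "\<delta> / (L + 1) > 0" using assms by simp
  fix z assume zS: "z \<in> {z \<in> \<Omega>. \<psi> z > 0}" and zd: "taxi (a, b) z < \<delta> / (L + 1)"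
  obtain x y where z: "z = (x, y)" by (cases z)
  define \<rho> where "\<rho> = taxi (a, b) z"
  define A where "A = (L + 1) * \<rho>"
  have \<rho>0: "\<rho> > 0" unfolding \<rho>_def by (rule taxi_pos) (use zS assms(4) in auto)
  have A0: "A > L * \<rho>" "A \<ge> \<rho>" using \<rho>0 assms(3) by (auto simp: A_def algebra_simps)
  have A\<delta>: "A < \<delta>" using zd assms(3) by (simp add: A_def \<rho>_def pos_less_divide_eq mult.commute)
  have xy: "\<bar>x - a\<bar> \<le> \<rho>" "\<bar>y - b\<bar> \<le> \<rho>" by (auto simp: \<rho>_def taxi_def z)
  have Ap: "A > 0" using A0(2) \<rho>0 by linarith
  have seg: "\<bar>t - a\<bar> \<le> \<bar>x - a\<bar>" if "t \<in> closed_segment a x" for t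
    using that by (auto simp: closed_segment_eq_real_ivl split: if_splits)
  have segb: "\<bar>t - b\<bar> \<le> A" if "t \<in> closed_segment (b + s * A) y" "s = 1 \<or> s = -1" for t s
    using that xy A0 Ap by (auto simp: closed_segment_eq_real_ivl split: if_splits)
  \<comment> \<open>Zeros cannot block both directions: on one vertical line the Lipschitz bound
    makes them coincide, and a zero both above and below \<open>z\<close> would be \<open>z\<close>
    itself.\<close>
  have "\<exists>s. (s = 1 \<or> s = -1) \<and> (\<forall>t\<in>closed_segment (b + s * A) y. \<psi> (x, t) \<noteq> 0)"
  proof (rule ccontr)
    assume *: "\<not> ?thesis"
    then obtain t where t: "t \<in> closed_segment (b + 1 * A) y" "\<psi> (x, t) = 0" by blast
    from * obtain t' where t': "t' \<in> closed_segment (b + (-1) * A) y" "\<psi> (x, t') = 0" by blast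
    have "\<bar>t - t'\<bar> \<le> L * \<bar>x - x\<bar>"
      using segb[OF t(1)] segb[OF t'(1)] A\<delta> xy A0 t(2) t'(2) by (intro lip) auto
    then have "t = t'" by simp
    moreover have "t \<ge> y" "t' \<le> y"
      using t(1) t'(1) xy A0 Ap by (auto simp: closed_segment_eq_real_ivl split: if_splits)
    ultimately have "\<psi> (x, y) = 0" using t(2) by simp
    then show False using zS z by simp
  qed
  then obtain s where s: "s = 1 \<or> s = -1" and s0: "\<And>t. t \<in> closed_segment (b + s * A) y \<Longrightarrow> \<psi> (x, t) \<noteq> 0"
    by blast
  define w1 where "w1 = (a, b + s * A)"
  define w2 where "w2 = (x, b + s * A)"
  have sA: "\<bar>s * A\<bar> = A" using s Ap by auto
  have c: "continuous_on X \<psi>" for X using cont continuous_on_subset by blast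
  have pos2: "\<psi> w > 0" if "w \<in> closed_segment w2 z" for w
    by (rule positive_on_connected[OF _ c _ _ _ that, of z])
       (use s0 zS in \<open>auto simp: w2_def z vertical_closed_segment\<close>)
  have pos1: "\<psi> w > 0" if "w \<in> closed_segment w1 w2" for w
  proof (rule positive_on_connected[OF _ c _ _ _ that, of w2])
    fix w assume "w \<in> closed_segment w1 w2"
    then obtain t where t: "w = (t, b + s * A)" "t \<in> closed_segment a x"
      by (auto simp: w1_def w2_def horizontal_closed_segment)
    \<comment> \<open>Compared with the zero \<open>(a, b)\<close>, a zero at horizontal offset at
      most \<open>\<rho>\<close> has height offset at most \<open>L * \<rho>\<close>, which is less
      than \<open>A\<close>.\<close>
    show "\<psi> w \<noteq> 0"
    proof
      assume "\<psi> w = 0"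
      then have "\<bar>(b + s * A) - b\<bar> \<le> L * \<bar>t - a\<bar>"
        using t(1) seg[OF t(2)] xy A0 A\<delta> sA assms(2,4) by (intro lip) auto
      also have "\<dots> \<le> L * \<rho>" using seg[OF t(2)] xy assms(3) by (intro mult_left_mono) auto
      finally show False using A0 sA by simp
    qed
  qed (use pos2 in auto)
  \<comment> \<open>By the Lipschitz bound with equal abscissae, \<open>(a, b)\<close> is the only
    zero on its vertical line within the box.\<close>
  have pos0: "\<psi> w > 0" if w: "w \<in> closed_segment (a, b) w1 - {(a, b)}" for w
  proof -
    obtain t where t: "w = (a, t)" "t \<in> closed_segment b (b + s * A)" "t \<noteq> b"
      using w by (auto simp: w1_def vertical_closed_segment)
    show ?thesis
    proof (rule positive_on_connected[OF _ c, of "closed_segment w w1" w1])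
      fix v assume "v \<in> closed_segment w w1"
      then obtain t' where t': "v = (a, t')" "t' \<in> closed_segment t (b + s * A)"
        by (auto simp: w1_def t vertical_closed_segment)
      have t'b: "t' \<noteq> b" "\<bar>t' - b\<bar> \<le> A"
        using t t' s Ap by (auto simp: closed_segment_eq_real_ivl split: if_splits)
      show "\<psi> v \<noteq> 0"
      proof
        assume "\<psi> v = 0"
        then have "\<bar>t' - b\<bar> \<le> L * \<bar>a - a\<bar>"
          using t' t'b A\<delta> assms(2,4) by (intro lip) auto
        then show False using t'b by simp
      qed
    qed (use pos1 in auto)
  qed
  have in\<Omega>: "w \<in> \<Omega>" if "\<bar>fst w - a\<bar> \<le> \<rho>" "\<bar>snd w - b\<bar> \<le> A" for w
    using box[of "fst w" "snd w"] that A0 A\<delta> by simp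
  show "axis_path {z \<in> \<Omega>. 0 < \<psi> z} (a, b) ((L + 2) * taxi (a, b) z) z"
    unfolding axis_path_def
  proof (rule exI[of _ w1], rule exI[of _ w2], intro conjI)
    show "axis_parallel (a, b) w1" "axis_parallel w1 w2" "axis_parallel w2 z"
      by (auto simp: axis_parallel_def w1_def w2_def z)
    show "taxi (a, b) w1 \<le> (L + 2) * taxi (a, b) z"
    proof -
      have "taxi (a, b) w1 = A" using sA by (simp add: taxi_def w1_def)
      then show ?thesis using \<rho>0 by (simp add: A_def flip: \<rho>_def)
    qed
    show "taxi (a, b) w2 \<le> (L + 2) * taxi (a, b) z"
    proof -
      have "taxi (a, b) w2 \<le> \<rho> + A" using sA xy by (simp add: taxi_def w2_def)
      then show ?thesis by (simp add: A_def algebra_simps flip: \<rho>_def)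
    qed
    show "closed_segment (a, b) w1 - {(a, b)} \<subseteq> {z \<in> \<Omega>. \<psi> z > 0}"
    proof
      fix w assume w: "w \<in> closed_segment (a, b) w1 - {(a, b)}"
      then have "w \<in> \<Omega>"
        using s Ap \<rho>0 by (intro in\<Omega>) (auto simp: w1_def vertical_closed_segment closed_segment_eq_real_ivl split: if_splits)
      then show "w \<in> {z \<in> \<Omega>. \<psi> z > 0}" using pos0[OF w] by simp
    qed
    show "closed_segment w1 w2 \<subseteq> {z \<in> \<Omega>. \<psi> z > 0}"
    proof
      fix w assume w: "w \<in> closed_segment w1 w2"
      then have "w \<in> \<Omega>"
        using sA xy by (intro in\<Omega>) (auto simp: w1_def w2_def horizontal_closed_segment dest!: seg)
      then show "w \<in> {z \<in> \<Omega>. \<psi> z > 0}" using pos1[OF w] by simp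
    qed
    show "closed_segment w2 z \<subseteq> {z \<in> \<Omega>. \<psi> z > 0}"
    proof
      fix w assume w: "w \<in> closed_segment w2 z"
      then have "w \<in> \<Omega>"
        using xy s by (intro in\<Omega>) (auto simp: w2_def z vertical_closed_segment dest: segb)
      then show "w \<in> {z \<in> \<Omega>. \<psi> z > 0}" using pos2[OF w] by simp
    qed
  qed
qed

section \<open>Reflection in the diagonal and local shape of the interface\<close>

lemma closed_segment_swap: "closed_segment (prod.swap v) (prod.swap w) = prod.swap ` closed_segment v w"
  for v w :: "real \<times> real"
proof -
  have "linear (prod.swap :: real \<times> real \<Rightarrow> _)" by (rule linearI) auto
  then show ?thesis by (rule closed_segment_linear_image)
qed

text \<open>The reflection preserves \<open>taxi\<close> and legs parallel to the axes; it reduces a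
  graph over the second axis to one over the first.\<close>

lemma axis_accessible_swap:
  assumes "axis_accessible (prod.swap ` S) (prod.swap P)" shows "axis_accessible S P"
proof -
  have t: "taxi (prod.swap P) (prod.swap z) = taxi P z" for z by (simp add: taxi_def)
  have t': "taxi (prod.swap P) z = taxi P (prod.swap z)" for z by (simp add: taxi_def)
  have ss: "prod.swap ` X \<subseteq> S \<longleftrightarrow> X \<subseteq> prod.swap ` S" for X :: "(real \<times> real) set"
  proof -
    have "z \<in> prod.swap ` S \<longleftrightarrow> prod.swap z \<in> S" for z by (cases z) force
    then show ?thesis unfolding image_subset_iff subset_iff Ball_def by auto
  qed
  have ap: "axis_parallel v (prod.swap w) \<longleftrightarrow> axis_parallel (prod.swap v) w" for v w
    by (auto simp: axis_parallel_def)
  have cs: "closed_segment v (prod.swap w) = prod.swap ` closed_segment (prod.swap v) w" for v w :: "real \<times> real"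
    using closed_segment_swap[of "prod.swap v" w] by simp
  have cs': "closed_segment (prod.swap v) w = prod.swap ` closed_segment v (prod.swap w)" for v w :: "real \<times> real"
    using closed_segment_swap[of v "prod.swap w"] by simp
  from assms obtain c \<delta> where c: "c \<ge> 1" "\<delta> > 0" and H: "\<And>z. z \<in> prod.swap ` S \<Longrightarrow> taxi (prod.swap P) z < \<delta> \<Longrightarrow>
      axis_path (prod.swap ` S) (prod.swap P) (c * taxi (prod.swap P) z) z"
    unfolding axis_accessible_def by blast
  show ?thesis unfolding axis_accessible_def
  proof (rule exI[of _ c], rule exI[of _ \<delta>], intro conjI c ballI impI)
    fix z assume z: "z \<in> S" "taxi P z < \<delta>"
    obtain w1 w2 where w: "axis_parallel (prod.swap P) w1" "axis_parallel w1 w2" "axis_parallel w2 (prod.swap z)"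
        "taxi (prod.swap P) w1 \<le> c * taxi P z" "taxi (prod.swap P) w2 \<le> c * taxi P z"
        "closed_segment (prod.swap P) w1 - {prod.swap P} \<subseteq> prod.swap ` S" "closed_segment w1 w2 \<subseteq> prod.swap ` S"
        "closed_segment w2 (prod.swap z) \<subseteq> prod.swap ` S"
      using H[of "prod.swap z"] z unfolding t axis_path_def by blast
    show "axis_path S P (c * taxi P z) z" unfolding axis_path_def
    proof (rule exI[of _ "prod.swap w1"], rule exI[of _ "prod.swap w2"], intro conjI)
      have "closed_segment P (prod.swap w1) - {P} = prod.swap ` (closed_segment (prod.swap P) w1 - {prod.swap P})"
        unfolding cs by (subst image_set_diff) auto
      then show "closed_segment P (prod.swap w1) - {P} \<subseteq> S" using w(6) by (simp add: ss)
      show "closed_segment (prod.swap w1) (prod.swap w2) \<subseteq> S" using w(7) by (simp add: ss closed_segment_swap)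
      show "closed_segment (prod.swap w2) z \<subseteq> S" using w(8) by (simp add: ss cs')
    qed (use w in \<open>auto simp: ap t' axis_parallel_def\<close>)
  qed
qed

text \<open>The Lipschitz bound is the mean value theorem for both components of the parametrisation.\<close>
lemma param_lipschitz:
  fixes r s :: "real \<Rightarrow> real"
  assumes "open J" "t0 \<in> J" "Ck_on 1 J r" "Ck_on 1 J s" "deriv r t0 \<noteq> 0"
  shows "\<exists>\<epsilon> L. \<epsilon> > 0 \<and> L \<ge> 0 \<and> ball t0 \<epsilon> \<subseteq> J \<and>
    (\<forall>t\<in>ball t0 \<epsilon>. \<forall>t'\<in>ball t0 \<epsilon>. \<bar>s t - s t'\<bar> \<le> L * \<bar>r t - r t'\<bar>)"
proof -
  have cr: "isCont (deriv r) t0" and cs: "isCont (deriv s) t0"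
    using assms by (simp_all add: continuous_on_eq_continuous_at)
  \<comment> \<open>By continuity \<open>deriv r\<close> stays at least \<open>m\<close> and
    \<open>deriv s\<close> at most \<open>M\<close> in absolute value near \<open>t0\<close>, whence
    the Lipschitz constant \<open>M / m\<close>.\<close>
  define m where "m = \<bar>deriv r t0\<bar> / 2"
  define M where "M = \<bar>deriv s t0\<bar> + 1"
  have m: "m > 0" using assms by (simp add: m_def)
  obtain \<epsilon>1 where \<epsilon>1: "\<epsilon>1 > 0" "\<And>t. dist t t0 < \<epsilon>1 \<Longrightarrow> dist (deriv r t) (deriv r t0) < m"
    using cr m unfolding continuous_at_eps_delta by metis
  obtain \<epsilon>2 where \<epsilon>2: "\<epsilon>2 > 0" "\<And>t. dist t t0 < \<epsilon>2 \<Longrightarrow> dist (deriv s t) (deriv s t0) < 1"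
    using cs unfolding continuous_at_eps_delta by (metis zero_less_one)
  obtain \<epsilon>3 where \<epsilon>3: "\<epsilon>3 > 0" "ball t0 \<epsilon>3 \<subseteq> J" using assms open_contains_ball by blast
  define \<epsilon> where "\<epsilon> = min \<epsilon>1 (min \<epsilon>2 \<epsilon>3)"
  have dr: "\<bar>deriv r t\<bar> \<ge> m" and ds: "\<bar>deriv s t\<bar> \<le> M" and tJ: "t \<in> J" if "t \<in> ball t0 \<epsilon>" for t
  proof -
    have d: "dist t t0 < \<epsilon>1" "dist t t0 < \<epsilon>2" using that by (auto simp: \<epsilon>_def dist_commute)
    show "\<bar>deriv r t\<bar> \<ge> m" using \<epsilon>1(2)[OF d(1)] unfolding m_def dist_real_def by linarith
    show "\<bar>deriv s t\<bar> \<le> M" using \<epsilon>2(2)[OF d(2)] by (simp add: M_def dist_real_def)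
    show "t \<in> J" using that \<epsilon>3(2) by (auto simp: \<epsilon>_def)
  qed
  have lt: "\<bar>s t - s t'\<bar> \<le> M / m * \<bar>r t - r t'\<bar>" if tt: "t < t'" "t \<in> ball t0 \<epsilon>" "t' \<in> ball t0 \<epsilon>" for t t'
  proof -
    have mid: "u \<in> ball t0 \<epsilon>" if "t \<le> u" "u \<le> t'" for u
      using that tt by (auto simp: dist_real_def)
    have "\<exists>u. t < u \<and> u < t' \<and> r t' - r t = (t' - t) * deriv r u"
      by (rule MVT2[OF tt(1)]) (use Ck_on_DERIV[of 0 J r] tJ[OF mid] assms in auto)
    then obtain u where u: "t < u" "u < t'" "r t' - r t = (t' - t) * deriv r u" by blast
    have "\<exists>v. t < v \<and> v < t' \<and> s t' - s t = (t' - t) * deriv s v"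
      by (rule MVT2[OF tt(1)]) (use Ck_on_DERIV[of 0 J s] tJ[OF mid] assms in auto)
    then obtain v where v: "t < v" "v < t'" "s t' - s t = (t' - t) * deriv s v" by blast
    have "\<bar>s t - s t'\<bar> = (t' - t) * \<bar>deriv s v\<bar>" using v tt by (simp add: abs_minus_commute[of "s t"] abs_mult)
    also have "\<dots> \<le> (t' - t) * M" using ds[OF mid, of v] v tt by (intro mult_left_mono) auto
    also have "\<dots> = M / m * ((t' - t) * m)" using m by simp
    also have "\<dots> \<le> M / m * ((t' - t) * \<bar>deriv r u\<bar>)"
      using dr[OF mid, of u] u tt m by (intro mult_left_mono) (auto simp: M_def)
    also have "(t' - t) * \<bar>deriv r u\<bar> = \<bar>r t - r t'\<bar>" using u tt by (simp add: abs_minus_commute[of "r t"] abs_mult)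
    finally show ?thesis .
  qed
  show ?thesis
  proof (intro exI conjI ballI)
    show "\<epsilon> > 0" using \<epsilon>1 \<epsilon>2 \<epsilon>3 by (simp add: \<epsilon>_def)
    show "M / m \<ge> 0" using m by (simp add: M_def)
    show "ball t0 \<epsilon> \<subseteq> J" using tJ by blast
    fix t t' assume "t \<in> ball t0 \<epsilon>" "t' \<in> ball t0 \<epsilon>"
    then show "\<bar>s t - s t'\<bar> \<le> M / m * \<bar>r t - r t'\<bar>"
      using lt[of t t'] lt[of t' t] by (cases t t' rule: linorder_cases) (auto simp: abs_minus_commute)
  qed
qed

lemma local_param_Ck_on:
  "local_param \<Gamma> r s J t0 \<Longrightarrow> Ck_on 5 J r \<and> Ck_on 5 J s"
  unfolding local_param_def using uc_derivs_Ck_on by blast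

text \<open>The parametrisation is a homeomorphism onto a relatively open piece, so no other branch
  of \<open>\<Gamma>\<close> comes near the point: every nearby zero of \<open>\<psi>\<close> is a
  curve point with parameter close to \<open>t0\<close>.\<close>

lemma local_param_nhd:
  assumes "local_param \<Gamma> r s J t0" "\<epsilon> > 0" "ball t0 \<epsilon> \<subseteq> J"
  shows "\<exists>U. open U \<and> (r t0, s t0) \<in> U \<and> \<Gamma> \<inter> U \<subseteq> (\<lambda>t. (r t, s t)) ` ball t0 \<epsilon>"
proof -
  obtain W \<eta> where W: "openin (top_of_set \<Gamma>) W" "homeomorphism J W (\<lambda>t. (r t, s t)) \<eta>"
    using assms(1) unfolding local_param_def by blast
  have "openin (top_of_set J) (ball t0 \<epsilon>)"
    using assms(3) by (simp add: openin_open_eq open_subset)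
  then have "openin (top_of_set W) ((\<lambda>t. (r t, s t)) ` ball t0 \<epsilon>)"
    by (rule homeomorphism_imp_open_map[OF W(2)])
  then have "openin (top_of_set \<Gamma>) ((\<lambda>t. (r t, s t)) ` ball t0 \<epsilon>)"
    using W(1) openin_trans by blast
  then obtain U where U: "open U" "(\<lambda>t. (r t, s t)) ` ball t0 \<epsilon> = \<Gamma> \<inter> U" by (auto simp: openin_open)
  have "(r t0, s t0) \<in> (\<lambda>t. (r t, s t)) ` ball t0 \<epsilon>" using assms(2) by simp
  then show ?thesis using U by auto
qed

lemma local_param_in: "local_param \<Gamma> r s J t0 \<Longrightarrow> t \<in> J \<Longrightarrow> (r t, s t) \<in> \<Gamma>"
  unfolding local_param_def homeomorphism_def by (fastforce dest: openin_imp_subset)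

lemma open_square:
  assumes "open U" "(a::real, b::real) \<in> U"
  shows "\<exists>\<delta>>0. \<forall>x y. \<bar>x - a\<bar> < \<delta> \<longrightarrow> \<bar>y - b\<bar> < \<delta> \<longrightarrow> (x, y) \<in> U"
proof -
  obtain e where e: "e > 0" "ball (a, b) e \<subseteq> U" using assms open_contains_ball by blast
  have "(x, y) \<in> U" if "\<bar>x - a\<bar> < e / 2" "\<bar>y - b\<bar> < e / 2" for x y
  proof -
    have "dist (x, y) (a, b) < e" using dist_le_taxi[of "(x, y)" "(a, b)"] that by (simp add: taxi_def)
    then show ?thesis using e(2) by (auto simp: dist_commute)
  qed
  then show ?thesis using e(1) by (intro exI[of _ "e / 2"]) auto
qed

text \<open>One component of the parametrisation has nonzero derivative at \<open>t0\<close>, so the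
  zero set is a Lipschitz graph over the first or, after reflection, the second axis. The side where
  \<open>\<psi>\<close> is negative follows from the statement for \<open>- \<psi>\<close>.\<close>

lemma axis_accessible_side:
  fixes \<psi> :: "real \<times> real \<Rightarrow> real"
  assumes cont: "continuous_on UNIV \<psi>" and "open \<Omega>"
    and \<Gamma>: "\<Gamma> = {z \<in> \<Omega>. \<psi> z = 0}" and param: "local_param \<Gamma> r s J t0"
  shows "axis_accessible {z \<in> \<Omega>. \<psi> z > 0} (r t0, s t0)"
proof -
  have J: "open J" "t0 \<in> J" and ne: "deriv r t0 \<noteq> 0 \<or> deriv s t0 \<noteq> 0"
    using param by (auto simp: local_param_def)
  have C1: "Ck_on 1 J r" "Ck_on 1 J s" using local_param_Ck_on[OF param] Ck_on_le by (metis one_le_numeral)+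
  have P: "(r t0, s t0) \<in> \<Omega>" "\<psi> (r t0, s t0) = 0" using local_param_in[OF param J(2)] \<Gamma> by auto
  show ?thesis
  proof (cases "deriv r t0 = 0")
    case False
    obtain \<epsilon> L where L: "\<epsilon> > 0" "L \<ge> 0" "ball t0 \<epsilon> \<subseteq> J"
      "\<And>t t'. t \<in> ball t0 \<epsilon> \<Longrightarrow> t' \<in> ball t0 \<epsilon> \<Longrightarrow> \<bar>s t - s t'\<bar> \<le> L * \<bar>r t - r t'\<bar>"
      using param_lipschitz[OF J C1 False] by blast
    obtain U where U: "open U" "(r t0, s t0) \<in> U" "\<Gamma> \<inter> U \<subseteq> (\<lambda>t. (r t, s t)) ` ball t0 \<epsilon>"
      using local_param_nhd[OF param L(1,3)] by blast
    obtain \<delta> where \<delta>: "\<delta> > 0" "\<And>x y. \<bar>x - r t0\<bar> < \<delta> \<Longrightarrow> \<bar>y - s t0\<bar> < \<delta> \<Longrightarrow> (x, y) \<in> U \<inter> \<Omega>"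
      using open_square[of "U \<inter> \<Omega>" "r t0" "s t0"] U P assms(2) by blast
    show ?thesis
    proof (rule axis_accessible_superlevel[OF cont \<delta>(1) L(2) P(2)])
      fix x y x' y' assume A: "\<bar>x - r t0\<bar> < \<delta>" "\<bar>y - s t0\<bar> < \<delta>" "\<bar>x' - r t0\<bar> < \<delta>" "\<bar>y' - s t0\<bar> < \<delta>"
        "\<psi> (x, y) = 0" "\<psi> (x', y') = 0"
      then have "(x, y) \<in> \<Gamma> \<inter> U" "(x', y') \<in> \<Gamma> \<inter> U" using \<delta>(2) \<Gamma> by auto
      then have "(x, y) \<in> (\<lambda>t. (r t, s t)) ` ball t0 \<epsilon>" "(x', y') \<in> (\<lambda>t. (r t, s t)) ` ball t0 \<epsilon>"
        using U(3) by blast+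
      then obtain t t' where "t \<in> ball t0 \<epsilon>" "t' \<in> ball t0 \<epsilon>" "x = r t" "y = s t" "x' = r t'" "y' = s t'"
        by (auto simp del: mem_ball)
      then show "\<bar>y - y'\<bar> \<le> L * \<bar>x - x'\<bar>" using L(4) by simp
    qed (use \<delta>(2) in blast)
  next
    case True
    then have sne: "deriv s t0 \<noteq> 0" using ne by simp
    obtain \<epsilon> L where L: "\<epsilon> > 0" "L \<ge> 0" "ball t0 \<epsilon> \<subseteq> J"
      "\<And>t t'. t \<in> ball t0 \<epsilon> \<Longrightarrow> t' \<in> ball t0 \<epsilon> \<Longrightarrow> \<bar>r t - r t'\<bar> \<le> L * \<bar>s t - s t'\<bar>"
      using param_lipschitz[OF J C1(2,1) sne] by blast
    obtain U where U: "open U" "(r t0, s t0) \<in> U" "\<Gamma> \<inter> U \<subseteq> (\<lambda>t. (r t, s t)) ` ball t0 \<epsilon>"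
      using local_param_nhd[OF param L(1,3)] by blast
    obtain \<delta> where \<delta>: "\<delta> > 0" "\<And>x y. \<bar>x - r t0\<bar> < \<delta> \<Longrightarrow> \<bar>y - s t0\<bar> < \<delta> \<Longrightarrow> (x, y) \<in> U \<inter> \<Omega>"
      using open_square[of "U \<inter> \<Omega>" "r t0" "s t0"] U P assms(2) by blast
    have "axis_accessible {z \<in> prod.swap ` \<Omega>. (\<psi> \<circ> prod.swap) z > 0} (s t0, r t0)"
    proof (rule axis_accessible_superlevel[OF _ \<delta>(1) L(2)])
      show "continuous_on UNIV (\<psi> \<circ> prod.swap)"
        by (intro continuous_on_compose continuous_on_swap continuous_on_subset[OF cont]) auto
      fix x y x' y' assume A: "\<bar>x - s t0\<bar> < \<delta>" "\<bar>y - r t0\<bar> < \<delta>" "\<bar>x' - s t0\<bar> < \<delta>" "\<bar>y' - r t0\<bar> < \<delta>"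
        "(\<psi> \<circ> prod.swap) (x, y) = 0" "(\<psi> \<circ> prod.swap) (x', y') = 0"
      then have "(y, x) \<in> \<Gamma> \<inter> U" "(y', x') \<in> \<Gamma> \<inter> U" using \<delta>(2) \<Gamma> by auto
      then have "(y, x) \<in> (\<lambda>t. (r t, s t)) ` ball t0 \<epsilon>" "(y', x') \<in> (\<lambda>t. (r t, s t)) ` ball t0 \<epsilon>"
        using U(3) by blast+
      then obtain t t' where "t \<in> ball t0 \<epsilon>" "t' \<in> ball t0 \<epsilon>" "y = r t" "x = s t" "y' = r t'" "x' = s t'"
        by (auto simp del: mem_ball)
      then show "\<bar>y - y'\<bar> \<le> L * \<bar>x - x'\<bar>" using L(4) by simp
    next
      fix x y assume "\<bar>x - s t0\<bar> < \<delta>" "\<bar>y - r t0\<bar> < \<delta>"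
      then have "(y, x) \<in> \<Omega>" using \<delta>(2) by blast
      then show "(x, y) \<in> prod.swap ` \<Omega>" by (metis image_eqI swap_simp)
    qed (use P in simp)
    also have "{z \<in> prod.swap ` \<Omega>. (\<psi> \<circ> prod.swap) z > 0} = prod.swap ` {z \<in> \<Omega>. \<psi> z > 0}"
    proof (rule set_eqI)
      show "z \<in> {z \<in> prod.swap ` \<Omega>. (\<psi> \<circ> prod.swap) z > 0} \<longleftrightarrow> z \<in> prod.swap ` {z \<in> \<Omega>. \<psi> z > 0}" for z
        by (cases z) simp
    qed
    finally have *: "axis_accessible (prod.swap ` {z \<in> \<Omega>. \<psi> z > 0}) (s t0, r t0)" .
    show ?thesis by (rule axis_accessible_swap) (use * in \<open>simp only: swap_simp\<close>)
  qed
qed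

section \<open>Reduction of jets by the equation\<close>

text \<open>The part of the recursion of \<open>wrec\<close> that is linear in \<open>w\<close>. For
  \<open>p \<ge> 2\<close> it reads only entries with first index below \<open>p\<close> and total
  order at most \<open>p + q\<close>; the two inductions, over \<open>p\<close> and over the order,
  rest on this.\<close>

definition rec_op :: "(nat \<Rightarrow> nat \<Rightarrow> real) \<Rightarrow> (nat \<Rightarrow> nat \<Rightarrow> real) \<Rightarrow> (nat \<Rightarrow> nat \<Rightarrow> real) \<Rightarrow> nat \<Rightarrow> nat \<Rightarrow> real" where
  "rec_op \<alpha> \<beta> w p q = w (p - 2) (q + 2) +
     (\<Sum>i=0..p-2. \<Sum>j=0..q. real ((p - 2) choose i) * real (q choose j) *
             (\<alpha> (p - 2 - i) (q - j) * w (i + 1) j + \<beta> (p - 2 - i) (q - j) * w i (j + 1)))"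

section \<open>Uniqueness and superposition for the coefficient recursion\<close>

lemma wrec_less_2: "p < 2 \<Longrightarrow> wrec ini \<alpha> \<beta> \<epsilon> p q = ini p q"
  by (simp add: wrec.simps[of _ _ _ _ p])

lemma wrec_ge_2: "p \<ge> 2 \<Longrightarrow> wrec ini \<alpha> \<beta> \<epsilon> p q = - \<epsilon> p q - rec_op \<alpha> \<beta> (wrec ini \<alpha> \<beta> \<epsilon>) p q"
  by (simp add: wrec.simps[of _ _ _ _ p] rec_op_def)

lemma rec_op_cong:
  assumes "p \<ge> 2" "\<And>p' q'. p' < p \<Longrightarrow> p' + q' \<le> p + q \<Longrightarrow> w p' q' = w' p' q'"
  shows "rec_op \<alpha> \<beta> w p q = rec_op \<alpha> \<beta> w' p q"
  unfolding rec_op_def using assms(1)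
  by (intro arg_cong2[where f = "(+)"] sum.cong arg_cong2[where f = "(*)"] refl assms(2)) auto

lemma rec_op_add: "rec_op \<alpha> \<beta> (\<lambda>p q. w p q + w' p q) p q = rec_op \<alpha> \<beta> w p q + rec_op \<alpha> \<beta> w' p q"
  unfolding rec_op_def by (simp add: sum.distrib[symmetric] algebra_simps)

lemma rec_op_cmult: "rec_op \<alpha> \<beta> (\<lambda>p q. x * w p q) p q = x * rec_op \<alpha> \<beta> w p q"
  unfolding rec_op_def by (simp add: sum_distrib_left algebra_simps)

lemma rec_op_0: "rec_op \<alpha> \<beta> (\<lambda>p q. 0) p q = 0"
  by (simp add: rec_op_def)

lemma rec_op_sum: "rec_op \<alpha> \<beta> (\<lambda>p q. \<Sum>k\<in>A. x k * w k p q) p q = (\<Sum>k\<in>A. x k * rec_op \<alpha> \<beta> (w k) p q)"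
  by (induction A rule: infinite_finite_induct) (simp_all add: rec_op_0 rec_op_add rec_op_cmult)

text \<open>The recursion never raises the total order, so a jet known only up to order
  \<open>N\<close> is determined there by its entries with \<open>p < 2\<close> and the
  source.\<close>

lemma wrec_unique:
  assumes "\<And>p q. p + q \<le> N \<Longrightarrow> p < 2 \<Longrightarrow> w p q = ini p q"
    and "\<And>p q. p + q \<le> N \<Longrightarrow> p \<ge> 2 \<Longrightarrow> w p q = - \<epsilon> p q - rec_op \<alpha> \<beta> w p q"
  shows "p + q \<le> N \<Longrightarrow> w p q = wrec ini \<alpha> \<beta> \<epsilon> p q"
proof (induction p arbitrary: q rule: less_induct)
  case (less p)
  show ?case
  proof (cases "p < 2")
    case True
    then show ?thesis using assms(1) less.prems by (simp add: wrec_less_2)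
  next
    case False
    have "rec_op \<alpha> \<beta> w p q = rec_op \<alpha> \<beta> (wrec ini \<alpha> \<beta> \<epsilon>) p q"
      using False less by (intro rec_op_cong) auto
    then show ?thesis using assms(2)[OF less.prems] False by (simp add: wrec_ge_2)
  qed
qed

lemma wrec_eq_0:
  assumes "\<And>p q. p + q \<le> N \<Longrightarrow> p < 2 \<Longrightarrow> ini p q = 0" "\<And>p q. p + q \<le> N \<Longrightarrow> p \<ge> 2 \<Longrightarrow> \<epsilon> p q = 0" "p + q \<le> N"
  shows "wrec ini \<alpha> \<beta> \<epsilon> p q = 0"
  by (rule wrec_unique[of N "\<lambda>_ _. 0", symmetric]) (use assms in \<open>auto simp: rec_op_0\<close>)

lemma au_eq_0: "p + q < m + n \<Longrightarrow> au S a z p q m n = 0"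
  unfolding au_def by (rule wrec_eq_0[of "p + q"]) auto

lemma af_eq_0: "p + q < m + n + 2 \<Longrightarrow> af S a z p q m n = 0"
  unfolding af_def by (rule wrec_eq_0[of "p + q"]) auto

lemma finite_Lam [simp]: "finite (Lam K)"
  by (rule finite_subset[of _ "{..K} \<times> {..K}"]) (auto simp: Lam_def)

lemma Lam1_subset: "Lam1 K \<subseteq> Lam K"
  by (auto simp: Lam1_def)

lemma finite_Lam1 [simp]: "finite (Lam1 K)"
  using Lam1_subset finite_subset finite_Lam by metis

text \<open>Index sets that depend on \<open>p + q\<close> would block interchanging sums. They can
  be enlarged to fixed ones because \<open>au\<close> vanishes for data of higher order than
  \<open>p + q\<close>, and \<open>af\<close>, whose data lag behind by two orders, correspondingly
  earlier.\<close>

lemma full_jet_extend: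
  assumes "p + q \<le> N" "2 \<le> N"
  shows "full_jet S a z U F p q = (\<Sum>k\<in>Lam1 N. U (fst k) (snd k) * au S a z p q (fst k) (snd k))
      + (\<Sum>k\<in>Lam (N - 2). F (fst k) (snd k) * af S a z p q (fst k) (snd k))"
proof -
  have "(\<Sum>(m, n)\<in>Lam1 (p + q). au S a z p q m n * U m n) = (\<Sum>(m, n)\<in>Lam1 N. au S a z p q m n * U m n)"
    by (rule sum.mono_neutral_left[OF finite_Lam1]) (use assms in \<open>auto simp: Lam1_def Lam_def intro!: au_eq_0\<close>)
  moreover have "(\<Sum>(m, n)\<in>Lam (p + q - 2). af S a z p q m n * F m n) = (\<Sum>(m, n)\<in>Lam (N - 2). af S a z p q m n * F m n)"
    by (rule sum.mono_neutral_left[OF finite_Lam]) (use assms in \<open>auto simp: Lam_def intro!: af_eq_0\<close>)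
  ultimately show ?thesis unfolding full_jet_def by (simp add: case_prod_unfold mult.commute)
qed

text \<open>Leibniz' expansion of the derivative of order \<open>(p - 2, q)\<close> of
  \<open>f / a\<close>, with \<open>c\<close> the jet of \<open>1 / a\<close>.\<close>

definition source_op :: "(nat \<Rightarrow> nat \<Rightarrow> real) \<Rightarrow> (nat \<Rightarrow> nat \<Rightarrow> real) \<Rightarrow> nat \<Rightarrow> nat \<Rightarrow> real" where
  "source_op c F p q = (\<Sum>i\<le>p-2. \<Sum>j\<le>q. real ((p - 2) choose i) * real (q choose j) * (c (p - 2 - i) (q - j) * F i j))"

text \<open>Superposition: \<open>au\<close> and \<open>af\<close> are the solutions of the
  recursion for unit data, so their combination solves it with data \<open>U\<close> and the full
  source. Afterwards all statements about \<open>full_jet\<close> become statements about a single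
  recursion.\<close>

lemma full_jet_eq_wrec:
  "full_jet S a z U F p q = wrec U (side_deriv S (\<lambda>x. Dx a x / a x) z) (side_deriv S (\<lambda>x. Dy a x / a x) z)
     (source_op (side_deriv S (\<lambda>x. 1 / a x) z) F) p q"
proof -
  let ?\<alpha> = "side_deriv S (\<lambda>x. Dx a x / a x) z" and ?\<beta> = "side_deriv S (\<lambda>x. Dy a x / a x) z"
  let ?c = "side_deriv S (\<lambda>x. 1 / a x) z"
  \<comment> \<open>The summand 2 meets the condition \<open>2 \<le> N\<close> of
    \<open>full_jet_extend\<close>.\<close>
  define N where "N = p + q + 2"
  define e where "e k p q = (if fst k \<le> p - 2 \<and> snd k \<le> q
          then real ((p - 2) choose fst k) * real (q choose snd k) * ?c (p - 2 - fst k) (q - snd k)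
          else 0)" for k :: "nat \<times> nat" and p q
  define d where "d k p q = (if k = (p, q) then 1 else 0 :: real)" for k :: "nat \<times> nat" and p q
  have au: "au S a z p q (fst k) (snd k) = wrec (d k) ?\<alpha> ?\<beta> (\<lambda>_ _. 0) p q" for p q k
    by (cases k) (simp add: au_def d_def[abs_def])
  have af: "af S a z p q (fst k) (snd k) = wrec (\<lambda>_ _. 0) ?\<alpha> ?\<beta> (e k) p q" for p q k
    by (cases k) (simp add: af_def e_def[abs_def] cong: if_cong)
  define V where "V p q = (\<Sum>k\<in>Lam1 N. U (fst k) (snd k) * wrec (d k) ?\<alpha> ?\<beta> (\<lambda>_ _. 0) p q)
      + (\<Sum>k\<in>Lam (N - 2). F (fst k) (snd k) * wrec (\<lambda>_ _. 0) ?\<alpha> ?\<beta> (e k) p q)" for p q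
  define \<epsilon> where "\<epsilon> p q = (\<Sum>k\<in>Lam (N - 2). F (fst k) (snd k) * e k p q)" for p q
  have \<epsilon>: "\<epsilon> p q = source_op ?c F p q" if "p + q \<le> N" "p \<ge> 2" for p q
  proof -
    have "\<epsilon> p q = (\<Sum>k\<in>{..p-2}\<times>{..q}. F (fst k) (snd k) * e k p q)"
      unfolding \<epsilon>_def by (rule sum.mono_neutral_right[OF finite_Lam]) (use that in \<open>auto simp: Lam_def e_def\<close>)
    also have "\<dots> = (\<Sum>(i, j)\<in>{..p-2}\<times>{..q}. real ((p - 2) choose i) * real (q choose j) * (?c (p - 2 - i) (q - j) * F i j))"
      by (rule sum.cong) (auto simp: e_def)
    finally show ?thesis by (simp add: sum.cartesian_product source_op_def)
  qed
  have "V p q = wrec U ?\<alpha> ?\<beta> (source_op ?c F) p q" if "p + q \<le> N" for p q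
  proof (rule wrec_unique[OF _ _ that])
    fix p q assume pq: "p + q \<le> N" "p < 2"
    then have "V p q = (\<Sum>k\<in>Lam1 N. U (fst k) (snd k) * d k p q)"
      unfolding V_def by (simp add: wrec_less_2)
    also have "\<dots> = (\<Sum>k\<in>Lam1 N. if k = (p, q) then U p q else 0)"
      by (rule sum.cong) (auto simp: d_def)
    also have "\<dots> = U p q"
    proof -
      have "(p, q) \<in> Lam1 N" using pq by (auto simp: Lam1_def Lam_def)
      then show ?thesis by simp
    qed
    finally show "V p q = U p q" .
  next
    fix p q assume pq: "p + q \<le> N" "p \<ge> 2"
    have "V p q = - (\<Sum>k\<in>Lam1 N. U (fst k) (snd k) * rec_op ?\<alpha> ?\<beta> (wrec (d k) ?\<alpha> ?\<beta> (\<lambda>_ _. 0)) p q)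
      - (\<epsilon> p q + (\<Sum>k\<in>Lam (N - 2). F (fst k) (snd k) * rec_op ?\<alpha> ?\<beta> (wrec (\<lambda>_ _. 0) ?\<alpha> ?\<beta> (e k)) p q))"
      unfolding V_def \<epsilon>_def using pq
      by (simp add: wrec_ge_2 sum_negf[symmetric] sum.distrib[symmetric] algebra_simps)
    then show "V p q = - source_op ?c F p q - rec_op ?\<alpha> ?\<beta> V p q"
      unfolding V_def[abs_def] by (simp add: rec_op_add rec_op_sum \<epsilon>[OF pq])
  qed
  from this[of p q] show ?thesis using full_jet_extend[of p q N] by (simp add: V_def au af N_def)
qed

text \<open>\<open>W\<close> serves as its own initial data, since \<open>wrec\<close> reads only
  the entries with \<open>p < 2\<close>.\<close>

lemma full_jet_eqI:
  assumes rec: "\<And>p q. p + q \<le> N \<Longrightarrow> p \<ge> 2 \<Longrightarrow> W p q = - source_op (side_deriv S (\<lambda>x. 1 / a x) z) F p q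
      - rec_op (side_deriv S (\<lambda>x. Dx a x / a x) z) (side_deriv S (\<lambda>x. Dy a x / a x) z) W p q"
    and "p + q \<le> N"
  shows "full_jet S a z W F p q = W p q"
  unfolding full_jet_eq_wrec by (rule wrec_unique[symmetric, OF _ _ assms(2)]) (use rec in auto)

section \<open>The one-sided jet of a solution of the equation\<close>

context boundary_point
begin

lemma Dy_pow_add:
  assumes "tame_partials S P n F" "tame_partials S P n G" "z \<in> S"
  shows "(Dy ^^ n) (\<lambda>z. F z + G z) z = (Dy ^^ n) F z + (Dy ^^ n) G z"
  using assms
proof (induction n arbitrary: z)
  case (Suc n)
  have l: "tame_partials S P n F" "tame_partials S P n G"
    using Suc.prems has_partials_Suc_imp by blast+
  have d: "tame_partials S P (Suc 0) ((Dy ^^ n) F)" "tame_partials S P (Suc 0) ((Dy ^^ n) G)"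
    by (rule has_partials_Dy_pow, use Suc.prems in simp)+
  have "(Dy ^^ Suc n) (\<lambda>z. F z + G z) z = Dy ((Dy ^^ n) (\<lambda>z. F z + G z)) z" by simp
  also have "\<dots> = Dy (\<lambda>z. (Dy ^^ n) F z + (Dy ^^ n) G z) z"
    by (rule Dy_cong[OF open_S Suc.IH[OF l] Suc.prems(3)])
  also have "\<dots> = Dy ((Dy ^^ n) F) z + Dy ((Dy ^^ n) G) z"
    by (rule Dy_eqI) (intro DERIV_add has_partials_DERIV_y[OF d(1) Suc.prems(3)] has_partials_DERIV_y[OF d(2) Suc.prems(3)])
  finally show ?case by simp
qed simp

lemma Dxy_add:
  assumes "tame_partials S P (m + n) F" "tame_partials S P (m + n) G" "z \<in> S"
  shows "Dxy m n (\<lambda>z. F z + G z) z = Dxy m n F z + Dxy m n G z"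
  using assms
proof (induction m arbitrary: z)
  case 0
  then show ?case using Dy_pow_add[of n F G z] by (simp add: Dxy_def)
next
  case (Suc m)
  have l: "tame_partials S P (m + n) F" "tame_partials S P (m + n) G"
    using Suc.prems(1,2) by (auto intro: has_partials_le simp del: has_partials.simps)
  have d: "tame_partials S P (Suc 0) (Dxy m n F)" "tame_partials S P (Suc 0) (Dxy m n G)"
    by (rule has_partials_Dxy, use Suc.prems in simp)+
  have "Dxy (Suc m) n (\<lambda>z. F z + G z) z = Dx (\<lambda>z. Dxy m n F z + Dxy m n G z) z"
    unfolding Dxy_Suc_x by (rule Dx_cong[OF open_S Suc.IH[OF l] Suc.prems(3)])
  also have "\<dots> = Dx (Dxy m n F) z + Dx (Dxy m n G) z"
    by (rule Dx_eqI) (intro DERIV_add has_partials_DERIV_x[OF d(1) Suc.prems(3)] has_partials_DERIV_x[OF d(2) Suc.prems(3)])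
  finally show ?case by (simp add: Dxy_Suc_x)
qed

lemma bval_Dxy_add:
  assumes "tame_partials S P (m + n) F" "tame_partials S P (m + n) G"
  shows "bval S P (Dxy m n (\<lambda>z. F z + G z)) = bval S P (Dxy m n F) + bval S P (Dxy m n G)"
proof -
  have "bval S P (Dxy m n (\<lambda>z. F z + G z)) = bval S P (\<lambda>z. Dxy m n F z + Dxy m n G z)"
    by (rule bval_cong) (rule Dxy_add[OF assms])
  then show ?thesis using assms by (simp add: bval_add tame_Dxy)
qed

lemma Dxy_zero: "z \<in> S \<Longrightarrow> Dxy m n (\<lambda>_. 0) z = 0"
  using Dxy_add[of m n "\<lambda>_. 0" "\<lambda>_. 0" z] by (simp add: tame_partials_const)

lemma bval_Dxy_uminus:
  assumes "tame_partials S P (m + n) F"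
  shows "bval S P (Dxy m n (\<lambda>z. - F z)) = - bval S P (Dxy m n F)"
proof -
  have t: "tame_partials S P (m + n) (\<lambda>z. - F z)"
    using tame_partials_mult[OF tame_partials_const[of _ "-1"] assms] by simp
  have "bval S P (Dxy m n F) + bval S P (Dxy m n (\<lambda>z. - F z)) = bval S P (Dxy m n (\<lambda>z. F z + - F z))"
    by (rule bval_Dxy_add[OF assms t, symmetric])
  also have "\<dots> = bval S P (\<lambda>_. 0)" by (rule bval_cong) (simp add: Dxy_zero)
  also have "\<dots> = 0" by (rule bval_eqI) simp
  finally show ?thesis by simp
qed

text \<open>Solve the equation for \<open>u\<^sub>x\<^sub>x\<close> and differentiate it with Leibniz' rule.\<close>
lemma full_jet_of_solution:
  assumes N: "2 \<le> N" and u: "tame_partials S P N u" and f: "tame_partials S P (N - 2) f"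
    and a: "tame_partials S P (N - 1) a" "\<And>z. z \<in> S \<Longrightarrow> a z \<noteq> 0" "bval S P a \<noteq> 0"
    and pde: "\<And>z. z \<in> S \<Longrightarrow> - (Dx (\<lambda>z. a z * Dx u z) z + Dy (\<lambda>z. a z * Dy u z) z) = f z"
    and pq: "p + q \<le> N"
  shows "full_jet S a P (side_deriv S u P) (side_deriv S f P) p q = side_deriv S u P p q"
proof (rule full_jet_eqI[OF _ pq])
  fix p q assume pq: "p + q \<le> N" "p \<ge> 2"
  define m where "m = p - 2"
  have p: "p = Suc (Suc m)" and mq: "m + q \<le> N - 2" using pq by (auto simp: m_def)
  obtain K where K: "N = Suc (Suc K)" using N by (metis add_2_eq_Suc le_Suc_ex)
  have ta: "tame_partials S P (Suc K) a" and tu: "tame_partials S P (Suc (Suc K)) u" using a u K by simp_all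
  have Dd: "tame_partials S P (Suc K) (Dx u)" "tame_partials S P (Suc K) (Dy u)"
    "tame_partials S P K (Dx a)" "tame_partials S P K (Dy a)" "tame_partials S P K (Dy (Dy u))" "tame_partials S P K (Dx (Dx u))"
    using ta tu by auto
  have Kd: "tame_partials S P K (Dx u)" "tame_partials S P K (Dy u)" "tame_partials S P K a" "tame_partials S P K f"
    using Dd(1,2) ta f K by (auto intro: has_partials_le simp del: has_partials.simps)
  define c where "c z = 1 / a z" for z
  define \<alpha> where "\<alpha> z = Dx a z / a z" for z
  define \<beta> where "\<beta> z = Dy a z / a z" for z
  have tc: "tame_partials S P K c"
    using tame_partials_inverse[OF Kd(3) a(2,3)] by (simp add: c_def[abs_def] inverse_eq_divide)
  have t\<alpha>: "tame_partials S P K \<alpha>" using tame_partials_mult[OF Dd(3) tc] by (simp add: \<alpha>_def[abs_def] c_def)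
  have t\<beta>: "tame_partials S P K \<beta>" using tame_partials_mult[OF Dd(4) tc] by (simp add: \<beta>_def[abs_def] c_def)
  have eq: "Dx (Dx u) z = - ((c z * f z + Dy (Dy u) z) + (\<alpha> z * Dx u z + \<beta> z * Dy u z))" if z: "z \<in> S" for z
  proof -
    have "Dx (\<lambda>z. a z * Dx u z) z = Dx a z * Dx u z + Dx (Dx u) z * a z"
      by (rule Dx_eqI) (use DERIV_mult[OF has_partials_DERIV_x[OF ta z] has_partials_DERIV_x[OF Dd(1) z]] in simp)
    moreover have "Dy (\<lambda>z. a z * Dy u z) z = Dy a z * Dy u z + Dy (Dy u) z * a z"
      by (rule Dy_eqI) (use DERIV_mult[OF has_partials_DERIV_y[OF ta z] has_partials_DERIV_y[OF Dd(2) z]] in simp)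
    ultimately have "Dx (Dx u) z * a z = - (f z + Dy (Dy u) z * a z + (Dx a z * Dx u z + Dy a z * Dy u z))"
      using pde[OF z] by simp
    then have "Dx (Dx u) z = - (f z + Dy (Dy u) z * a z + (Dx a z * Dx u z + Dy a z * Dy u z)) / a z"
      using a(2)[OF z] by (simp add: nonzero_eq_divide_eq)
    then show ?thesis using a(2)[OF z] by (simp add: c_def \<alpha>_def \<beta>_def add_divide_distrib diff_divide_distrib)
  qed
  have low: "tame_partials S P (m + q) F" if "tame_partials S P K F" for F
    by (rule has_partials_le[OF that]) (use mq K in simp)
  note tm = low[OF tame_partials_mult]
  \<comment> \<open>\<open>Dxy m q (Dx (Dx u))\<close> takes two \<open>x\<close>-derivatives first,
    \<open>Dxy p q u\<close> takes all of them last; the symmetry of mixed derivatives identifies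
    their limits.\<close>
  have "side_deriv S u P p q = bval S P (Dxy m q (Dx (Dx u)))"
  proof -
    have "bval S P (Dxy m q (Dx (Dx u))) = bval S P (Dxy (Suc m) q (Dx u))"
      by (rule bval_Dxy_Dx, rule has_partials_le[OF Dd(1)]) (use mq K in simp)
    also have "\<dots> = bval S P (Dxy (Suc (Suc m)) q u)"
      by (rule bval_Dxy_Dx, rule has_partials_le[OF tu]) (use mq K in simp)
    finally show ?thesis by (simp add: side_deriv_eq_bval p)
  qed
  also have "\<dots> = bval S P (Dxy m q (\<lambda>z. - ((c z * f z + Dy (Dy u) z) + (\<alpha> z * Dx u z + \<beta> z * Dy u z))))"
    by (rule bval_cong) (rule Dxy_cong[OF open_S eq])
  also have "\<dots> = - bval S P (Dxy m q (\<lambda>z. (c z * f z + Dy (Dy u) z) + (\<alpha> z * Dx u z + \<beta> z * Dy u z)))"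
    by (rule bval_Dxy_uminus) (intro low tame_partials_add tame_partials_mult tc t\<alpha> t\<beta> Dd Kd)
  also have "\<dots> = - ((bval S P (Dxy m q (\<lambda>z. c z * f z)) + bval S P (Dxy m q (Dy (Dy u))))
      + (bval S P (Dxy m q (\<lambda>z. \<alpha> z * Dx u z)) + bval S P (Dxy m q (\<lambda>z. \<beta> z * Dy u z))))"
    by (subst bval_Dxy_add bval_Dxy_add[of _ _ "\<lambda>z. c z * f z" "Dy (Dy u)"] bval_Dxy_add[of _ _ "\<lambda>z. \<alpha> z * Dx u z" "\<lambda>z. \<beta> z * Dy u z"];
        (intro low tame_partials_add tame_partials_mult tc t\<alpha> t\<beta> Dd Kd)?)+ simp
  also have "bval S P (Dxy m q (Dy (Dy u))) = side_deriv S u P m (q + 2)"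
    by (simp add: Dxy_Dy side_deriv_eq_bval)
  also have "bval S P (Dxy m q (\<lambda>z. c z * f z)) = (\<Sum>i\<le>m. \<Sum>j\<le>q. real (m choose i) * real (q choose j)
      * (side_deriv S c P (m - i) (q - j) * side_deriv S f P i j))"
    unfolding side_deriv_eq_bval by (rule bval_Dxy_mult) (intro low tc Kd)+
  also have "bval S P (Dxy m q (\<lambda>z. \<alpha> z * Dx u z)) = (\<Sum>i\<le>m. \<Sum>j\<le>q. real (m choose i) * real (q choose j)
      * (side_deriv S \<alpha> P (m - i) (q - j) * side_deriv S u P (i + 1) j))"
  proof -
    have "bval S P (Dxy i j (Dx u)) = bval S P (Dxy (i + 1) j u)" if "i \<le> m" "j \<le> q" for i j
      using bval_Dxy_Dx[OF has_partials_le[OF tu], of i j] that mq K by simp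
    then show ?thesis unfolding side_deriv_eq_bval
      by (subst bval_Dxy_mult) (auto intro!: low t\<alpha> Kd sum.cong)
  qed
  also have "bval S P (Dxy m q (\<lambda>z. \<beta> z * Dy u z)) = (\<Sum>i\<le>m. \<Sum>j\<le>q. real (m choose i) * real (q choose j)
      * (side_deriv S \<beta> P (m - i) (q - j) * side_deriv S u P i (j + 1)))"
    unfolding side_deriv_eq_bval
    by (subst bval_Dxy_mult) (auto intro!: low t\<beta> Kd simp: Dxy_Dy)
  finally show "side_deriv S u P p q =
      - source_op (side_deriv S (\<lambda>x. 1 / a x) P) (side_deriv S f P) p q
      - rec_op (side_deriv S (\<lambda>x. Dx a x / a x) P) (side_deriv S (\<lambda>x. Dy a x / a x) P) (side_deriv S u P) p q"
    unfolding rec_op_def source_op_def m_def[symmetric] c_def[abs_def, symmetric] \<alpha>_def[abs_def, symmetric] \<beta>_def[abs_def, symmetric]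
    by (simp add: atLeast0AtMost distrib_left sum.distrib)
qed

end

section \<open>The transmission system\<close>

lemma wrec_add:
  "wrec (\<lambda>p q. ini p q + ini' p q) \<alpha> \<beta> (\<lambda>p q. \<epsilon> p q + \<epsilon>' p q) p q
    = wrec ini \<alpha> \<beta> \<epsilon> p q + wrec ini' \<alpha> \<beta> \<epsilon>' p q"
  by (rule wrec_unique[of "p + q", symmetric]) (auto simp: wrec_less_2 wrec_ge_2 rec_op_add)

lemma wrec_cmult:
  "wrec (\<lambda>p q. x * ini p q) \<alpha> \<beta> (\<lambda>p q. x * \<epsilon> p q) p q = x * wrec ini \<alpha> \<beta> \<epsilon> p q"
  by (rule wrec_unique[of "p + q", symmetric]) (auto simp: wrec_less_2 wrec_ge_2 rec_op_cmult algebra_simps)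

lemma full_jet_linear:
  "full_jet S a z (\<lambda>m n. x * U m n + y * U' m n) (\<lambda>m n. x * F m n + y * F' m n) p q
    = x * full_jet S a z U F p q + y * full_jet S a z U' F' p q"
proof -
  have "source_op c (\<lambda>m n. x * F m n + y * F' m n) = (\<lambda>p q. x * source_op c F p q + y * source_op c F' p q)" for c
    by (intro ext) (simp add: source_op_def sum_distrib_left sum.distrib[symmetric] algebra_simps)
  then show ?thesis unfolding full_jet_eq_wrec by (simp add: wrec_add wrec_cmult)
qed

lemma full_jet_add:
  "full_jet S a z (\<lambda>m n. V m n + W m n) (\<lambda>m n. F m n + F' m n)
    = (\<lambda>p q. full_jet S a z V F p q + full_jet S a z W F' p q)"
  using full_jet_linear[of S a z 1 V 1 W F F'] by (intro ext) simp

lemma full_jet_cong: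
  assumes "\<And>m n. (m, n) \<in> Lam1 5 \<Longrightarrow> U m n = U' m n" "\<And>m n. (m, n) \<in> Lam 3 \<Longrightarrow> F m n = F' m n" "p + q \<le> 5"
  shows "full_jet S a z U F p q = full_jet S a z U' F' p q"
  unfolding full_jet_extend[OF assms(3), simplified]
  by (intro arg_cong2[where f = "(+)"] sum.cong refl) (use assms in auto)

lemma taylor_poly_linear:
  "taylor_poly K (\<lambda>m n. x * c m n + y * c' m n) d = x * taylor_poly K c d + y * taylor_poly K c' d"
  by (simp add: taylor_poly_def sum_distrib_left sum.distrib[symmetric] case_prod_unfold algebra_simps add_divide_distrib)

lemma taylor_poly_cong:
  "(\<And>m n. m + n \<le> K \<Longrightarrow> c m n = c' m n) \<Longrightarrow> taylor_poly K c d = taylor_poly K c' d"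
  unfolding taylor_poly_def by (rule sum.cong) (auto simp: Lam_def)

text \<open>Constrains only the entries with \<open>m < 2\<close>: these are the data, the others
  are produced by the recursion.\<close>

definition vanish :: "nat \<Rightarrow> (nat \<Rightarrow> nat \<Rightarrow> real) \<Rightarrow> bool" where
  "vanish N V \<longleftrightarrow> (\<forall>m n. m < 2 \<and> m + n < N \<longrightarrow> V m n = 0)"

lemma full_jet_vanish: "vanish N V \<Longrightarrow> m + n < N \<Longrightarrow> full_jet S a z V (\<lambda>_ _. 0) m n = 0"
  unfolding full_jet_eq_wrec by (rule wrec_eq_0[of "m + n"]) (auto simp: vanish_def source_op_def)

text \<open>To leading order the equation says that \<open>u\<close> is harmonic, so that its leading homogeneous
  part is the real part of a multiple of \<open>(y + \<i>x)\<^sup>N\<close>.\<close>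

definition lead_coeff_of :: "nat \<Rightarrow> (nat \<Rightarrow> nat \<Rightarrow> real) \<Rightarrow> complex" where
  "lead_coeff_of N V = Complex (V 0 N) (if N = 0 then 0 else - V 1 (N - 1))"

text \<open>With zero source and vanishing lower orders the recursion collapses to
  \<open>w m n = - w (m - 2) (n + 2)\<close>, the Laplace equation for jets, and the sign is that of
  \<open>\<i> ^ 2\<close>.\<close>

lemma full_jet_leading:
  assumes "vanish N V"
  shows "m + n = N \<Longrightarrow> full_jet S a z V (\<lambda>_ _. 0) m n = Re (\<i> ^ m * lead_coeff_of N V)"
proof (induction m arbitrary: n rule: less_induct)
  case (less m)
  let ?w = "full_jet S a z V (\<lambda>_ _. 0)"
  let ?\<alpha> = "side_deriv S (\<lambda>x. Dx a x / a x) z" and ?\<beta> = "side_deriv S (\<lambda>x. Dy a x / a x) z"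
  consider "m = 0" | "m = 1" | "m \<ge> 2" by linarith
  then show ?case
  proof cases
    case 3
    have "?w m n = - rec_op ?\<alpha> ?\<beta> ?w m n"
      using 3 by (simp add: full_jet_eq_wrec[abs_def] wrec_ge_2 source_op_def)
    also have "rec_op ?\<alpha> ?\<beta> ?w m n = ?w (m - 2) (n + 2)"
      unfolding rec_op_def using 3 less.prems
      by (simp, intro sum.neutral ballI) (auto simp: full_jet_vanish[OF assms])
    also have "\<dots> = Re (\<i> ^ (m - 2) * lead_coeff_of N V)" using 3 less.prems by (intro less.IH) auto
    also have "\<i> ^ m = \<i> ^ (m - 2) * \<i> ^ 2" by (metis 3 le_add_diff_inverse2 power_add)
    then have "- Re (\<i> ^ (m - 2) * lead_coeff_of N V) = Re (\<i> ^ m * lead_coeff_of N V)" by simp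
    finally show ?thesis .
  qed (use less.prems in \<open>auto simp: full_jet_eq_wrec wrec_less_2 lead_coeff_of_def\<close>)
qed

locale transmission =
  fixes Op Om :: "(real \<times> real) set" and a :: "real \<times> real \<Rightarrow> real"
    and r s :: "real \<Rightarrow> real" and t0 :: real and J :: "real set"
  assumes J: "open J" "t0 \<in> J" and Cr: "Ck_on 5 J r" and Cs: "Ck_on 5 J s"
    and regular: "deriv r t0 \<noteq> 0 \<or> deriv s t0 \<noteq> 0"
    and am_nonzero: "side_deriv Om a (r t0, s t0) 0 0 \<noteq> 0"
begin

abbreviation P :: "real \<times> real" where "P \<equiv> (r t0, s t0)"

definition d :: "real \<Rightarrow> real \<times> real" where "d t = (r t - r t0, s t - s t0)"

text \<open>The gradient of \<open>u\<close> times \<open>a\<close>, paired with the normal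
  \<open>(deriv s t, - deriv r t)\<close>, everything replaced by Taylor polynomials: the share of
  one side in the second relation of \<open>transmission_system\<close>.\<close>

definition flux :: "(real \<times> real) set \<Rightarrow> (nat \<Rightarrow> nat \<Rightarrow> real) \<Rightarrow> real \<Rightarrow> real" where
  "flux S c t = taylor_poly 4 (side_deriv S a P) (d t) *
     (taylor_poly 4 (\<lambda>m n. c (m + 1) n) (d t) * deriv s t - taylor_poly 4 (\<lambda>m n. c m (n + 1)) (d t) * deriv r t)"

definition E1 :: "nat \<Rightarrow> (nat \<Rightarrow> nat \<Rightarrow> real) \<Rightarrow> real" where
  "E1 p c = (deriv ^^ p) (\<lambda>t. taylor_poly 5 c (d t)) t0 / fact p"

definition E2 :: "(real \<times> real) set \<Rightarrow> nat \<Rightarrow> (nat \<Rightarrow> nat \<Rightarrow> real) \<Rightarrow> real" where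
  "E2 S p c = (deriv ^^ p) (flux S c) t0 / fact p"

lemma Ck_taylor: "Ck_on 5 J (\<lambda>t. taylor_poly K c (d t))"
  unfolding taylor_poly_def d_def case_prod_unfold fst_conv snd_conv
  by (intro Ck_on_sum Ck_on_mult Ck_on_const Ck_on_power Ck_on_diff Cr Cs J)

lemma Ck_deriv_r: "Ck_on 4 J (deriv r)" and Ck_deriv_s: "Ck_on 4 J (deriv s)"
  using Cr Cs by (simp_all add: eval_nat_numeral)

lemma Ck_flux: "Ck_on 4 J (flux S c)"
  unfolding flux_def
  by (intro Ck_on_mult Ck_on_diff Ck_deriv_r Ck_deriv_s J Ck_on_le[OF Ck_taylor]) simp_all

lemma E1_linear:
  assumes "p \<le> 5" shows "E1 p (\<lambda>m n. x * c m n + y * c' m n) = x * E1 p c + y * E1 p c'"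
  unfolding E1_def taylor_poly_linear
  by (subst higher_deriv_linear[OF J(1) _ _ J(2)]) (use Ck_on_le[OF Ck_taylor assms] in \<open>auto simp: add_divide_distrib\<close>)

lemma E2_linear:
  assumes "p \<le> 4" shows "E2 S p (\<lambda>m n. x * c m n + y * c' m n) = x * E2 S p c + y * E2 S p c'"
proof -
  have "flux S (\<lambda>m n. x * c m n + y * c' m n) = (\<lambda>t. x * flux S c t + y * flux S c' t)"
    by (intro ext) (simp add: flux_def taylor_poly_linear algebra_simps)
  then show ?thesis unfolding E2_def
    by (simp, subst higher_deriv_linear[OF J(1) _ _ J(2)])
       (use Ck_on_le[OF Ck_flux assms] in \<open>auto simp: add_divide_distrib\<close>)
qed

lemma E1_cong: "(\<And>m n. m + n \<le> 5 \<Longrightarrow> c m n = c' m n) \<Longrightarrow> E1 p c = E1 p c'"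
  unfolding E1_def by (simp cong: taylor_poly_cong)

lemma E2_cong:
  assumes "\<And>m n. m + n \<le> 5 \<Longrightarrow> c m n = c' m n" shows "E2 S p c = E2 S p c'"
proof -
  have "taylor_poly 4 (\<lambda>m n. c (m + 1) n) = taylor_poly 4 (\<lambda>m n. c' (m + 1) n)"
    "taylor_poly 4 (\<lambda>m n. c m (n + 1)) = taylor_poly 4 (\<lambda>m n. c' m (n + 1))"
    by (intro ext taylor_poly_cong assms; simp)+
  then show ?thesis unfolding E2_def flux_def by simp
qed

text \<open>Separates the two sides by linearity of the derivative at \<open>t0\<close>, so that the
  unknown enters through a linear functional of its reduced jet.\<close>

lemma transmission_system_iff:
  "transmission_system Op Om a r s t0 U Fp Fm g gG V \<longleftrightarrow>
    (\<forall>p\<le>5. E1 p (full_jet Op a P U Fp) - E1 p (full_jet Om a P V Fm) = g p) \<and>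
    (\<forall>p\<le>4. E2 Op p (full_jet Op a P U Fp) - E2 Om p (full_jet Om a P V Fm) = gG p)"
proof -
  let ?up = "full_jet Op a P U Fp" and ?um = "full_jet Om a P V Fm"
  have 1: "(deriv ^^ p) (\<lambda>t. taylor_poly 5 ?up (d t) - taylor_poly 5 ?um (d t)) t0 / fact p
      = E1 p ?up - E1 p ?um" if "p \<le> 5" for p
    using higher_deriv_linear[OF J(1) Ck_on_le[OF Ck_taylor that] Ck_on_le[OF Ck_taylor that] J(2), of 1 5 ?up "-1" 5 ?um]
    by (simp add: E1_def diff_divide_distrib)
  have 2: "(deriv ^^ p) (\<lambda>t. (taylor_poly 4 (side_deriv Op a P) (d t) * taylor_poly 4 (\<lambda>m n. ?up (m + 1) n) (d t)
        - taylor_poly 4 (side_deriv Om a P) (d t) * taylor_poly 4 (\<lambda>m n. ?um (m + 1) n) (d t)) * deriv s t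
      + (taylor_poly 4 (side_deriv Op a P) (d t) * taylor_poly 4 (\<lambda>m n. ?up m (n + 1)) (d t)
        - taylor_poly 4 (side_deriv Om a P) (d t) * taylor_poly 4 (\<lambda>m n. ?um m (n + 1)) (d t)) * (- deriv r t)) t0 / fact p
      = E2 Op p ?up - E2 Om p ?um" if "p \<le> 4" for p
  proof -
    have "(\<lambda>t. (taylor_poly 4 (side_deriv Op a P) (d t) * taylor_poly 4 (\<lambda>m n. ?up (m + 1) n) (d t)
        - taylor_poly 4 (side_deriv Om a P) (d t) * taylor_poly 4 (\<lambda>m n. ?um (m + 1) n) (d t)) * deriv s t
      + (taylor_poly 4 (side_deriv Op a P) (d t) * taylor_poly 4 (\<lambda>m n. ?up m (n + 1)) (d t)
        - taylor_poly 4 (side_deriv Om a P) (d t) * taylor_poly 4 (\<lambda>m n. ?um m (n + 1)) (d t)) * (- deriv r t))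
      = (\<lambda>t. 1 * flux Op ?up t + (-1) * flux Om ?um t)"
      by (intro ext) (simp add: flux_def algebra_simps)
    then show ?thesis
      using higher_deriv_linear[OF J(1) Ck_on_le[OF Ck_flux that] Ck_on_le[OF Ck_flux that] J(2), of 1 Op ?up "-1" Om ?um]
      by (simp add: E2_def diff_divide_distrib)
  qed
  show ?thesis unfolding transmission_system_def Let_def d_def[symmetric] using 1 2 by auto
qed

text \<open>The homogeneous part of degree \<open>N\<close> of the Taylor polynomial, evaluated at
  the tangent vector of the curve.\<close>

definition hom :: "nat \<Rightarrow> (nat \<Rightarrow> nat \<Rightarrow> real) \<Rightarrow> real" where
  "hom N c = (\<Sum>m\<le>N. c m (N - m) / (fact m * fact (N - m)) * deriv r t0 ^ m * deriv s t0 ^ (N - m))"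

section \<open>Leading order of the jump functionals along the curve\<close>

lemma tendsto_difference_quotient:
  assumes "Ck_on (Suc n) J f" shows "((\<lambda>t. (f t - f t0) / (t - t0)) \<longlongrightarrow> deriv f t0) (at t0)"
  using Ck_on_DERIV[OF assms J(2)] by (simp add: has_field_derivative_iff)

text \<open>To first order the curve is its tangent, so a monomial of degree \<open>m + n\<close>
  contributes at the power \<open>m + n\<close> of \<open>t - t0\<close>: lower degrees vanish by
  assumption, higher ones in the limit.\<close>

lemma taylor_poly_leading:
  assumes "\<And>m n. m + n < N \<Longrightarrow> c m n = 0" "N \<le> K"
  shows "((\<lambda>t. taylor_poly K c (d t) / (t - t0) ^ N) \<longlongrightarrow> hom N c) (at t0)"
proof -
  have rt: "((\<lambda>t. (r t - r t0) / (t - t0)) \<longlongrightarrow> deriv r t0) (at t0)"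
    and st: "((\<lambda>t. (s t - s t0) / (t - t0)) \<longlongrightarrow> deriv s t0) (at t0)"
    using Cr Cs by (auto intro!: tendsto_difference_quotient[of 4] simp: eval_nat_numeral)
  let ?l = "\<lambda>m n. if m + n = N then c m n / (fact m * fact n) * deriv r t0 ^ m * deriv s t0 ^ n else 0"
  have tm: "((\<lambda>t. c m n / (fact m * fact n) * (r t - r t0) ^ m * (s t - s t0) ^ n / (t - t0) ^ N) \<longlongrightarrow> ?l m n) (at t0)" for m n
  proof (cases "m + n < N")
    case True
    then show ?thesis using assms(1) by simp
  next
    case False
    have "((\<lambda>t. c m n / (fact m * fact n) * ((r t - r t0) / (t - t0)) ^ m * ((s t - s t0) / (t - t0)) ^ n * (t - t0) ^ (m + n - N))
        \<longlongrightarrow> c m n / (fact m * fact n) * deriv r t0 ^ m * deriv s t0 ^ n * (t0 - t0) ^ (m + n - N)) (at t0)"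
      by (intro tendsto_intros rt st)
    also have "c m n / (fact m * fact n) * deriv r t0 ^ m * deriv s t0 ^ n * (t0 - t0) ^ (m + n - N) = ?l m n"
      using False by (auto simp: power_0_left)
    finally show ?thesis
    proof (rule Lim_transform_eventually)
      have "c m n / (fact m * fact n) * ((r t - r t0) / (t - t0)) ^ m * ((s t - s t0) / (t - t0)) ^ n * (t - t0) ^ (m + n - N)
          = c m n / (fact m * fact n) * (r t - r t0) ^ m * (s t - s t0) ^ n / (t - t0) ^ N" if "t \<noteq> t0" for t
      proof -
        have "(t - t0) ^ m * (t - t0) ^ n = (t - t0) ^ N * (t - t0) ^ (m + n - N)"
          using False by (simp flip: power_add)
        then have "(t - t0) ^ (m + n - N) / ((t - t0) ^ m * (t - t0) ^ n) = 1 / (t - t0) ^ N"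
          using that by (simp add: divide_simps)
        moreover have "c m n / (fact m * fact n) * ((r t - r t0) / (t - t0)) ^ m * ((s t - s t0) / (t - t0)) ^ n * (t - t0) ^ (m + n - N)
          = c m n / (fact m * fact n) * (r t - r t0) ^ m * (s t - s t0) ^ n * ((t - t0) ^ (m + n - N) / ((t - t0) ^ m * (t - t0) ^ n))"
          by (simp add: power_divide)
        ultimately show ?thesis by simp
      qed
      then show "\<forall>\<^sub>F t in at t0. c m n / (fact m * fact n) * ((r t - r t0) / (t - t0)) ^ m * ((s t - s t0) / (t - t0)) ^ n * (t - t0) ^ (m + n - N)
          = c m n / (fact m * fact n) * (r t - r t0) ^ m * (s t - s t0) ^ n / (t - t0) ^ N"
        by (simp add: eventually_at_filter)
    qed
  qed
  have "((\<lambda>t. \<Sum>k\<in>Lam K. c (fst k) (snd k) / (fact (fst k) * fact (snd k)) * (r t - r t0) ^ fst k * (s t - s t0) ^ snd k / (t - t0) ^ N)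
      \<longlongrightarrow> (\<Sum>k\<in>Lam K. ?l (fst k) (snd k))) (at t0)"
    by (intro tendsto_sum tm)
  also have "(\<Sum>k\<in>Lam K. ?l (fst k) (snd k)) = (\<Sum>k\<in>(\<lambda>m. (m, N - m)) ` {..N}. ?l (fst k) (snd k))"
    by (rule sum.mono_neutral_right[OF finite_Lam]) (use assms(2) in \<open>auto simp: Lam_def image_iff\<close>)
  also have "\<dots> = hom N c"
    unfolding hom_def by (subst sum.reindex) (auto simp: inj_on_def intro!: sum.cong)
  finally show ?thesis by (simp add: taylor_poly_def d_def case_prod_unfold sum_divide_distrib)
qed

lemma E1_leading:
  assumes "\<And>m n. m + n < N \<Longrightarrow> c m n = 0" "N \<le> 5"
  shows "\<And>q. q < N \<Longrightarrow> E1 q c = 0" "E1 N c = hom N c"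
proof -
  have "((\<lambda>t. taylor_poly 5 c (d t) / (t - t0) ^ N) \<longlongrightarrow> hom N c) (at t0)"
    by (rule taylor_poly_leading) (use assms in auto)
  note * = tendsto_imp_derivs[OF J Ck_on_le[OF Ck_taylor assms(2)] this]
  show "E1 q c = 0" if "q < N" for q using *(1)[OF that] by (simp add: E1_def)
  show "E1 N c = hom N c" using *(2) by (simp add: E1_def)
qed

text \<open>The gradient costs one order: a jet that starts in degree \<open>N + 1\<close> has a
  flux that starts at order \<open>N\<close>, and there \<open>a\<close> enters only through its
  value at \<open>P\<close>.\<close>

lemma E2_leading:
  assumes "\<And>m n. m + n < Suc N \<Longrightarrow> c m n = 0" "N \<le> 4"
  shows "\<And>q. q < N \<Longrightarrow> E2 S q c = 0"
    "E2 S N c = side_deriv S a P 0 0 * (hom N (\<lambda>m n. c (m + 1) n) * deriv s t0 - hom N (\<lambda>m n. c m (n + 1)) * deriv r t0)"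
proof -
  have cont: "(f \<longlongrightarrow> f t0) (at t0)" if "Ck_on 4 J f" for f
    using Ck_on_continuous[OF that] J by (auto simp: continuous_on_eq_continuous_at isCont_def)
  have "((\<lambda>t. taylor_poly 4 (side_deriv S a P) (d t) / (t - t0) ^ 0) \<longlongrightarrow> hom 0 (side_deriv S a P)) (at t0)"
    by (rule taylor_poly_leading) auto
  then have a: "((\<lambda>t. taylor_poly 4 (side_deriv S a P) (d t)) \<longlongrightarrow> side_deriv S a P 0 0) (at t0)"
    by (simp add: hom_def)
  have "((\<lambda>t. taylor_poly 4 (side_deriv S a P) (d t) *
     (taylor_poly 4 (\<lambda>m n. c (m + 1) n) (d t) / (t - t0) ^ N * deriv s t
      - taylor_poly 4 (\<lambda>m n. c m (n + 1)) (d t) / (t - t0) ^ N * deriv r t)) \<longlongrightarrow>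
     side_deriv S a P 0 0 * (hom N (\<lambda>m n. c (m + 1) n) * deriv s t0 - hom N (\<lambda>m n. c m (n + 1)) * deriv r t0)) (at t0)"
    by (intro tendsto_intros a cont Ck_deriv_r Ck_deriv_s taylor_poly_leading assms) auto
  then have "((\<lambda>t. flux S c t / (t - t0) ^ N) \<longlongrightarrow>
     side_deriv S a P 0 0 * (hom N (\<lambda>m n. c (m + 1) n) * deriv s t0 - hom N (\<lambda>m n. c m (n + 1)) * deriv r t0)) (at t0)"
    by (simp add: flux_def diff_divide_distrib right_diff_distrib)
  note * = tendsto_imp_derivs[OF J Ck_on_le[OF Ck_flux assms(2)] this]
  show "E2 S q c = 0" if "q < N" for q using *(1)[OF that] by (simp add: E2_def)
  show "E2 S N c = side_deriv S a P 0 0 * (hom N (\<lambda>m n. c (m + 1) n) * deriv s t0 - hom N (\<lambda>m n. c m (n + 1)) * deriv r t0)"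
    using *(2) by (simp add: E2_def)
qed

definition \<omega> :: complex where "\<omega> = Complex (deriv s t0) (deriv r t0)"

lemma omega_nonzero: "\<omega> \<noteq> 0"
  using regular by (auto simp: \<omega>_def complex_eq_iff)

text \<open>Binomial theorem for the \<open>N\<close>-th power of
  \<open>\<i> * deriv r t0 + deriv s t0\<close>; the factorials in the Taylor coefficients supply
  the binomial coefficients.\<close>

lemma hom_Re:
  assumes "\<And>m n. m + n = N \<Longrightarrow> c m n = Re (\<i> ^ m * Z)"
  shows "hom N c = Re (\<omega> ^ N * Z) / fact N"
proof -
  have "\<omega> = \<i> * of_real (deriv r t0) + of_real (deriv s t0)"
    by (simp add: \<omega>_def complex_eq_iff)
  then have "\<omega> ^ N * Z = (\<Sum>m\<le>N. of_real (real (N choose m) * deriv r t0 ^ m * deriv s t0 ^ (N - m)) * (\<i> ^ m * Z))"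
    by (simp add: binomial_ring sum_distrib_left power_mult_distrib mult_ac)
  then have "Re (\<omega> ^ N * Z) = (\<Sum>m\<le>N. real (N choose m) * deriv r t0 ^ m * deriv s t0 ^ (N - m) * Re (\<i> ^ m * Z))"
    by simp
  also have "\<dots> / fact N = hom N c"
    unfolding hom_def sum_divide_distrib
    by (rule sum.cong) (auto simp: assms binomial_fact field_simps)
  finally show ?thesis by simp
qed

abbreviation L1 :: "nat \<Rightarrow> (nat \<Rightarrow> nat \<Rightarrow> real) \<Rightarrow> real" where
  "L1 p V \<equiv> E1 p (full_jet Om a P V (\<lambda>_ _. 0))"

abbreviation L2 :: "nat \<Rightarrow> (nat \<Rightarrow> nat \<Rightarrow> real) \<Rightarrow> real" where
  "L2 p V \<equiv> E2 Om p (full_jet Om a P V (\<lambda>_ _. 0))"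

lemma L1_leading:
  assumes "vanish N V" "N \<le> 5"
  shows "\<And>q. q < N \<Longrightarrow> L1 q V = 0" "L1 N V = Re (\<omega> ^ N * lead_coeff_of N V) / fact N"
proof -
  have z: "full_jet Om a P V (\<lambda>_ _. 0) m n = 0" if "m + n < N" for m n
    by (rule full_jet_vanish[OF assms(1) that])
  show "L1 q V = 0" if "q < N" for q
    by (rule E1_leading(1)[OF _ assms(2) that]) (rule z)
  have "L1 N V = hom N (full_jet Om a P V (\<lambda>_ _. 0))"
    by (rule E1_leading(2)[OF _ assms(2)]) (rule z)
  also have "\<dots> = Re (\<omega> ^ N * lead_coeff_of N V) / fact N"
    by (rule hom_Re) (rule full_jet_leading[OF assms(1)])
  finally show "L1 N V = Re (\<omega> ^ N * lead_coeff_of N V) / fact N" .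
qed

text \<open>The flux sees the imaginary part of the same complex number whose real part
  \<open>L1_leading\<close> finds at order \<open>N + 1\<close>. Together they determine it, which
  makes the diagonal block invertible.\<close>

lemma L2_leading:
  assumes "vanish (Suc N) V" "N \<le> 4"
  shows "\<And>q. q < N \<Longrightarrow> L2 q V = 0"
    "L2 N V = - side_deriv Om a P 0 0 * Im (\<omega> ^ Suc N * lead_coeff_of (Suc N) V) / fact N"
proof -
  let ?c = "full_jet Om a P V (\<lambda>_ _. 0)" and ?Z = "lead_coeff_of (Suc N) V"
  have z: "?c m n = 0" if "m + n < Suc N" for m n by (rule full_jet_vanish[OF assms(1) that])
  show "L2 q V = 0" if "q < N" for q
    by (rule E2_leading(1)[OF _ assms(2) that]) (rule z)
  have x: "hom N (\<lambda>m n. ?c (m + 1) n) = Re (\<omega> ^ N * (\<i> * ?Z)) / fact N"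
  proof (rule hom_Re)
    fix m n assume "m + n = N"
    then show "?c (m + 1) n = Re (\<i> ^ m * (\<i> * ?Z))"
      using full_jet_leading[OF assms(1), of "m + 1" n] by (simp add: mult_ac)
  qed
  have y: "hom N (\<lambda>m n. ?c m (n + 1)) = Re (\<omega> ^ N * ?Z) / fact N"
    by (rule hom_Re) (use full_jet_leading[OF assms(1)] in simp)
  have "L2 N V = side_deriv Om a P 0 0 * (hom N (\<lambda>m n. ?c (m + 1) n) * deriv s t0 - hom N (\<lambda>m n. ?c m (n + 1)) * deriv r t0)"
    by (rule E2_leading(2)[OF _ assms(2)]) (rule z)
  also have "\<dots> = side_deriv Om a P 0 0 * (Re (\<omega> ^ N * (\<i> * ?Z)) * Re \<omega> - Re (\<omega> ^ N * ?Z) * Im \<omega>) / fact N"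
  proof -
    have "c * (x / F * A - y / F * B) = c * (x * A - y * B) / F" for c x y A B F :: real
      by (simp add: diff_divide_distrib right_diff_distrib)
    then show ?thesis unfolding x y by (simp add: \<omega>_def)
  qed
  \<comment> \<open>Multiplication by \<open>\<i>\<close> turns the first real part into a negative
    imaginary part; what remains is the imaginary part of a product with
    \<open>\<omega>\<close>.\<close>
  also have "Re (\<omega> ^ N * (\<i> * ?Z)) * Re \<omega> - Re (\<omega> ^ N * ?Z) * Im \<omega> = - Im (\<omega> ^ Suc N * ?Z)"
    by (simp add: algebra_simps)
  finally show "L2 N V = - side_deriv Om a P 0 0 * Im (\<omega> ^ Suc N * ?Z) / fact N"
    by (simp only: mult_minus_left mult_minus_right)
qed

text \<open>Forward substitution through the triangular system: once the orders up to
  \<open>N\<close> vanish, the next two equations are the real and imaginary part of a nonzero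
  multiple of the next leading coefficient.\<close>

lemma homogeneous_vanish:
  "N \<le> 5 \<Longrightarrow> (\<And>p. p \<le> N \<Longrightarrow> L1 p V = 0) \<Longrightarrow> (\<And>p. p < N \<Longrightarrow> L2 p V = 0) \<Longrightarrow> vanish (Suc N) V"
proof (induction N)
  case 0
  have "vanish 0 V" by (simp add: vanish_def)
  then have "V 0 0 = 0" using L1_leading(2)[of 0 V] 0 by (simp add: lead_coeff_of_def)
  then show ?case by (simp add: vanish_def)
next
  case (Suc N)
  have v: "vanish (Suc N) V" using Suc by simp
  have "Re (\<omega> ^ Suc N * lead_coeff_of (Suc N) V) = 0"
    using L1_leading(2)[OF v] Suc.prems by simp
  moreover have "Im (\<omega> ^ Suc N * lead_coeff_of (Suc N) V) = 0"
    using L2_leading(2)[OF v] Suc.prems am_nonzero by simp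
  ultimately have "\<omega> ^ Suc N * lead_coeff_of (Suc N) V = 0" by (simp only: complex_eq_iff) simp
  then have "lead_coeff_of (Suc N) V = 0" using omega_nonzero by simp
  then have z: "V 0 (Suc N) = 0" "V (Suc 0) N = 0" by (auto simp: lead_coeff_of_def complex_eq_iff)
  show ?case unfolding vanish_def
  proof (intro allI impI)
    fix m n assume mn: "m < 2 \<and> m + n < Suc (Suc N)"
    show "V m n = 0"
    proof (cases "m + n < Suc N")
      case True
      then show ?thesis using v mn by (simp add: vanish_def)
    next
      case False
      then have "(m = 0 \<and> n = Suc N) \<or> (m = Suc 0 \<and> n = N)" using mn by linarith
      then show ?thesis using z by auto
    qed
  qed
qed

lemma E1_add: "p \<le> 5 \<Longrightarrow> E1 p (\<lambda>m n. c m n + c' m n) = E1 p c + E1 p c'"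
  using E1_linear[of p 1 c 1 c'] by simp

lemma E2_add: "p \<le> 4 \<Longrightarrow> E2 S p (\<lambda>m n. c m n + c' m n) = E2 S p c + E2 S p c'"
  using E2_linear[of p S 1 c 1 c'] by simp

lemma L1_add: "p \<le> 5 \<Longrightarrow> L1 p (\<lambda>m n. V m n + W m n) = L1 p V + L1 p W"
  using full_jet_add[of Om a P V W "\<lambda>_ _. 0" "\<lambda>_ _. 0"] by (simp add: E1_add)

lemma L2_add: "p \<le> 4 \<Longrightarrow> L2 p (\<lambda>m n. V m n + W m n) = L2 p V + L2 p W"
  using full_jet_add[of Om a P V W "\<lambda>_ _. 0" "\<lambda>_ _. 0"] by (simp add: E2_add)

text \<open>A correction concentrated in order \<open>N + 1\<close> leaves the equations already
  solved untouched, since its functionals of lower order vanish, and its leading coefficient can be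
  chosen to satisfy the two new ones.\<close>

lemma inhomogeneous_solvable:
  "N \<le> 5 \<Longrightarrow> \<exists>V. (\<forall>m n. (m, n) \<notin> Lam1 N \<longrightarrow> V m n = 0) \<and> (\<forall>p\<le>N. L1 p V = b1 p) \<and> (\<forall>p<N. L2 p V = b2 p)"
proof (induction N)
  case 0
  define V where "V m n = (if (m, n) = (0, 0) then b1 0 else 0)" for m n :: nat
  have "V 0 0 = b1 0" by (simp add: V_def)
  then have "L1 0 V = b1 0" using L1_leading(2)[of 0 V] by (simp add: vanish_def lead_coeff_of_def)
  moreover have "V m n = 0" if "(m, n) \<notin> Lam1 0" for m n
    using that by (auto simp: V_def Lam1_def Lam_def)
  ultimately show ?case by auto
next
  case (Suc N)
  then obtain V where V: "\<And>m n. (m, n) \<notin> Lam1 N \<Longrightarrow> V m n = 0" "\<And>p. p \<le> N \<Longrightarrow> L1 p V = b1 p"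
    "\<And>p. p < N \<Longrightarrow> L2 p V = b2 p" by auto
  define e1 where "e1 = b1 (Suc N) - L1 (Suc N) V"
  define e2 where "e2 = b2 N - L2 N V"
  \<comment> \<open>The formulas in \<open>L1_leading\<close> and \<open>L2_leading\<close> solved
    for the leading coefficient, with the residuals \<open>e1\<close> and \<open>e2\<close>
    prescribed; \<open>X\<close> is the jet that has this coefficient.\<close>
  define Z where "Z = Complex (e1 * fact (Suc N)) (- e2 * fact N / side_deriv Om a P 0 0) / \<omega> ^ Suc N"
  define X where "X m n = (if (m, n) = (0, Suc N) then Re Z else if (m, n) = (1, N) then - Im Z else 0)" for m n :: nat
  have v: "vanish (Suc N) X" by (auto simp: vanish_def X_def)
  have lc: "lead_coeff_of (Suc N) X = Z" by (simp add: lead_coeff_of_def X_def complex_eq_iff)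
  have oZ: "\<omega> ^ Suc N * Z = Complex (e1 * fact (Suc N)) (- e2 * fact N / side_deriv Om a P 0 0)"
    unfolding Z_def using omega_nonzero by (simp del: power_Suc)
  have X1: "L1 p X = (if p = Suc N then e1 else 0)" if "p \<le> Suc N" for p
    using L1_leading[OF v] that Suc.prems unfolding lc oZ by (auto simp del: fact_Suc)
  have X2: "L2 p X = (if p = N then e2 else 0)" if "p < Suc N" for p
    using L2_leading[OF v] that Suc.prems am_nonzero unfolding lc oZ by auto
  show ?case
  proof (intro exI[of _ "\<lambda>m n. V m n + X m n"] conjI allI impI)
    show "V m n + X m n = 0" if "(m, n) \<notin> Lam1 (Suc N)" for m n
      using that V(1)[of m n] by (auto simp: X_def Lam1_def Lam_def)
    show "L1 p (\<lambda>m n. V m n + X m n) = b1 p" if "p \<le> Suc N" for p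
      using that Suc.prems V(2)[of p] X1[OF that] by (auto simp: L1_add e1_def)
    show "L2 p (\<lambda>m n. V m n + X m n) = b2 p" if "p < Suc N" for p
      using that Suc.prems V(3)[of p] X2[OF that] by (auto simp: L2_add e2_def less_Suc_eq)
  qed
qed

section \<open>Linear dependence of the solution on the data\<close>

abbreviation TS where "TS \<equiv> transmission_system Op Om a r s t0"

abbreviation sol where "sol \<equiv> transmission_solution Op Om a r s t0"

lemma TS_linear:
  assumes "TS U Fp Fm g gG V" "TS U' Fp' Fm' g' gG' V'"
  shows "TS (\<lambda>m n. x * U m n + y * U' m n) (\<lambda>m n. x * Fp m n + y * Fp' m n) (\<lambda>m n. x * Fm m n + y * Fm' m n)
    (\<lambda>p. x * g p + y * g' p) (\<lambda>p. x * gG p + y * gG' p) (\<lambda>m n. x * V m n + y * V' m n)"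
proof -
  have l: "full_jet S a P (\<lambda>m n. x * U m n + y * U' m n) (\<lambda>m n. x * F m n + y * F' m n)
      = (\<lambda>p q. x * full_jet S a P U F p q + y * full_jet S a P U' F' p q)" for S U U' F F'
    by (intro ext) (rule full_jet_linear)
  have e: "x * A + y * B - (x * A' + y * B') = x * (A - A') + y * (B - B')" for A B A' B' :: real
    by (simp add: algebra_simps)
  show ?thesis using assms unfolding transmission_system_iff l by (simp add: E1_linear E2_linear e)
qed

lemma TS_cong:
  assumes "\<And>m n. (m, n) \<in> Lam1 5 \<Longrightarrow> U m n = U' m n" "\<And>m n. (m, n) \<in> Lam 3 \<Longrightarrow> Fp m n = Fp' m n"
    "\<And>m n. (m, n) \<in> Lam 3 \<Longrightarrow> Fm m n = Fm' m n" "\<And>p. p \<le> 5 \<Longrightarrow> g p = g' p" "\<And>p. p \<le> 4 \<Longrightarrow> gG p = gG' p"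
    "\<And>m n. (m, n) \<in> Lam1 5 \<Longrightarrow> V m n = V' m n" and "TS U Fp Fm g gG V"
  shows "TS U' Fp' Fm' g' gG' V'"
proof -
  have up: "full_jet Op a P U Fp m n = full_jet Op a P U' Fp' m n" if "m + n \<le> 5" for m n
    by (rule full_jet_cong) (use assms that in auto)
  have um: "full_jet Om a P V Fm m n = full_jet Om a P V' Fm' m n" if "m + n \<le> 5" for m n
    by (rule full_jet_cong) (use assms that in auto)
  show ?thesis using assms(4,5,7) unfolding transmission_system_iff
    by (simp add: E1_cong[OF up] E1_cong[OF um] E2_cong[OF up] E2_cong[OF um])
qed

text \<open>The functionals of the plus side vanish up to the order in question, so the minus side
  solves a homogeneous system. The case \<open>N = 5\<close> yields uniqueness, smaller
  \<open>N\<close> the triangular shape of \<open>Tu\<close>.\<close>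

lemma TS_unique_up_to:
  assumes "N \<le> 5" "vanish (Suc N) U" "TS U (\<lambda>_ _. 0) (\<lambda>_ _. 0) (\<lambda>_. 0) (\<lambda>_. 0) V"
  shows "vanish (Suc N) V"
proof (rule homogeneous_vanish[OF assms(1)])
  let ?up = "full_jet Op a P U (\<lambda>_ _. 0)"
  have up: "?up m n = 0" if "m + n < Suc N" for m n by (rule full_jet_vanish[OF assms(2) that])
  fix p
  show "L1 p V = 0" if "p \<le> N"
  proof -
    have "E1 p ?up = 0"
    \<comment> \<open>\<open>E1_leading\<close> reaches only up to order five, so for
      \<open>N = 5\<close> it cannot be used with \<open>Suc N\<close>; but then every coefficient
      that \<open>E1\<close> reads is zero.\<close>
    proof (cases "N = 5")
      case True
      have "E1 p ?up = E1 p (\<lambda>_ _. 0)" by (rule E1_cong) (use up True in simp)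
      also have "\<dots> = 0" using E1_linear[of p 0 "\<lambda>_ _. 0" 0 "\<lambda>_ _. 0"] that assms(1) by simp
      finally show ?thesis .
    next
      case False
      then show ?thesis
        by (intro E1_leading(1)[of "Suc N"]) (use up that assms(1) in auto)
    qed
    then show ?thesis using assms(1,3) that unfolding transmission_system_iff by auto
  qed
  show "L2 p V = 0" if "p < N"
  proof -
    have "E2 Op p ?up = 0"
    proof (cases "N = 5")
      case True
      have "E2 Op p ?up = E2 Op p (\<lambda>_ _. 0)" by (rule E2_cong) (use up True in simp)
      also have "\<dots> = 0" using E2_linear[of p Op 0 "\<lambda>_ _. 0" 0 "\<lambda>_ _. 0"] that assms(1) by simp
      finally show ?thesis .
    next
      case False
      then show ?thesis
        by (intro E2_leading(1)[of N]) (use up that assms(1) in auto)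
    qed
    then show ?thesis using assms(1,3) that unfolding transmission_system_iff by auto
  qed
qed

lemma TS_unique:
  assumes "TS U Fp Fm g gG V" "TS U Fp Fm g gG V'"
    and "\<And>m n. (m, n) \<notin> Lam1 5 \<Longrightarrow> V m n = 0" "\<And>m n. (m, n) \<notin> Lam1 5 \<Longrightarrow> V' m n = 0"
  shows "V = V'"
proof -
  have "TS (\<lambda>_ _. 0) (\<lambda>_ _. 0) (\<lambda>_ _. 0) (\<lambda>_. 0) (\<lambda>_. 0) (\<lambda>m n. V m n - V' m n)"
    using TS_linear[OF assms(1,2), of 1 "-1"] by simp
  then have "vanish (Suc 5) (\<lambda>m n. V m n - V' m n)"
    by (rule TS_unique_up_to[rotated 2]) (auto simp: vanish_def)
  then have "V m n = V' m n" if "(m, n) \<in> Lam1 5" for m n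
    using that by (auto simp: vanish_def Lam1_def Lam_def)
  then show ?thesis using assms(3,4) by (intro ext) metis
qed

lemma TS_exists: "\<exists>V. (\<forall>m n. (m, n) \<notin> Lam1 5 \<longrightarrow> V m n = 0) \<and> TS U Fp Fm g gG V"
proof -
  let ?up = "full_jet Op a P U Fp" and ?f = "full_jet Om a P (\<lambda>_ _. 0) Fm"
  obtain V where V: "\<forall>m n. (m, n) \<notin> Lam1 5 \<longrightarrow> V m n = 0"
    "\<forall>p\<le>5. L1 p V = E1 p ?up - g p - E1 p ?f" "\<forall>p<5. L2 p V = E2 Op p ?up - gG p - E2 Om p ?f"
    using inhomogeneous_solvable[of 5 "\<lambda>p. E1 p ?up - g p - E1 p ?f" "\<lambda>p. E2 Op p ?up - gG p - E2 Om p ?f"] by auto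
  have um: "full_jet Om a P V Fm = (\<lambda>m n. full_jet Om a P V (\<lambda>_ _. 0) m n + ?f m n)"
    using full_jet_add[of Om a P V "\<lambda>_ _. 0" "\<lambda>_ _. 0" Fm] by simp
  have "TS U Fp Fm g gG V"
    unfolding transmission_system_iff um using V by (simp add: E1_add E2_add)
  then show ?thesis using V by blast
qed

text \<open>Existence and uniqueness, under the normalisation outside \<open>Lam1 5\<close>, give
  meaning to the description in \<open>transmission_solution\<close>.\<close>

lemma sol_properties:
  "(m, n) \<notin> Lam1 5 \<Longrightarrow> sol U Fp Fm g gG m n = 0" "TS U Fp Fm g gG (sol U Fp Fm g gG)"
proof -
  let ?Q = "\<lambda>V. (\<forall>m n. (m, n) \<notin> Lam1 5 \<longrightarrow> V m n = 0) \<and> TS U Fp Fm g gG V"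
  obtain V where V: "?Q V" using TS_exists by blast
  have "?Q (THE V. ?Q V)"
    by (rule theI[of ?Q, OF V]) (use TS_unique V in blast)
  then show "(m, n) \<notin> Lam1 5 \<Longrightarrow> sol U Fp Fm g gG m n = 0" "TS U Fp Fm g gG (sol U Fp Fm g gG)"
    unfolding transmission_solution_def by blast+
qed

text \<open>The one-sided jet of the actual solution is not zero outside \<open>Lam1 5\<close>.
  Truncating it there does not affect the system, since the reduction up to order five reads only
  \<open>Lam1 5\<close>.\<close>

lemma sol_eqI:
  assumes "TS U Fp Fm g gG V" "(m, n) \<in> Lam1 5" shows "sol U Fp Fm g gG m n = V m n"
proof -
  define V' where "V' m n = (if (m, n) \<in> Lam1 5 then V m n else 0)" for m n
  have "TS U Fp Fm g gG V'" by (rule TS_cong[OF _ _ _ _ _ _ assms(1)]) (auto simp: V'_def)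
  then have "sol U Fp Fm g gG = V'" by (rule TS_unique[OF sol_properties(2)]) (auto simp: sol_properties(1) V'_def)
  then show ?thesis using assms(2) by (simp add: V'_def)
qed

text \<open>Unit data of order \<open>N + 1\<close> vanish up to order \<open>N\<close>, hence so
  does the solution. This explains the restriction of the sum in \<open>coeff_system\<close> to
  \<open>m' + n' \<ge> m + n\<close>.\<close>

lemma Tu_eq_0: "(m, n) \<in> Lam1 5 \<Longrightarrow> m' + n' < m + n \<Longrightarrow> Tu Op Om a r s t0 m' n' m n = 0"
proof -
  assume mn: "(m, n) \<in> Lam1 5" "m' + n' < m + n"
  obtain N where N: "m + n = Suc N" using mn(2) by (cases "m + n") auto
  have "vanish (Suc N) (sol (unit2 m n) (\<lambda>_ _. 0) (\<lambda>_ _. 0) (\<lambda>_. 0) (\<lambda>_. 0))"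
  proof (rule TS_unique_up_to[OF _ _ sol_properties(2)])
    show "N \<le> 5" using mn(1) N by (simp add: Lam1_def Lam_def)
    show "vanish (Suc N) (unit2 m n)" using N by (auto simp: vanish_def unit2_def)
  qed
  then have "m' < 2 \<Longrightarrow> ?thesis" using mn(2) N by (auto simp: vanish_def Tu_def)
  moreover have "\<not> m' < 2 \<Longrightarrow> ?thesis" unfolding Tu_def by (rule sol_properties(1)) (auto simp: Lam1_def)
  ultimately show ?thesis by blast
qed

lemma TS_zero: "TS (\<lambda>_ _. 0) (\<lambda>_ _. 0) (\<lambda>_ _. 0) (\<lambda>_. 0) (\<lambda>_. 0) (\<lambda>_ _. 0)"
  using TS_linear[OF sol_properties(2) sol_properties(2), where x = 0 and y = 0] by simp

lemma TS_add:
  assumes "TS U Fp Fm g gG V" "TS U' Fp' Fm' g' gG' V'"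
  shows "TS (\<lambda>m n. U m n + U' m n) (\<lambda>m n. Fp m n + Fp' m n) (\<lambda>m n. Fm m n + Fm' m n)
    (\<lambda>p. g p + g' p) (\<lambda>p. gG p + gG' p) (\<lambda>m n. V m n + V' m n)"
  using TS_linear[OF assms, of 1 1] by simp

lemma TS_sum:
  assumes "\<And>k. TS (U k) (Fp k) (Fm k) (g k) (gG k) (V k)"
  shows "TS (\<lambda>m n. \<Sum>k\<in>A. x k * U k m n) (\<lambda>m n. \<Sum>k\<in>A. x k * Fp k m n) (\<lambda>m n. \<Sum>k\<in>A. x k * Fm k m n)
    (\<lambda>p. \<Sum>k\<in>A. x k * g k p) (\<lambda>p. \<Sum>k\<in>A. x k * gG k p) (\<lambda>m n. \<Sum>k\<in>A. x k * V k m n)"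
proof (induction A rule: infinite_finite_induct)
  case (insert k A)
  then show ?case using TS_linear[OF assms[of k] insert.IH, of "x k" 1] by simp
qed (simp_all add: TS_zero)

text \<open>The superposition of the solutions for unit data solves the system with the given data
  on the relevant indices; uniqueness identifies it with \<open>V\<close>.\<close>

lemma transmission_representation:
  assumes "TS U Fp Fm g gG V" "(m', n') \<in> Lam1 5"
  shows "V m' n' = (\<Sum>(m, n)\<in>Lam1 5. U m n * Tu Op Om a r s t0 m' n' m n)
    + (\<Sum>(m, n)\<in>Lam 3. Fp m n * Tp Op Om a r s t0 m' n' m n)
    + (\<Sum>(m, n)\<in>Lam 3. Fm m n * Tm Op Om a r s t0 m' n' m n)
    + (\<Sum>p=0..5. g p * Tg Op Om a r s t0 m' n' p) + (\<Sum>p=0..4. gG p * TgG Op Om a r s t0 m' n' p)"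
proof -
  let ?z2 = "\<lambda>_ _. 0 :: real" and ?z1 = "\<lambda>_. 0 :: real"
  let ?u = "\<lambda>k. unit2 (fst k) (snd k)"
  have u2: "(\<Sum>k\<in>A. c (fst k) (snd k) * ?u k m n) = (if (m, n) \<in> A then c m n else 0)"
    if "finite A" for A m n and c :: "nat \<Rightarrow> nat \<Rightarrow> real"
  proof -
    have "(\<Sum>k\<in>A. c (fst k) (snd k) * ?u k m n) = (\<Sum>k\<in>A. if k = (m, n) then c m n else 0)"
      by (rule sum.cong) (auto simp: unit2_def)
    then show ?thesis using that by simp
  qed
  have u1: "(\<Sum>k=0..K. c k * unit1 k p) = (if p \<le> K then c p else 0)" for K p and c :: "nat \<Rightarrow> real"
  proof -
    have "(\<Sum>k=0..K. c k * unit1 k p) = (\<Sum>k=0..K. if k = p then c p else 0)"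
      by (rule sum.cong) (auto simp: unit1_def)
    then show ?thesis by simp
  qed
  note s1 = TS_sum[of ?u "\<lambda>_. ?z2" "\<lambda>_. ?z2" "\<lambda>_. ?z1" "\<lambda>_. ?z1" "\<lambda>k. sol (?u k) ?z2 ?z2 ?z1 ?z1"
      "\<lambda>k. U (fst k) (snd k)" "Lam1 5", OF sol_properties(2)]
  note s2 = TS_sum[of "\<lambda>_. ?z2" ?u "\<lambda>_. ?z2" "\<lambda>_. ?z1" "\<lambda>_. ?z1" "\<lambda>k. sol ?z2 (?u k) ?z2 ?z1 ?z1"
      "\<lambda>k. Fp (fst k) (snd k)" "Lam 3", OF sol_properties(2)]
  note s3 = TS_sum[of "\<lambda>_. ?z2" "\<lambda>_. ?z2" ?u "\<lambda>_. ?z1" "\<lambda>_. ?z1" "\<lambda>k. sol ?z2 ?z2 (?u k) ?z1 ?z1"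
      "\<lambda>k. Fm (fst k) (snd k)" "Lam 3", OF sol_properties(2)]
  note s4 = TS_sum[of "\<lambda>_. ?z2" "\<lambda>_. ?z2" "\<lambda>_. ?z2" unit1 "\<lambda>_. ?z1" "\<lambda>k. sol ?z2 ?z2 ?z2 (unit1 k) ?z1"
      g "{0..5}", OF sol_properties(2)]
  note s5 = TS_sum[of "\<lambda>_. ?z2" "\<lambda>_. ?z2" "\<lambda>_. ?z2" "\<lambda>_. ?z1" unit1 "\<lambda>k. sol ?z2 ?z2 ?z2 ?z1 (unit1 k)"
      gG "{0..4}", OF sol_properties(2)]
  note total = TS_add[OF TS_add[OF TS_add[OF TS_add[OF s1 s2] s3] s4] s5]
  define W where "W m' n' = (\<Sum>k\<in>Lam1 5. U (fst k) (snd k) * Tu Op Om a r s t0 m' n' (fst k) (snd k))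
    + (\<Sum>k\<in>Lam 3. Fp (fst k) (snd k) * Tp Op Om a r s t0 m' n' (fst k) (snd k))
    + (\<Sum>k\<in>Lam 3. Fm (fst k) (snd k) * Tm Op Om a r s t0 m' n' (fst k) (snd k))
    + (\<Sum>p=0..5. g p * Tg Op Om a r s t0 m' n' p) + (\<Sum>p=0..4. gG p * TgG Op Om a r s t0 m' n' p)" for m' n'
  have "TS U Fp Fm g gG W"
    unfolding W_def[abs_def] Tu_def Tp_def Tm_def Tg_def TgG_def
    by (rule TS_cong[OF _ _ _ _ _ _ total]) (simp_all add: u2 u1)
  then have "V m' n' = W m' n'" using sol_eqI[OF _ assms(2)] assms(1) by metis
  then show ?thesis by (simp add: W_def case_prod_unfold)
qed

end

section \<open>The jump relations of the exact solution\<close>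

text \<open>Small steps along the normal in both directions end in the two sides. This is what makes
  each point of the interface a boundary point of both.\<close>

lemma closure_of_normal:
  assumes "unit_normal_towards \<Gamma> Op Om z v" shows "z \<in> closure Op" "z \<in> closure Om"
proof -
  have v: "norm v = 1" and ev: "\<forall>\<^sub>F \<epsilon> in at_right 0. z + \<epsilon> *\<^sub>R v \<in> Op \<and> z - \<epsilon> *\<^sub>R v \<in> Om"
    using assms by (auto simp: unit_normal_towards_def)
  have near: "\<exists>\<epsilon>>0. \<epsilon> < e \<and> z + \<epsilon> *\<^sub>R v \<in> Op \<and> z - \<epsilon> *\<^sub>R v \<in> Om" if "e > 0" for e
  proof -
    have "\<forall>\<^sub>F \<epsilon> in at_right 0. \<epsilon> \<in> {0<..<e}" using that by (rule eventually_at_right_real)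
    with ev have "\<forall>\<^sub>F \<epsilon> in at_right 0. \<epsilon> > 0 \<and> \<epsilon> < e \<and> z + \<epsilon> *\<^sub>R v \<in> Op \<and> z - \<epsilon> *\<^sub>R v \<in> Om"
      by eventually_elim auto
    then show ?thesis using eventually_happens trivial_limit_at_right_real by blast
  qed
  show "z \<in> closure Op" unfolding closure_approachable
  proof (intro allI impI)
    fix e :: real assume "e > 0"
    then obtain \<epsilon> where "\<epsilon> > 0" "\<epsilon> < e" "z + \<epsilon> *\<^sub>R v \<in> Op" using near by blast
    then show "\<exists>y\<in>Op. dist y z < e" using v by (intro bexI[of _ "z + \<epsilon> *\<^sub>R v"]) (auto simp: dist_norm)
  qed
  show "z \<in> closure Om" unfolding closure_approachable
  proof (intro allI impI)
    fix e :: real assume "e > 0"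
    then obtain \<epsilon> where "\<epsilon> > 0" "\<epsilon> < e" "z - \<epsilon> *\<^sub>R v \<in> Om" using near by blast
    then show "\<exists>y\<in>Om. dist y z < e" using v by (intro bexI[of _ "z - \<epsilon> *\<^sub>R v"]) (auto simp: dist_norm)
  qed
qed

lemma uc_partials_le: "uc_partials K S F \<Longrightarrow> k \<le> K \<Longrightarrow> uc_partials k S F"
  unfolding uc_partials_def by (rule has_partials_le)

lemma uc_partials_Dx: "uc_partials (Suc K) S F \<Longrightarrow> uc_partials K S (Dx F)"
  and uc_partials_Dy: "uc_partials (Suc K) S F \<Longrightarrow> uc_partials K S (Dy F)"
  by (simp_all add: uc_partials_def)

text \<open>Built from the limits of the single factors and linear in \<open>v\<close>, so that the
  unit normal can be rescaled to the normal given by the parametrisation.\<close>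

definition side_flux :: "(real \<times> real) set \<Rightarrow> (real \<times> real \<Rightarrow> real) \<Rightarrow> (real \<times> real \<Rightarrow> real) \<Rightarrow> real \<times> real \<Rightarrow> real \<times> real \<Rightarrow> real" where
  "side_flux S a u z v = side_val S a z * (side_val S (Dx u) z * fst v + side_val S (Dy u) z * snd v)"

lemma (in boundary_point) side_val_flux:
  assumes "uc_partials 0 S a" "uc_partials 1 S u"
  shows "side_val S (\<lambda>z'. (a z' *\<^sub>R (Dx u z', Dy u z')) \<bullet> v) P = side_flux S a u P v"
proof -
  have "tame S P a" "tame S P (Dx u)" "tame S P (Dy u)"
    using uc_partials_tame_partials[OF assms(1) P_closure] uc_partials_tame_partials[OF assms(2) P_closure] by auto
  then have "((\<lambda>z'. a z' * (Dx u z' * fst v + Dy u z' * snd v)) \<longlongrightarrow>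
      bval S P a * (bval S P (Dx u) * fst v + bval S P (Dy u) * snd v)) (at P within S)"
    by (intro tendsto_intros tame_tendsto)
  then show ?thesis
    unfolding side_val_eq_bval side_flux_def
    by (intro bval_eqI) (simp add: inner_prod_def algebra_simps)
qed

text \<open>By the Taylor expansions up to the interface, the jump relations along the curve agree with
  those of the Taylor polynomials to high order, so that no chain rule at the boundary is needed.\<close>

locale interface_data = transmission Op Om a r s t0 J
  + pl: accessible_boundary_point Op "(r t0, s t0)" + mi: accessible_boundary_point Om "(r t0, s t0)"
  for Op Om a r s t0 J +
  fixes u f g gG :: "real \<times> real \<Rightarrow> real"
  assumes a_reg: "uc_partials 6 Op a" "uc_partials 6 Om a"
    and u_reg: "uc_partials 7 Op u" "uc_partials 7 Om u"
    and f_reg: "uc_partials 5 Op f" "uc_partials 5 Om f"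
    and a_nonzero: "\<And>z. z \<in> Op \<union> Om \<Longrightarrow> a z \<noteq> 0" "side_val Op a (r t0, s t0) \<noteq> 0"
    and pde: "\<And>z. z \<in> Op \<union> Om \<Longrightarrow> - (Dx (\<lambda>z. a z * Dx u z) z + Dy (\<lambda>z. a z * Dy u z) z) = f z"
    and curve: "\<And>t. t \<in> J \<Longrightarrow> (r t, s t) \<in> closure Op" "\<And>t. t \<in> J \<Longrightarrow> (r t, s t) \<in> closure Om"
    and jump_u: "\<And>t. t \<in> J \<Longrightarrow> side_val Op u (r t, s t) - side_val Om u (r t, s t) = g (r t, s t)"
    and jump_flux: "\<And>t. t \<in> J \<Longrightarrow> side_flux Op a u (r t, s t) (deriv s t, - deriv r t)
        - side_flux Om a u (r t, s t) (deriv s t, - deriv r t)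
        = gG (r t, s t) * sqrt ((deriv r t)\<^sup>2 + (deriv s t)\<^sup>2)"
    and regular_curve: "\<And>t. t \<in> J \<Longrightarrow> (deriv r t)\<^sup>2 + (deriv s t)\<^sup>2 > 0"
    and g_reg: "Ck_on 5 J (\<lambda>t. g (r t, s t))" "Ck_on 4 J (\<lambda>t. gG (r t, s t))"
begin

lemma full_jet_plus: "p + q \<le> 5 \<Longrightarrow> full_jet Op a P (side_deriv Op u P) (side_deriv Op f P) p q = side_deriv Op u P p q"
  by (rule pl.full_jet_of_solution[of 5])
     (use a_nonzero pde pl.side_val_eq_bval in \<open>auto intro!: uc_partials_tame_partials pl.P_closure
        uc_partials_le[OF u_reg(1)] uc_partials_le[OF f_reg(1)] uc_partials_le[OF a_reg(1)]\<close>)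

lemma full_jet_minus: "p + q \<le> 5 \<Longrightarrow> full_jet Om a P (side_deriv Om u P) (side_deriv Om f P) p q = side_deriv Om u P p q"
  by (rule mi.full_jet_of_solution[of 5])
     (use a_nonzero pde am_nonzero mi.side_deriv_eq_bval[of a 0 0] in \<open>auto intro!: uc_partials_tame_partials mi.P_closure
        uc_partials_le[OF u_reg(2)] uc_partials_le[OF f_reg(2)] uc_partials_le[OF a_reg(2)]\<close>)

lemma taxi_curve_bigo: "(\<lambda>t. taxi P (r t, s t)) \<in> O[at t0](\<lambda>t. t - t0)"
proof -
  have *: "(\<lambda>t. \<phi> t - \<phi> t0) \<in> O[at t0](\<lambda>t. t - t0)" if "Ck_on (Suc 4) J \<phi>" for \<phi>
    by (rule bigoI_tendsto[OF tendsto_difference_quotient[OF that]]) (simp add: eventually_at_filter)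
  have "(\<lambda>t. r t - r t0) \<in> O[at t0](\<lambda>t. t - t0)" "(\<lambda>t. s t - s t0) \<in> O[at t0](\<lambda>t. t - t0)"
    using * Cr Cs by (simp_all add: eval_nat_numeral)
  then show ?thesis unfolding taxi_def fst_conv snd_conv by (intro sum_in_bigo) (simp_all add: landau_o.big.abs)
qed

lemma eventually_taxi_curve: "\<delta> > 0 \<Longrightarrow> \<forall>\<^sub>F t in at t0. taxi P (r t, s t) < \<delta>"
proof -
  assume "\<delta> > 0"
  have "isCont r t0" "isCont s t0"
    using Ck_on_continuous[OF Cr] Ck_on_continuous[OF Cs] J by (auto simp: continuous_on_eq_continuous_at)
  then have "((\<lambda>t. taxi P (r t, s t)) \<longlongrightarrow> \<bar>r t0 - r t0\<bar> + \<bar>s t0 - s t0\<bar>) (at t0)"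
    unfolding taxi_def fst_conv snd_conv isCont_def by (intro tendsto_intros)
  then show ?thesis using \<open>\<delta> > 0\<close> by (intro order_tendstoD(2)) auto
qed

text \<open>The curve departs from \<open>P\<close> at most linearly in \<open>t - t0\<close>, so
  the Taylor estimate on the closure becomes an estimate in powers of \<open>t - t0\<close>.\<close>

lemma side_val_curve_bigo:
  assumes "accessible_boundary_point S P" "uc_partials (Suc K) S F" "\<And>t. t \<in> J \<Longrightarrow> (r t, s t) \<in> closure S"
  shows "(\<lambda>t. side_val S F (r t, s t) - taylor_poly K (side_deriv S F P) (d t)) \<in> O[at t0](\<lambda>t. (t - t0) ^ Suc K)"
proof -
  interpret S: accessible_boundary_point S P by (rule assms(1))
  obtain C \<delta> where C: "\<delta> > 0" "\<And>z. z \<in> closure S \<Longrightarrow> taxi P z < \<delta> \<Longrightarrow>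
    \<bar>side_val S F z - taylor_poly K (side_deriv S F P) (z - P)\<bar> \<le> C * taxi P z ^ Suc K"
    using S.taylor_bound_closure[OF assms(2)] by blast
  have "\<forall>\<^sub>F t in at t0. t \<in> J"
    using J by (simp add: eventually_at_topological) blast
  then have "\<forall>\<^sub>F t in at t0. norm (side_val S F (r t, s t) - taylor_poly K (side_deriv S F P) (d t))
      \<le> C * norm (taxi P (r t, s t) ^ Suc K)"
    using eventually_taxi_curve[OF C(1)]
  proof eventually_elim
    case (elim t)
    have "d t = (r t, s t) - P" by (simp add: d_def)
    then show ?case using C(2)[OF assms(3)] elim by simp
  qed
  then have "(\<lambda>t. side_val S F (r t, s t) - taylor_poly K (side_deriv S F P) (d t)) \<in> O[at t0](\<lambda>t. taxi P (r t, s t) ^ Suc K)"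
    by (rule bigoI)
  also have "(\<lambda>t. taxi P (r t, s t) ^ Suc K) \<in> O[at t0](\<lambda>t. (t - t0) ^ Suc K)"
    by (rule landau_o.big_power[OF taxi_curve_bigo])
  finally show ?thesis .
qed

lemma Ck_on_bounded: "Ck_on n J \<phi> \<Longrightarrow> \<phi> \<in> O[at t0](\<lambda>_. 1)"
  using Ck_on_continuous[of n J \<phi>] J
  by (intro bigoI_tendsto[where c = "\<phi> t0"]) (auto simp: continuous_on_eq_continuous_at isCont_def)

text \<open>All factors agree with their quartic Taylor polynomials up to order five and the
  polynomials stay bounded, so the products agree up to order five, enough for the four derivatives
  taken of the flux.\<close>

lemma side_flux_curve_bigo:
  assumes S: "accessible_boundary_point S P" "\<And>t. t \<in> J \<Longrightarrow> (r t, s t) \<in> closure S"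
    and reg: "uc_partials 6 S a" "uc_partials 7 S u"
  shows "(\<lambda>t. side_flux S a u (r t, s t) (deriv s t, - deriv r t) - flux S (side_deriv S u P) t) \<in> O[at t0](\<lambda>t. (t - t0) ^ 5)"
proof -
  interpret S: accessible_boundary_point S P by (rule S(1))
  let ?O = "O[at t0](\<lambda>t. (t - t0) ^ 5)"
  define A where "A t = side_val S a (r t, s t)" for t
  define X where "X t = side_val S (Dx u) (r t, s t)" for t
  define Y where "Y t = side_val S (Dy u) (r t, s t)" for t
  define A' where "A' t = taylor_poly 4 (side_deriv S a P) (d t)" for t
  define X' where "X' t = taylor_poly 4 (\<lambda>m n. side_deriv S u P (m + 1) n) (d t)" for t
  define Y' where "Y' t = taylor_poly 4 (\<lambda>m n. side_deriv S u P m (n + 1)) (d t)" for t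
  have tu: "tame_partials S P 7 u" by (rule uc_partials_tame_partials[OF reg(2) S.P_closure])
  have "X' t = taylor_poly 4 (side_deriv S (Dx u) P) (d t)" for t
    unfolding X'_def
  proof (rule taylor_poly_cong)
    fix m n :: nat assume "m + n \<le> 4"
    then have "tame_partials S P (m + n + 1) u" by (intro has_partials_le[OF tu]) simp
    then show "side_deriv S u P (m + 1) n = side_deriv S (Dx u) P m n"
      by (simp add: S.side_deriv_eq_bval S.bval_Dxy_Dx)
  qed
  then have X: "(\<lambda>t. X t - X' t) \<in> ?O"
    using side_val_curve_bigo[OF S(1) uc_partials_le[OF uc_partials_Dx], of 6 u 4] reg(2) S(2)
    by (simp add: X_def)
  have "Y' t = taylor_poly 4 (side_deriv S (Dy u) P) (d t)" for t
    unfolding Y'_def by (rule taylor_poly_cong) (simp add: S.side_deriv_eq_bval Dxy_Dy)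
  then have Y: "(\<lambda>t. Y t - Y' t) \<in> ?O"
    using side_val_curve_bigo[OF S(1) uc_partials_le[OF uc_partials_Dy], of 6 u 4] reg(2) S(2)
    by (simp add: Y_def)
  have A: "(\<lambda>t. A t - A' t) \<in> ?O"
    using side_val_curve_bigo[OF S(1) uc_partials_le[OF reg(1)], of 4] S(2) by (simp add: A_def A'_def)
  have bA: "A' \<in> O[at t0](\<lambda>_. 1)" and bX: "X' \<in> O[at t0](\<lambda>_. 1)" and bY: "Y' \<in> O[at t0](\<lambda>_. 1)"
    unfolding A'_def[abs_def] X'_def[abs_def] Y'_def[abs_def] by (rule Ck_on_bounded[OF Ck_taylor])+
  have br: "deriv r \<in> O[at t0](\<lambda>_. 1)" and bs: "deriv s \<in> O[at t0](\<lambda>_. 1)"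
    by (rule Ck_on_bounded[OF Ck_deriv_r], rule Ck_on_bounded[OF Ck_deriv_s])
  have one: "(\<lambda>t. (t - t0) ^ 5) \<in> O[at t0](\<lambda>_. 1)"
  proof (rule bigoI_tendsto)
    have "((\<lambda>t. (t - t0) ^ 5 / 1) \<longlongrightarrow> (t0 - t0) ^ 5 / 1) (at t0)" by (intro tendsto_intros) simp
    then show "((\<lambda>t. (t - t0) ^ 5 / 1) \<longlongrightarrow> 0) (at t0)" by simp
  qed simp
  define Z where "Z t = X t * deriv s t - Y t * deriv r t" for t
  define Z' where "Z' t = X' t * deriv s t - Y' t * deriv r t" for t
  have ml: "(\<lambda>t. p t * q t) \<in> ?O" if "p \<in> ?O" "q \<in> O[at t0](\<lambda>_. 1)" for p q :: "real \<Rightarrow> real"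
    using landau_o.big.mult[OF that] by simp
  have "(\<lambda>t. (X t - X' t) * deriv s t - (Y t - Y' t) * deriv r t) \<in> ?O"
    by (intro sum_in_bigo ml X Y br bs)
  then have Z: "(\<lambda>t. Z t - Z' t) \<in> ?O" by (simp add: Z_def Z'_def algebra_simps)
  have bZ: "Z' \<in> O[at t0](\<lambda>_. 1)"
    unfolding Z'_def[abs_def] using landau_o.big.mult[OF bX bs] landau_o.big.mult[OF bY br] by (intro sum_in_bigo) simp_all
  \<comment> \<open>Expansion of \<open>A t * Z t - A' t * Z' t\<close> in which every summand
    contains a small factor and the other factor is bounded; only bounds for the Taylor polynomials
    are at hand.\<close>
  have "(\<lambda>t. ((A t - A' t) * (Z t - Z' t) + (A t - A' t) * Z' t) + (Z t - Z' t) * A' t) \<in> ?O"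
    by (intro sum_in_bigo ml A Z bZ bA landau_o.big_trans[OF Z one])
  also have "(\<lambda>t. ((A t - A' t) * (Z t - Z' t) + (A t - A' t) * Z' t) + (Z t - Z' t) * A' t)
      = (\<lambda>t. side_flux S a u (r t, s t) (deriv s t, - deriv r t) - flux S (side_deriv S u P) t)"
    by (intro ext) (simp add: side_flux_def flux_def A_def X_def Y_def A'_def X'_def Y'_def Z_def Z'_def algebra_simps)
  finally show ?thesis .
qed

lemma accessible_plus: "accessible_boundary_point Op P" and accessible_minus: "accessible_boundary_point Om P"
  by unfold_locales

text \<open>Jump data minus the jump of the Taylor polynomials is five times (for the flux four
  times) continuously differentiable along the curve, and by the Taylor estimates it vanishes to one
  order more; so all derivatives in question are zero at \<open>t0\<close>.\<close>

lemma actual_transmission_system: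
  "TS (side_deriv Op u P) (side_deriv Op f P) (side_deriv Om f P) (g_coef r s t0 g) (gG_coef r s t0 gG) (side_deriv Om u P)"
proof -
  have nhd: "\<forall>\<^sub>F t in at t0. t \<in> J" using J by (simp add: eventually_at_topological) blast
  let ?U = "side_deriv Op u P" and ?V = "side_deriv Om u P"
  have 1: "E1 p ?U - E1 p ?V = g_coef r s t0 g p" if p: "p \<le> 5" for p
  proof -
    define T where "T t = 1 * taylor_poly 5 ?U (d t) + (-1) * taylor_poly 5 ?V (d t)" for t
    have CT: "Ck_on 5 J T" unfolding T_def by (intro Ck_on_add Ck_on_cmult Ck_taylor J)
    have "(\<lambda>t. (side_val Op u (r t, s t) - taylor_poly 5 ?U (d t)) - (side_val Om u (r t, s t) - taylor_poly 5 ?V (d t)))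
        \<in> O[at t0](\<lambda>t. (t - t0) ^ Suc 5)"
      by (intro sum_in_bigo side_val_curve_bigo accessible_plus accessible_minus curve uc_partials_le[OF u_reg(1)] uc_partials_le[OF u_reg(2)]) auto
    moreover have ev: "\<forall>\<^sub>F t in at t0. 1 * g (r t, s t) + (-1) * T t
        = (side_val Op u (r t, s t) - taylor_poly 5 ?U (d t)) - (side_val Om u (r t, s t) - taylor_poly 5 ?V (d t))"
      using nhd by eventually_elim (simp add: jump_u[symmetric] T_def)
    ultimately have "(\<lambda>t. 1 * g (r t, s t) + (-1) * T t) \<in> O[at t0](\<lambda>t. (t - t0) ^ Suc 5)"
      by (simp only: landau_o.big.in_cong[OF ev])
    then have "(deriv ^^ p) (\<lambda>t. 1 * g (r t, s t) + (-1) * T t) t0 = 0"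
      by (intro bigo_imp_derivs_zero[OF J _ p] Ck_on_add Ck_on_cmult g_reg CT J)
    then have "(deriv ^^ p) (\<lambda>t. g (r t, s t)) t0 = (deriv ^^ p) T t0"
      by (subst (asm) higher_deriv_linear[OF J(1) Ck_on_le[OF g_reg(1) p] Ck_on_le[OF CT p] J(2)]) simp
    also have "\<dots> = (deriv ^^ p) (\<lambda>t. taylor_poly 5 ?U (d t)) t0 - (deriv ^^ p) (\<lambda>t. taylor_poly 5 ?V (d t)) t0"
      unfolding T_def
      by (subst higher_deriv_linear[OF J(1) Ck_on_le[OF Ck_taylor p] Ck_on_le[OF Ck_taylor p] J(2)]) simp
    finally show ?thesis by (simp add: g_coef_def E1_def diff_divide_distrib)
  qed
  define \<kappa> where "\<kappa> t = sqrt ((deriv r t)\<^sup>2 + (deriv s t)\<^sup>2)" for t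
  have Cg: "Ck_on 4 J (\<lambda>t. gG (r t, s t) * \<kappa> t)"
    unfolding \<kappa>_def
    by (intro Ck_on_mult g_reg J Ck_on_sqrt Ck_on_add Ck_on_power Ck_deriv_r Ck_deriv_s regular_curve)
  have 2: "E2 Op p ?U - E2 Om p ?V = gG_coef r s t0 gG p" if p: "p \<le> 4" for p
  proof -
    define T where "T t = 1 * flux Op ?U t + (-1) * flux Om ?V t" for t
    have CT: "Ck_on 4 J T" unfolding T_def by (intro Ck_on_add Ck_on_cmult Ck_flux J)
    have "(\<lambda>t. (side_flux Op a u (r t, s t) (deriv s t, - deriv r t) - flux Op ?U t)
        - (side_flux Om a u (r t, s t) (deriv s t, - deriv r t) - flux Om ?V t)) \<in> O[at t0](\<lambda>t. (t - t0) ^ 5)"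
      by (intro sum_in_bigo side_flux_curve_bigo accessible_plus accessible_minus curve a_reg u_reg)
    moreover have ev: "\<forall>\<^sub>F t in at t0. 1 * (gG (r t, s t) * \<kappa> t) + (-1) * T t
        = (side_flux Op a u (r t, s t) (deriv s t, - deriv r t) - flux Op ?U t)
        - (side_flux Om a u (r t, s t) (deriv s t, - deriv r t) - flux Om ?V t)"
      using nhd by eventually_elim (simp add: jump_flux[symmetric] T_def \<kappa>_def)
    ultimately have "(\<lambda>t. 1 * (gG (r t, s t) * \<kappa> t) + (-1) * T t) \<in> O[at t0](\<lambda>t. (t - t0) ^ 5)"
      by (simp only: landau_o.big.in_cong[OF ev])
    then have "(\<lambda>t. 1 * (gG (r t, s t) * \<kappa> t) + (-1) * T t) \<in> O[at t0](\<lambda>t. (t - t0) ^ Suc 4)"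
      by simp
    then have "(deriv ^^ p) (\<lambda>t. 1 * (gG (r t, s t) * \<kappa> t) + (-1) * T t) t0 = 0"
      by (intro bigo_imp_derivs_zero[OF J _ p] Ck_on_add Ck_on_cmult Cg CT J)
    then have "(deriv ^^ p) (\<lambda>t. gG (r t, s t) * \<kappa> t) t0 = (deriv ^^ p) T t0"
      by (subst (asm) higher_deriv_linear[OF J(1) Ck_on_le[OF Cg p] Ck_on_le[OF CT p] J(2)]) simp
    also have "\<dots> = (deriv ^^ p) (flux Op ?U) t0 - (deriv ^^ p) (flux Om ?V) t0"
      unfolding T_def
      by (subst higher_deriv_linear[OF J(1) Ck_on_le[OF Ck_flux p] Ck_on_le[OF Ck_flux p] J(2)]) simp
    finally show ?thesis by (simp add: gG_coef_def E2_def diff_divide_distrib \<kappa>_def)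
  qed
  \<comment> \<open>By the equation the reduced jets are the true ones up to order five, and
    \<open>E1\<close> and \<open>E2\<close> read nothing beyond.\<close>
  have "E1 p (full_jet Op a P ?U (side_deriv Op f P)) = E1 p ?U" "E1 p (full_jet Om a P ?V (side_deriv Om f P)) = E1 p ?V"
    "E2 Op p (full_jet Op a P ?U (side_deriv Op f P)) = E2 Op p ?U" "E2 Om p (full_jet Om a P ?V (side_deriv Om f P)) = E2 Om p ?V" for p
    by (rule E1_cong E2_cong, erule full_jet_plus full_jet_minus)+
  then show ?thesis unfolding transmission_system_iff using 1 2 by auto
qed

end

section \<open>Consistency of the scheme\<close>

text \<open>The sum norm of the coefficients. It is submultiplicative and so gives bounds for
  products of polynomials in \<open>h\<close> that are uniform in all parameters.\<close>

definition pnorm :: "real poly \<Rightarrow> real" where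
  "pnorm p = (\<Sum>i\<le>degree p. \<bar>coeff p i\<bar>)"

lemma pnorm_eq: "degree p \<le> n \<Longrightarrow> pnorm p = (\<Sum>i\<le>n. \<bar>coeff p i\<bar>)"
  unfolding pnorm_def by (rule sum.mono_neutral_left) (auto simp: coeff_eq_0)

lemma pnorm_nonneg: "pnorm p \<ge> 0"
  by (simp add: pnorm_def sum_nonneg)

lemma pnorm_0 [simp]: "pnorm 0 = 0"
  by (simp add: pnorm_def)

lemma pnorm_add: "pnorm (p + q) \<le> pnorm p + pnorm q"
proof -
  let ?n = "max (degree p) (degree q)"
  have "pnorm (p + q) = (\<Sum>i\<le>?n. \<bar>coeff p i + coeff q i\<bar>)"
    by (subst pnorm_eq[of _ ?n]) (auto simp: degree_add_le)
  also have "\<dots> \<le> (\<Sum>i\<le>?n. \<bar>coeff p i\<bar> + \<bar>coeff q i\<bar>)" by (intro sum_mono abs_triangle_ineq)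
  also have "\<dots> = pnorm p + pnorm q" by (simp add: sum.distrib pnorm_eq[of p ?n] pnorm_eq[of q ?n])
  finally show ?thesis .
qed

lemma pnorm_smult: "pnorm (smult c p) = \<bar>c\<bar> * pnorm p"
  by (subst pnorm_eq[of _ "degree p"]) (auto simp: degree_smult_le pnorm_def abs_mult sum_distrib_left)

lemma pnorm_pCons: "pnorm (pCons c p) = \<bar>c\<bar> + pnorm p"
proof -
  have "pnorm (pCons c p) = (\<Sum>i\<le>Suc (degree p). \<bar>coeff (pCons c p) i\<bar>)"
    by (rule pnorm_eq) (rule degree_pCons_le)
  also have "\<dots> = \<bar>c\<bar> + pnorm p" unfolding pnorm_def by (subst sum.atMost_Suc_shift) simp
  finally show ?thesis .
qed

lemma pnorm_mult: "pnorm (p * q) \<le> pnorm p * pnorm q"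
proof (induction p)
  case (pCons c p)
  have "pnorm (pCons c p * q) \<le> pnorm (smult c q) + pnorm (pCons 0 (p * q))"
    by (simp add: pnorm_add)
  also have "\<dots> \<le> \<bar>c\<bar> * pnorm q + pnorm p * pnorm q"
    using pCons.IH by (simp add: pnorm_smult pnorm_pCons)
  finally show ?case by (simp add: pnorm_pCons algebra_simps)
qed simp

lemma pnorm_power: "pnorm (p ^ n) \<le> pnorm p ^ n"
proof (induction n)
  case (Suc n)
  have "pnorm (p ^ Suc n) \<le> pnorm p * pnorm (p ^ n)" by (simp add: pnorm_mult)
  also have "\<dots> \<le> pnorm p * pnorm p ^ n" by (intro mult_left_mono Suc pnorm_nonneg)
  finally show ?case by simp
qed (simp add: pnorm_def)

lemma pnorm_sum: "pnorm (\<Sum>i\<in>A. f i) \<le> (\<Sum>i\<in>A. pnorm (f i))"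
proof (induction A rule: infinite_finite_induct)
  case (insert x A)
  then show ?case using pnorm_add[of "f x" "sum f A"] by simp
qed simp_all

text \<open>For \<open>h \<le> 1\<close> every power that remains is at most \<open>h ^ n\<close>.
  This turns vanishing coefficients into an explicit estimate.\<close>

lemma poly_le_pnorm:
  assumes "\<And>i. i < n \<Longrightarrow> coeff p i = 0" "0 \<le> h" "h \<le> 1"
  shows "\<bar>poly p h\<bar> \<le> pnorm p * h ^ n"
proof -
  have "\<bar>poly p h\<bar> \<le> (\<Sum>i\<le>degree p. \<bar>coeff p i * h ^ i\<bar>)"
    unfolding poly_altdef by (rule sum_abs)
  also have "\<dots> \<le> (\<Sum>i\<le>degree p. \<bar>coeff p i\<bar> * h ^ n)"
  proof (rule sum_mono)
    fix i
    show "\<bar>coeff p i * h ^ i\<bar> \<le> \<bar>coeff p i\<bar> * h ^ n"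
      using assms power_decreasing[of n i h]
      by (cases "i < n") (auto simp: abs_mult power_abs intro!: mult_left_mono)
  qed
  finally show ?thesis by (simp add: pnorm_def sum_distrib_right)
qed

lemma pnorm_monom: "pnorm (monom c n) \<le> \<bar>c\<bar>"
proof -
  have "pnorm (monom c n) = (\<Sum>i\<le>n. \<bar>coeff (monom c n) i\<bar>)" by (rule pnorm_eq) (rule degree_monom_le)
  also have "\<dots> = (\<Sum>i\<le>n. if i = n then \<bar>c\<bar> else 0)" by (rule sum.cong) auto
  finally show ?thesis by simp
qed

lemma pnorm_Cpoly:
  assumes "\<And>p. p \<le> 5 \<Longrightarrow> \<bar>c kl p\<bar> \<le> M" shows "pnorm (Cpoly c kl) \<le> 6 * M"
proof -
  have "pnorm (Cpoly c kl) \<le> (\<Sum>p=0..5. pnorm (monom (c kl p) p))" unfolding Cpoly_def by (rule pnorm_sum)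
  also have "\<dots> \<le> (\<Sum>p=0..(5::nat). M)"
    by (intro sum_mono order.trans[OF pnorm_monom] assms) simp
  finally show ?thesis by simp
qed

text \<open>The number 3 bounds \<open>v0 + k\<close> and \<open>w0 + l\<close>, as offsets are at
  most 1 and stencil indices at most 2 in absolute value.\<close>

definition G5_bound :: "(real \<times> real) set \<Rightarrow> (real \<times> real \<Rightarrow> real) \<Rightarrow> real \<times> real \<Rightarrow> nat \<Rightarrow> nat \<Rightarrow> real" where
  "G5_bound S a z m n = (\<Sum>(p, q)\<in>Lam 5. \<bar>au S a z p q m n / (fact p * fact q)\<bar> * (3 ^ p * 3 ^ q))"

lemma pnorm_G5:
  assumes "\<bar>x\<bar> \<le> 3" "\<bar>y\<bar> \<le> 3" shows "pnorm (G5 S a z m n [:0, x:] [:0, y:]) \<le> G5_bound S a z m n"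
proof -
  have lin: "pnorm ([:0, x:] ^ p) \<le> 3 ^ p" if "\<bar>x\<bar> \<le> 3" for p x
  proof -
    have "pnorm [:0, x:] = \<bar>x\<bar>" by (simp add: pnorm_pCons)
    then have "pnorm ([:0, x:] ^ p) \<le> \<bar>x\<bar> ^ p" using pnorm_power[of "[:0, x:]" p] by simp
    also have "\<dots> \<le> 3 ^ p" using that by (intro power_mono) auto
    finally show ?thesis .
  qed
  have "pnorm (G5 S a z m n [:0, x:] [:0, y:]) \<le>
      (\<Sum>k\<in>Lam 5. pnorm (smult (au S a z (fst k) (snd k) m n / (fact (fst k) * fact (snd k))) ([:0, x:] ^ fst k * [:0, y:] ^ snd k)))"
    unfolding G5_def case_prod_unfold by (rule pnorm_sum)
  also have "\<dots> \<le> G5_bound S a z m n"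
    unfolding G5_bound_def case_prod_unfold pnorm_smult
    by (intro sum_mono mult_left_mono order.trans[OF pnorm_mult] mult_mono lin assms pnorm_nonneg) auto
  finally show ?thesis .
qed

lemma finite_stencil: "finite stencil"
  by (simp add: stencil_def near_idx_def far_idx_def)

lemma stencil_bound: "(k, l) \<in> stencil \<Longrightarrow> \<bar>real_of_int k\<bar> \<le> 2 \<and> \<bar>real_of_int l\<bar> \<le> 2"
  by (auto simp: stencil_def near_idx_def far_idx_def)

text \<open>The bound sums over the full stencil in order not to depend on \<open>D\<close>; the
  factor 6 counts the coefficients of \<open>Cpoly\<close>.\<close>

lemma pnorm_Ipoly:
  assumes "D \<subseteq> stencil" "\<And>kl p. kl \<in> stencil \<Longrightarrow> p \<le> 5 \<Longrightarrow> \<bar>c kl p\<bar> \<le> M" "\<bar>v0\<bar> \<le> 1" "\<bar>w0\<bar> \<le> 1"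
  shows "pnorm (Ipoly S a z D v0 w0 c m n) \<le> (\<Sum>kl\<in>stencil. 6 * \<bar>M\<bar> * G5_bound S a z m n)"
proof -
  have B: "G5_bound S a z m n \<ge> 0" unfolding G5_bound_def case_prod_unfold by (intro sum_nonneg) auto
  have "pnorm (Ipoly S a z D v0 w0 c m n) \<le>
      (\<Sum>kl\<in>D. pnorm (Cpoly c kl * G5 S a z m n [:0, v0 + real_of_int (fst kl):] [:0, w0 + real_of_int (snd kl):]))"
    unfolding Ipoly_def case_prod_unfold prod.collapse by (rule pnorm_sum)
  also have "\<dots> \<le> (\<Sum>kl\<in>D. 6 * \<bar>M\<bar> * G5_bound S a z m n)"
  proof (intro sum_mono order.trans[OF pnorm_mult] mult_mono pnorm_nonneg)
    fix kl assume kl: "kl \<in> D"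
    have "pnorm (Cpoly c kl) \<le> 6 * M" by (rule pnorm_Cpoly) (use assms kl in blast)
    then show "pnorm (Cpoly c kl) \<le> 6 * \<bar>M\<bar>" by linarith
    show "pnorm (G5 S a z m n [:0, v0 + real_of_int (fst kl):] [:0, w0 + real_of_int (snd kl):]) \<le> G5_bound S a z m n"
    proof (rule pnorm_G5)
      have "\<bar>real_of_int (fst kl)\<bar> \<le> 2" "\<bar>real_of_int (snd kl)\<bar> \<le> 2"
        using stencil_bound[of "fst kl" "snd kl"] assms(1) kl by auto
      then show "\<bar>v0 + real_of_int (fst kl)\<bar> \<le> 3" "\<bar>w0 + real_of_int (snd kl)\<bar> \<le> 3"
        using assms(3,4) by linarith+
    qed
  qed auto
  also have "\<dots> \<le> (\<Sum>kl\<in>stencil. 6 * \<bar>M\<bar> * G5_bound S a z m n)"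
    by (rule sum_mono2[OF finite_stencil assms(1)]) (use B in auto)
  finally show ?thesis .
qed

section \<open>Regrouping stencil sums by independent derivatives\<close>

lemma af_Lam1: "(p, q) \<in> Lam1 K \<Longrightarrow> af S a z p q m n = 0"
  by (auto simp: Lam1_def af_def wrec_less_2)

text \<open>Each derivative in the Taylor polynomial is replaced by its reduction; interchanging the
  sums leaves \<open>G5\<close> and \<open>H5\<close> as the factors of the independent derivatives.
  \<open>H5\<close> may be summed over all of \<open>Lam 5\<close>, as \<open>af\<close> vanishes on
  \<open>Lam1 5\<close>.\<close>

lemma taylor_poly_G5_H5:
  assumes "\<And>p q. p + q \<le> 5 \<Longrightarrow> full_jet S a z U F p q = U p q"
  shows "taylor_poly 5 U (x * h, y * h) = (\<Sum>(m, n)\<in>Lam1 5. U m n * poly (G5 S a z m n [:0, x:] [:0, y:]) h)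
    + (\<Sum>(m, n)\<in>Lam 3. F m n * poly (H5 S a z m n [:0, x:] [:0, y:]) h)"
proof -
  define X where "X pq = (x * h) ^ fst pq * (y * h) ^ snd pq / (fact (fst pq) * fact (snd pq))" for pq :: "nat \<times> nat"
  have G: "poly (G5 S a z (fst k) (snd k) [:0, x:] [:0, y:]) h = (\<Sum>pq\<in>Lam 5. au S a z (fst pq) (snd pq) (fst k) (snd k) * X pq)" for k
    by (simp add: G5_def X_def poly_sum case_prod_unfold mult_ac)
  have H: "poly (H5 S a z (fst k) (snd k) [:0, x:] [:0, y:]) h = (\<Sum>pq\<in>Lam 5. af S a z (fst pq) (snd pq) (fst k) (snd k) * X pq)" for k
  proof -
    have "poly (H5 S a z (fst k) (snd k) [:0, x:] [:0, y:]) h = (\<Sum>pq\<in>Lam2 5. af S a z (fst pq) (snd pq) (fst k) (snd k) * X pq)"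
      by (simp add: H5_def X_def poly_sum case_prod_unfold mult_ac)
    also have "\<dots> = (\<Sum>pq\<in>Lam 5. af S a z (fst pq) (snd pq) (fst k) (snd k) * X pq)"
      by (rule sum.mono_neutral_left) (auto simp: Lam2_def af_Lam1[of _ _ 5])
    finally show ?thesis .
  qed
  have "taylor_poly 5 U (x * h, y * h) = (\<Sum>pq\<in>Lam 5. U (fst pq) (snd pq) * X pq)"
    by (simp add: taylor_poly_def X_def case_prod_unfold mult_ac)
  also have "\<dots> = (\<Sum>pq\<in>Lam 5. ((\<Sum>k\<in>Lam1 5. U (fst k) (snd k) * au S a z (fst pq) (snd pq) (fst k) (snd k))
      + (\<Sum>k\<in>Lam 3. F (fst k) (snd k) * af S a z (fst pq) (snd pq) (fst k) (snd k))) * X pq)"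
  proof (rule sum.cong[OF refl])
    fix pq assume "pq \<in> Lam 5"
    then have le: "fst pq + snd pq \<le> 5" by (auto simp: Lam_def)
    show "U (fst pq) (snd pq) * X pq = ((\<Sum>k\<in>Lam1 5. U (fst k) (snd k) * au S a z (fst pq) (snd pq) (fst k) (snd k))
      + (\<Sum>k\<in>Lam 3. F (fst k) (snd k) * af S a z (fst pq) (snd pq) (fst k) (snd k))) * X pq"
      using full_jet_extend[OF le, of S a z U F] assms[OF le] by simp
  qed
  also have "\<dots> = (\<Sum>pq\<in>Lam 5. \<Sum>k\<in>Lam1 5. U (fst k) (snd k) * (au S a z (fst pq) (snd pq) (fst k) (snd k) * X pq))
      + (\<Sum>pq\<in>Lam 5. \<Sum>k\<in>Lam 3. F (fst k) (snd k) * (af S a z (fst pq) (snd pq) (fst k) (snd k) * X pq))"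
    by (simp add: distrib_right sum.distrib sum_distrib_right mult.assoc)
  also have "\<dots> = (\<Sum>k\<in>Lam1 5. \<Sum>pq\<in>Lam 5. U (fst k) (snd k) * (au S a z (fst pq) (snd pq) (fst k) (snd k) * X pq))
      + (\<Sum>k\<in>Lam 3. \<Sum>pq\<in>Lam 5. F (fst k) (snd k) * (af S a z (fst pq) (snd pq) (fst k) (snd k) * X pq))"
    by (subst (1 2) sum.swap) (rule refl)
  finally show ?thesis by (simp add: case_prod_unfold G H sum_distrib_left)
qed

lemma sum_stencil_taylor:
  assumes "\<And>p q. p + q \<le> 5 \<Longrightarrow> full_jet S a z U F p q = U p q"
  shows "(\<Sum>(k, l)\<in>D. poly (Cpoly c (k, l)) h * taylor_poly 5 U ((v0 + real_of_int k) * h, (w0 + real_of_int l) * h))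
    = (\<Sum>(m, n)\<in>Lam1 5. U m n * poly (Ipoly S a z D v0 w0 c m n) h)
    + (\<Sum>(m, n)\<in>Lam 3. F m n * poly (Hpoly S a z D v0 w0 c m n) h)"
proof -
  define C where "C kl = poly (Cpoly c kl) h" for kl
  define G where "G kl mn = poly (G5 S a z (fst mn) (snd mn) [:0, v0 + real_of_int (fst kl):] [:0, w0 + real_of_int (snd kl):]) h" for kl mn
  define H where "H kl mn = poly (H5 S a z (fst mn) (snd mn) [:0, v0 + real_of_int (fst kl):] [:0, w0 + real_of_int (snd kl):]) h" for kl mn
  have "(\<Sum>(k, l)\<in>D. poly (Cpoly c (k, l)) h * taylor_poly 5 U ((v0 + real_of_int k) * h, (w0 + real_of_int l) * h))
    = (\<Sum>kl\<in>D. C kl * ((\<Sum>mn\<in>Lam1 5. U (fst mn) (snd mn) * G kl mn) + (\<Sum>mn\<in>Lam 3. F (fst mn) (snd mn) * H kl mn)))"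
    by (simp add: taylor_poly_G5_H5[OF assms] case_prod_unfold C_def G_def H_def)
  also have "\<dots> = (\<Sum>kl\<in>D. \<Sum>mn\<in>Lam1 5. U (fst mn) (snd mn) * (C kl * G kl mn)) + (\<Sum>kl\<in>D. \<Sum>mn\<in>Lam 3. F (fst mn) (snd mn) * (C kl * H kl mn))"
    by (simp add: distrib_left sum.distrib sum_distrib_left mult.left_commute)
  also have "\<dots> = (\<Sum>mn\<in>Lam1 5. \<Sum>kl\<in>D. U (fst mn) (snd mn) * (C kl * G kl mn)) + (\<Sum>mn\<in>Lam 3. \<Sum>kl\<in>D. F (fst mn) (snd mn) * (C kl * H kl mn))"
    by (subst (1 2) sum.swap) (rule refl)
  finally show ?thesis
    by (simp add: Ipoly_def Hpoly_def case_prod_unfold poly_sum C_def G_def H_def sum_distrib_left)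
qed

lemma Lh_eq_sum: "Lh h c U = (\<Sum>kl\<in>stencil. poly (Cpoly c kl) h * U kl)"
proof -
  have "(\<Sum>kl\<in>stencil. poly (Cpoly c kl) h * U kl) = (\<Sum>kl\<in>near_idx. poly (Cpoly c kl) h * U kl) + (\<Sum>kl\<in>far_idx. poly (Cpoly c kl) h * U kl)"
    unfolding stencil_def by (rule sum.union_disjoint) (auto simp: near_idx_def far_idx_def)
  also have "(\<Sum>kl\<in>near_idx. poly (Cpoly c kl) h * U kl) = (\<Sum>k\<in>{-1..1}. \<Sum>l\<in>{-1..1}. poly (Cpoly c (k, l)) h * U (k, l))"
  proof -
    have "{-1..1} = {-1, 0, 1 :: int}" by auto
    then show ?thesis by (simp only: near_idx_def sum.cartesian_product case_prod_unfold prod.collapse)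
  qed
  also have "(\<Sum>kl\<in>far_idx. poly (Cpoly c kl) h * U kl) = (\<Sum>k\<in>{-2, 2}. poly (Cpoly c (k, 0)) h * U (k, 0)) + (\<Sum>l\<in>{-2, 2}. poly (Cpoly c (0, l)) h * U (0, l))"
    by (simp add: far_idx_def)
  finally show ?thesis by (simp add: Lh_def)
qed

lemma stencil_split:
  "stencil = dp' \<psi> h z \<union> dm' \<psi> h z" "dp' \<psi> h z \<inter> dm' \<psi> h z = {}"
  "kl \<in> dp' \<psi> h z \<longleftrightarrow> kl \<in> stencil \<and> \<psi> (shift h z kl) > 0"
  "kl \<in> dm' \<psi> h z \<longleftrightarrow> kl \<in> stencil \<and> \<psi> (shift h z kl) \<le> 0"
  by (auto simp: dp'_def dm'_def dp_def dm_def pos_idx_def neg_idx_def stencil_def)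

text \<open>The right-hand side of the scheme with the two index sets as parameters, since one
  constant has to serve every splitting of the stencil.\<close>

definition scheme_rhs :: "(real \<times> real) set \<Rightarrow> (real \<times> real) set \<Rightarrow> (real \<times> real \<Rightarrow> real) \<Rightarrow> (real \<Rightarrow> real) \<Rightarrow> (real \<Rightarrow> real)
    \<Rightarrow> real \<Rightarrow> real \<times> real \<Rightarrow> (real \<times> real \<Rightarrow> real) \<Rightarrow> (real \<times> real \<Rightarrow> real) \<Rightarrow> (real \<times> real \<Rightarrow> real) \<Rightarrow> real
    \<Rightarrow> (int \<times> int) set \<Rightarrow> (int \<times> int) set \<Rightarrow> real \<Rightarrow> real \<Rightarrow> (int \<times> int \<Rightarrow> nat \<Rightarrow> real) \<Rightarrow> real" where
  "scheme_rhs Op Om a r s t0 P f g gG h D1 D2 v0 w0 c = (let IM = Ipoly Om a P D2 v0 w0 c in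
     (\<Sum>(m, n)\<in>Lam 3. side_deriv Op f P m n * Jf h (Hpoly Op a P D1 v0 w0 c) IM (Tp Op Om a r s t0) m n)
     + (\<Sum>(m, n)\<in>Lam 3. side_deriv Om f P m n * Jf h (Hpoly Om a P D2 v0 w0 c) IM (Tm Op Om a r s t0) m n)
     + (\<Sum>p=0..5. g_coef r s t0 g p * Jg h IM (Tg Op Om a r s t0) p)
     + (\<Sum>p=0..4. gG_coef r s t0 gG p * Jg h IM (TgG Op Om a r s t0) p))"

context interface_data
begin

abbreviation rhs where "rhs \<equiv> scheme_rhs Op Om a r s t0 P f g gG"

text \<open>If the exact values were given by the Taylor polynomials, the defect of the scheme would be
  the combination of the polynomials of the linear system for \<open>c\<close> with the derivatives of \<open>u\<^sub>+\<close>.\<close>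
lemma scheme_defect:
  fixes D1 D2 c v0 w0
  defines "IP \<equiv> Ipoly Op a P D1 v0 w0 c" and "IM \<equiv> Ipoly Om a P D2 v0 w0 c"
    and "U \<equiv> side_deriv Op u P" and "V \<equiv> side_deriv Om u P"
  assumes "h \<noteq> 0"
  shows "(\<Sum>(k, l)\<in>D1. poly (Cpoly c (k, l)) h * taylor_poly 5 U ((v0 + real_of_int k) * h, (w0 + real_of_int l) * h))
    + (\<Sum>(k, l)\<in>D2. poly (Cpoly c (k, l)) h * taylor_poly 5 V ((v0 + real_of_int k) * h, (w0 + real_of_int l) * h))
    - h * rhs h D1 D2 v0 w0 c
    = (\<Sum>(m, n)\<in>Lam1 5. U m n * poly (IP m n + (\<Sum>(m', n')\<in>{(m', n') \<in> Lam1 5. m' + n' \<ge> m + n}.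
          smult (Tu Op Om a r s t0 m' n' m n) (IM m' n'))) h)"
proof -
  define HP where "HP = Hpoly Op a P D1 v0 w0 c"
  define HM where "HM = Hpoly Om a P D2 v0 w0 c"
  let ?Tu = "\<lambda>k mn. Tu Op Om a r s t0 (fst k) (snd k) (fst mn) (snd mn)"
  let ?Tp = "\<lambda>k mn. Tp Op Om a r s t0 (fst k) (snd k) (fst mn) (snd mn)"
  let ?Tm = "\<lambda>k mn. Tm Op Om a r s t0 (fst k) (snd k) (fst mn) (snd mn)"
  let ?Tg = "\<lambda>k p. Tg Op Om a r s t0 (fst k) (snd k) p"
  let ?TgG = "\<lambda>k p. TgG Op Om a r s t0 (fst k) (snd k) p"
  define Fp where "Fp mn = side_deriv Op f P (fst mn) (snd mn)" for mn
  define Fm where "Fm mn = side_deriv Om f P (fst mn) (snd mn)" for mn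
  define gc where "gc = g_coef r s t0 g"
  define ggc where "ggc = gG_coef r s t0 gG"
  define I where "I k = poly (IM (fst k) (snd k)) h" for k
  define u' where "u' mn = U (fst mn) (snd mn)" for mn
  have "(\<Sum>k\<in>Lam1 5. V (fst k) (snd k) * I k)
      = (\<Sum>k\<in>Lam1 5. (\<Sum>mn\<in>Lam1 5. u' mn * (I k * ?Tu k mn)) + (\<Sum>mn\<in>Lam 3. Fp mn * (I k * ?Tp k mn))
        + (\<Sum>mn\<in>Lam 3. Fm mn * (I k * ?Tm k mn)) + (\<Sum>p=0..5. gc p * (I k * ?Tg k p)) + (\<Sum>p=0..4. ggc p * (I k * ?TgG k p)))"
  proof (rule sum.cong[OF refl])
    fix k :: "nat \<times> nat" assume "k \<in> Lam1 5"
    then have "(fst k, snd k) \<in> Lam1 5" by simp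
    from transmission_representation[OF actual_transmission_system this]
    show "V (fst k) (snd k) * I k = (\<Sum>mn\<in>Lam1 5. u' mn * (I k * ?Tu k mn)) + (\<Sum>mn\<in>Lam 3. Fp mn * (I k * ?Tp k mn))
        + (\<Sum>mn\<in>Lam 3. Fm mn * (I k * ?Tm k mn)) + (\<Sum>p=0..5. gc p * (I k * ?Tg k p)) + (\<Sum>p=0..4. ggc p * (I k * ?TgG k p))"
      unfolding V_def case_prod_unfold u'_def U_def Fp_def Fm_def gc_def ggc_def
      by (simp only: distrib_right sum_distrib_right) (simp only: mult_ac)
  qed
  \<comment> \<open>The interchange collects the factor of each datum: for \<open>u'\<close> the
    contribution of the minus side to the linear system, for the others the part of
    \<open>h * J\<close> that stems from the transmission coefficients.\<close>
  also have "\<dots> = (\<Sum>mn\<in>Lam1 5. u' mn * (\<Sum>k\<in>Lam1 5. I k * ?Tu k mn)) + (\<Sum>mn\<in>Lam 3. Fp mn * (\<Sum>k\<in>Lam1 5. I k * ?Tp k mn))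
        + (\<Sum>mn\<in>Lam 3. Fm mn * (\<Sum>k\<in>Lam1 5. I k * ?Tm k mn)) + (\<Sum>p=0..5. gc p * (\<Sum>k\<in>Lam1 5. I k * ?Tg k p))
        + (\<Sum>p=0..4. ggc p * (\<Sum>k\<in>Lam1 5. I k * ?TgG k p))"
    unfolding sum.distrib sum_distrib_left by (intro arg_cong2[where f = "(+)"] sum.swap)
  finally have V: "(\<Sum>k\<in>Lam1 5. V (fst k) (snd k) * I k) = \<dots>" .
  have Jf1: "h * (\<Sum>(m, n)\<in>Lam 3. F m n * Jf h HH IM T m n)
      = (\<Sum>mn\<in>Lam 3. F (fst mn) (snd mn) * poly (HH (fst mn) (snd mn)) h)
      + (\<Sum>mn\<in>Lam 3. F (fst mn) (snd mn) * (\<Sum>k\<in>Lam1 5. I k * T (fst k) (snd k) (fst mn) (snd mn)))" for F HH T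
  proof -
    have "h * (F (fst mn) (snd mn) * Jf h HH IM T (fst mn) (snd mn)) = F (fst mn) (snd mn) * poly (HH (fst mn) (snd mn)) h
      + F (fst mn) (snd mn) * (\<Sum>k\<in>Lam1 5. I k * T (fst k) (snd k) (fst mn) (snd mn))" for mn
      using \<open>h \<noteq> 0\<close> by (simp add: Jf_def I_def case_prod_unfold field_simps)
    then show ?thesis by (simp add: sum_distrib_left[of h] sum.distrib[symmetric] case_prod_unfold)
  qed
  have Jg1: "h * (\<Sum>p=0..K. G p * Jg h IM T p) = (\<Sum>p=0..K. G p * (\<Sum>k\<in>Lam1 5. I k * T (fst k) (snd k) p))" for K G T
  proof -
    have "h * (G p * Jg h IM T p) = G p * (\<Sum>k\<in>Lam1 5. I k * T (fst k) (snd k) p)" for p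
      using \<open>h \<noteq> 0\<close> by (simp add: Jg_def I_def case_prod_unfold field_simps)
    then show ?thesis unfolding sum_distrib_left[of h] by (intro sum.cong refl)
  qed
  define Qp where "Qp m n = IP m n + (\<Sum>(m', n')\<in>{(m', n') \<in> Lam1 5. m' + n' \<ge> m + n}.
          smult (Tu Op Om a r s t0 m' n' m n) (IM m' n'))" for m n
  have Q: "poly (Qp m n) h
      = poly (IP m n) h + (\<Sum>k\<in>Lam1 5. I k * ?Tu k (m, n))" if "(m, n) \<in> Lam1 5" for m n
  proof -
    have "poly (\<Sum>(m', n')\<in>{(m', n') \<in> Lam1 5. m' + n' \<ge> m + n}. smult (Tu Op Om a r s t0 m' n' m n) (IM m' n')) h
        = (\<Sum>k\<in>{(m', n') \<in> Lam1 5. m' + n' \<ge> m + n}. I k * ?Tu k (m, n))"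
      by (simp add: poly_sum case_prod_unfold I_def mult.commute)
    \<comment> \<open>The terms added to the restricted sum vanish by
      \<open>Tu_eq_0\<close>.\<close>
    also have "\<dots> = (\<Sum>k\<in>Lam1 5. I k * ?Tu k (m, n))"
      by (rule sum.mono_neutral_left[OF finite_Lam1]) (use Tu_eq_0[OF that] in \<open>auto, metis not_le\<close>)
    finally show ?thesis by (simp add: Qp_def)
  qed
  have "(\<Sum>(m, n)\<in>Lam1 5. U m n * poly (Qp m n) h)
      = (\<Sum>mn\<in>Lam1 5. u' mn * poly (IP (fst mn) (snd mn)) h + u' mn * (\<Sum>k\<in>Lam1 5. I k * ?Tu k mn))"
    by (rule sum.cong) (auto simp: Q u'_def distrib_left)
  also have "\<dots> = (\<Sum>mn\<in>Lam1 5. u' mn * poly (IP (fst mn) (snd mn)) h) + (\<Sum>mn\<in>Lam1 5. u' mn * (\<Sum>k\<in>Lam1 5. I k * ?Tu k mn))"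
    by (rule sum.distrib)
  finally have R: "(\<Sum>(m, n)\<in>Lam1 5. U m n * poly (Qp m n) h)
      = (\<Sum>mn\<in>Lam1 5. u' mn * poly (IP (fst mn) (snd mn)) h) + (\<Sum>mn\<in>Lam1 5. u' mn * (\<Sum>k\<in>Lam1 5. I k * ?Tu k mn))" .
  have P1: "(\<Sum>(k, l)\<in>D1. poly (Cpoly c (k, l)) h * taylor_poly 5 U ((v0 + real_of_int k) * h, (w0 + real_of_int l) * h))
    = (\<Sum>mn\<in>Lam1 5. u' mn * poly (IP (fst mn) (snd mn)) h) + (\<Sum>mn\<in>Lam 3. Fp mn * poly (HP (fst mn) (snd mn)) h)"
    unfolding U_def by (subst sum_stencil_taylor[OF full_jet_plus]) (simp_all add: IP_def HP_def case_prod_unfold u'_def U_def Fp_def)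
  have P2: "(\<Sum>(k, l)\<in>D2. poly (Cpoly c (k, l)) h * taylor_poly 5 V ((v0 + real_of_int k) * h, (w0 + real_of_int l) * h))
    = (\<Sum>k\<in>Lam1 5. V (fst k) (snd k) * I k) + (\<Sum>mn\<in>Lam 3. Fm mn * poly (HM (fst mn) (snd mn)) h)"
    unfolding V_def by (subst sum_stencil_taylor[OF full_jet_minus]) (simp_all add: IM_def HM_def case_prod_unfold I_def V_def Fm_def)
  show ?thesis
    unfolding R[unfolded Qp_def] P1 P2 V scheme_rhs_def Let_def IM_def[symmetric] HP_def[symmetric] HM_def[symmetric]
      distrib_left[of h] Jf1 Jg1 Fp_def Fm_def gc_def ggc_def by simp
qed

text \<open>Two errors of sixth order arise: exact against Taylor values (\<open>K2\<close>), and
  the defect of the Taylor values, where the linear system removes the lower coefficients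
  (\<open>K1\<close>). Division by \<open>h\<close> leaves fifth order. \<open>K\<close> precedes
  \<open>h\<close>, \<open>c\<close> and the index sets, so only bounds through \<open>M\<close> and
  the full stencil may enter it.\<close>

lemma consistency:
  fixes \<delta> C M :: real
  assumes C: "0 \<le> C" "0 < \<delta>"
    and Cp: "\<And>z. z \<in> closure Op \<Longrightarrow> taxi P z < \<delta> \<Longrightarrow> \<bar>side_val Op u z - taylor_poly 5 (side_deriv Op u P) (z - P)\<bar> \<le> C * taxi P z ^ 6"
    and Cm: "\<And>z. z \<in> closure Om \<Longrightarrow> taxi P z < \<delta> \<Longrightarrow> \<bar>side_val Om u z - taylor_poly 5 (side_deriv Om u P) (z - P)\<bar> \<le> C * taxi P z ^ 6"
  obtains K where "\<And>h z v0 w0 c D1 D2 val. \<lbrakk>0 < h; h \<le> 1; 6 * h < \<delta>; z = (fst P + v0 * h, snd P + w0 * h);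
      \<bar>v0\<bar> \<le> 1; \<bar>w0\<bar> \<le> 1; D1 \<union> D2 = stencil; D1 \<inter> D2 = {};
      \<forall>kl\<in>D1. shift h z kl \<in> closure Op \<and> val kl = side_val Op u (shift h z kl);
      \<forall>kl\<in>D2. shift h z kl \<in> closure Om \<and> val kl = side_val Om u (shift h z kl);
      coeff_system (Ipoly Op a P D1 v0 w0 c) (Ipoly Om a P D2 v0 w0 c) (Tu Op Om a r s t0);
      \<forall>kl\<in>stencil. \<forall>p\<le>5. \<bar>c kl p\<bar> \<le> M\<rbrakk> \<Longrightarrow>
      \<bar>inverse h * Lh h c val - rhs h D1 D2 v0 w0 c\<bar> \<le> K * h ^ 5"
proof -
  define BP where "BP m n = (\<Sum>kl\<in>stencil. 6 * \<bar>M\<bar> * G5_bound Op a P m n)" for m n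
  define BM where "BM m n = (\<Sum>kl\<in>stencil. 6 * \<bar>M\<bar> * G5_bound Om a P m n)" for m n
  define BQ where "BQ m n = BP m n + (\<Sum>(m', n')\<in>{(m', n') \<in> Lam1 5. m' + n' \<ge> m + n}. \<bar>Tu Op Om a r s t0 m' n' m n\<bar> * BM m' n')" for m n
  define K1 where "K1 = (\<Sum>(m, n)\<in>Lam1 5. \<bar>side_deriv Op u P m n\<bar> * BQ m n)"
  \<comment> \<open>\<open>6 ^ 6\<close> comes from the sixth power of the \<open>taxi\<close>
    distance, at most \<open>6 * h\<close> on the stencil; \<open>6 * \<bar>M\<bar>\<close> bounds
    the values of \<open>Cpoly\<close>.\<close>
  define K2 where "K2 = (\<Sum>kl\<in>stencil. 6 * \<bar>M\<bar> * (C * 6 ^ 6))"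
  show thesis
  proof (rule that[of "K1 + K2"])
    fix h v0 w0 :: real and z c D1 D2 val
    assume h: "0 < h" "h \<le> 1" "6 * h < \<delta>" and z: "z = (fst P + v0 * h, snd P + w0 * h)"
      and vw: "\<bar>v0\<bar> \<le> 1" "\<bar>w0\<bar> \<le> 1" and D: "D1 \<union> D2 = stencil" "D1 \<inter> D2 = {}"
      and D1: "\<forall>kl\<in>D1. shift h z kl \<in> closure Op \<and> val kl = side_val Op u (shift h z kl)"
      and D2: "\<forall>kl\<in>D2. shift h z kl \<in> closure Om \<and> val kl = side_val Om u (shift h z kl)"
      and sys0: "coeff_system (Ipoly Op a P D1 v0 w0 c) (Ipoly Om a P D2 v0 w0 c) (Tu Op Om a r s t0)"
      and M: "\<forall>kl\<in>stencil. \<forall>p\<le>5. \<bar>c kl p\<bar> \<le> M"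
    define IP where "IP = Ipoly Op a P D1 v0 w0 c"
    define IM where "IM = Ipoly Om a P D2 v0 w0 c"
    have sys: "coeff_system IP IM (Tu Op Om a r s t0)" using sys0 by (simp add: IP_def IM_def)
    let ?U = "side_deriv Op u P" and ?V = "side_deriv Om u P"
    let ?c = "\<lambda>kl. poly (Cpoly c kl) h"
    let ?x = "\<lambda>kl. ((v0 + real_of_int (fst kl)) * h, (w0 + real_of_int (snd kl)) * h)"
    let ?R = "rhs h D1 D2 v0 w0 c"
    define Q where "Q m n = IP m n + (\<Sum>(m', n')\<in>{(m', n') \<in> Lam1 5. m' + n' \<ge> m + n}. smult (Tu Op Om a r s t0 m' n' m n) (IM m' n'))" for m n
    have fin: "finite D1" "finite D2" using D(1) finite_stencil by (metis finite_Un)+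
    have sub: "D1 \<subseteq> stencil" "D2 \<subseteq> stencil" using D by auto
    have sh: "shift h z kl - P = ?x kl" "taxi P (shift h z kl) < \<delta>" "taxi P (shift h z kl) \<le> 6 * h"
      if kl: "kl \<in> stencil" for kl
    proof -
      show "shift h z kl - P = ?x kl" by (simp add: shift_def z algebra_simps)
      have b: "\<bar>real_of_int (fst kl)\<bar> \<le> 2" "\<bar>real_of_int (snd kl)\<bar> \<le> 2" using stencil_bound[of "fst kl" "snd kl"] kl by auto
      have "taxi P (shift h z kl) = \<bar>v0 + real_of_int (fst kl)\<bar> * h + \<bar>w0 + real_of_int (snd kl)\<bar> * h"
      proof -
        have "taxi P (shift h z kl) = \<bar>fst (shift h z kl - P)\<bar> + \<bar>snd (shift h z kl - P)\<bar>"
          by (simp add: taxi_def)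
        then show ?thesis using h(1) unfolding \<open>shift h z kl - P = ?x kl\<close> by (simp add: abs_mult)
      qed
      also have "\<dots> \<le> 3 * h + 3 * h" using b vw h(1) by (intro add_mono mult_right_mono) auto
      finally show t: "taxi P (shift h z kl) \<le> 6 * h" by simp
      then show "taxi P (shift h z kl) < \<delta>" using h(3) by simp
    qed
    have Cb: "\<bar>?c kl\<bar> \<le> 6 * \<bar>M\<bar>" if "kl \<in> stencil" for kl
    proof -
      have "\<bar>?c kl\<bar> \<le> pnorm (Cpoly c kl) * h ^ 0" using h by (intro poly_le_pnorm) auto
      also have "\<dots> \<le> 6 * M" using pnorm_Cpoly[of c kl M] M that by auto
      finally show ?thesis by linarith
    qed
    have err: "\<bar>?c kl * val kl - ?c kl * y\<bar> \<le> 6 * \<bar>M\<bar> * (C * 6 ^ 6) * h ^ 6"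
      if kl: "kl \<in> stencil" and y: "\<bar>val kl - y\<bar> \<le> C * taxi P (shift h z kl) ^ 6" for kl y
    proof -
      have "taxi P (shift h z kl) ^ 6 \<le> (6 * h) ^ 6" by (rule power_mono[OF sh(3)[OF kl] taxi_nonneg])
      then have "\<bar>val kl - y\<bar> \<le> C * (6 * h) ^ 6" using y C(1) by (meson mult_left_mono order.trans)
      then have "\<bar>?c kl\<bar> * \<bar>val kl - y\<bar> \<le> (6 * \<bar>M\<bar>) * (C * (6 * h) ^ 6)"
        by (intro mult_mono Cb kl) auto
      moreover have "?c kl * val kl - ?c kl * y = ?c kl * (val kl - y)" by (simp add: right_diff_distrib)
      ultimately show ?thesis by (simp only: abs_mult) (simp add: power_mult_distrib mult_ac)
    qed
    define y where "y kl = (if kl \<in> D1 then taylor_poly 5 ?U (?x kl) else taylor_poly 5 ?V (?x kl))" for kl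
    have ey: "\<bar>val kl - y kl\<bar> \<le> C * taxi P (shift h z kl) ^ 6" if "kl \<in> stencil" for kl
    proof (cases "kl \<in> D1")
      case True
      then show ?thesis using D1 Cp[of "shift h z kl"] sh[OF that] by (simp add: y_def)
    next
      case False
      then have "kl \<in> D2" using that D by auto
      then show ?thesis using False D2 Cm[of "shift h z kl"] sh[OF that] by (simp add: y_def)
    qed
    have "\<bar>Lh h c val - (\<Sum>kl\<in>stencil. ?c kl * y kl)\<bar> = \<bar>\<Sum>kl\<in>stencil. ?c kl * val kl - ?c kl * y kl\<bar>"
      by (simp add: Lh_eq_sum sum_subtractf)
    also have "\<dots> \<le> (\<Sum>kl\<in>stencil. 6 * \<bar>M\<bar> * (C * 6 ^ 6) * h ^ 6)"
      by (rule order.trans[OF sum_abs]) (intro sum_mono err ey)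
    also have "\<dots> = K2 * h ^ 6" by (simp add: K2_def)
    finally have E1: "\<bar>Lh h c val - (\<Sum>kl\<in>stencil. ?c kl * y kl)\<bar> \<le> K2 * h ^ 6" .
    have "(\<Sum>kl\<in>stencil. ?c kl * y kl) = (\<Sum>kl\<in>D1. ?c kl * y kl) + (\<Sum>kl\<in>D2. ?c kl * y kl)"
      unfolding D(1)[symmetric] by (rule sum.union_disjoint[OF fin D(2)])
    also have "(\<Sum>kl\<in>D1. ?c kl * y kl) = (\<Sum>(k, l)\<in>D1. poly (Cpoly c (k, l)) h * taylor_poly 5 ?U ((v0 + real_of_int k) * h, (w0 + real_of_int l) * h))"
      by (rule sum.cong) (auto simp: y_def)
    also have "(\<Sum>kl\<in>D2. ?c kl * y kl) = (\<Sum>(k, l)\<in>D2. poly (Cpoly c (k, l)) h * taylor_poly 5 ?V ((v0 + real_of_int k) * h, (w0 + real_of_int l) * h))"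
      by (rule sum.cong) (use D(2) in \<open>auto simp: y_def\<close>)
    finally have "(\<Sum>kl\<in>stencil. ?c kl * y kl) - h * ?R = (\<Sum>(m, n)\<in>Lam1 5. ?U m n * poly (Q m n) h)"
      using scheme_defect[of h, where c = c and ?D1.0 = D1 and ?D2.0 = D2 and ?v0.0 = v0 and ?w0.0 = w0] h(1) unfolding IP_def[symmetric] IM_def[symmetric] Q_def by simp
    also have "\<bar>\<dots>\<bar> \<le> (\<Sum>mn\<in>Lam1 5. \<bar>?U (fst mn) (snd mn)\<bar> * BQ (fst mn) (snd mn) * h ^ 6)"
      unfolding case_prod_unfold
    proof (rule order.trans[OF sum_abs], rule sum_mono)
      fix mn :: "nat \<times> nat" assume mn: "mn \<in> Lam1 5"
      have q0: "coeff (Q (fst mn) (snd mn)) e = 0" if "e < 6" for e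
        using sys mn that unfolding coeff_system_def Q_def by (auto simp: case_prod_unfold)
      have bM: "pnorm (IM m' n') \<le> BM m' n'" for m' n'
        unfolding IM_def BM_def by (rule pnorm_Ipoly[OF sub(2)]) (use M vw in auto)
      have bP: "pnorm (IP m' n') \<le> BP m' n'" for m' n'
        unfolding IP_def BP_def by (rule pnorm_Ipoly[OF sub(1)]) (use M vw in auto)
      have "pnorm (Q (fst mn) (snd mn)) \<le> BQ (fst mn) (snd mn)"
        unfolding Q_def BQ_def case_prod_unfold
        by (intro order.trans[OF pnorm_add] add_mono bP order.trans[OF pnorm_sum] sum_mono)
           (simp add: pnorm_smult mult_left_mono bM)
      then have "\<bar>poly (Q (fst mn) (snd mn)) h\<bar> \<le> BQ (fst mn) (snd mn) * h ^ 6"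
        using poly_le_pnorm[of 6 "Q (fst mn) (snd mn)" h] q0 h(1,2)
        by (meson less_imp_le mult_right_mono order.trans zero_le_power)
      then show "\<bar>?U (fst mn) (snd mn) * poly (Q (fst mn) (snd mn)) h\<bar> \<le> \<bar>?U (fst mn) (snd mn)\<bar> * BQ (fst mn) (snd mn) * h ^ 6"
        by (simp add: abs_mult mult.assoc mult_left_mono)
    qed
    also have "\<dots> = K1 * h ^ 6" by (simp add: K1_def case_prod_unfold sum_distrib_right)
    finally have E2: "\<bar>(\<Sum>kl\<in>stencil. ?c kl * y kl) - h * ?R\<bar> \<le> K1 * h ^ 6" .
    have "\<bar>Lh h c val - h * ?R\<bar> \<le> (K1 + K2) * h ^ 6"
      using E1 E2 by (simp only: distrib_right)
    moreover have "\<bar>Lh h c val - h * ?R\<bar> = h * \<bar>inverse h * Lh h c val - ?R\<bar>"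
    proof -
      have "Lh h c val - h * ?R = h * (inverse h * Lh h c val - ?R)" using h(1) by (simp add: right_diff_distrib)
      then show ?thesis using h(1) by (simp only: abs_mult abs_of_pos)
    qed
    ultimately have "h * \<bar>inverse h * Lh h c val - ?R\<bar> \<le> h * ((K1 + K2) * h ^ 5)"
      by (simp add: eval_nat_numeral mult_ac)
    then show "\<bar>inverse h * Lh h c val - ?R\<bar> \<le> (K1 + K2) * h ^ 5" using h(1) by (simp only: mult_le_cancel_left_pos)
  qed
qed

end

text \<open>\<open>K\<close> and \<open>h0\<close> are chosen before the grid, the point, the
  offsets and \<open>c\<close>, so the estimate is uniform in all of them as long as the
  coefficients are bounded by \<open>M\<close>.\<close>

theorem theorem2p3:
  fixes l1 l2 l3 l4 :: real and N0 :: nat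
    and \<psi> a u f g gG :: "real \<times> real \<Rightarrow> real"
    and nrm :: "real \<times> real \<Rightarrow> real \<times> real"
    and \<Omega> \<Omega>p \<Omega>m \<Gamma> :: "(real \<times> real) set"
    and r s :: "real \<Rightarrow> real" and J :: "real set" and t0 M :: real and P :: "real \<times> real"
  assumes dom: "l1 < l2" "l3 < l4" "l4 - l3 = real N0 * (l2 - l1)"
    and \<Omega>: "\<Omega> = {l1<..<l2} \<times> {l3<..<l4}"
    and \<psi>: "smooth_fun \<psi>"
    and \<Gamma>: "\<Gamma> = {z \<in> \<Omega>. \<psi> z = 0}" "smooth_curve \<Gamma>"
    and \<Omega>p: "\<Omega>p = {z \<in> \<Omega>. \<psi> z > 0}"
    and \<Omega>m: "\<Omega>m = {z \<in> \<Omega>. \<psi> z < 0}"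
    and nrm: "\<forall>z\<in>\<Gamma>. unit_normal_towards \<Gamma> \<Omega>p \<Omega>m z (nrm z)"
    and a_reg: "uc_partials 6 \<Omega>p a" "uc_partials 6 \<Omega>m a"
    and u_reg: "uc_partials 7 \<Omega>p u" "uc_partials 7 \<Omega>m u"
    and f_reg: "uc_partials 5 \<Omega>p f" "uc_partials 5 \<Omega>m f"
    and a_pos: "\<forall>z\<in>\<Omega>p \<union> \<Gamma>. side_val \<Omega>p a z > 0" "\<forall>z\<in>\<Omega>m \<union> \<Gamma>. side_val \<Omega>m a z > 0"
    and pde: "\<forall>z\<in>\<Omega> - \<Gamma>. - (Dx (\<lambda>z. a z * Dx u z) z + Dy (\<lambda>z. a z * Dy u z) z) = f z"
    and jump_u: "\<forall>z\<in>\<Gamma>. interface_jump \<Omega>p \<Omega>m u z = g z"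
    and jump_flux: "\<forall>z\<in>\<Gamma>. interface_jump \<Omega>p \<Omega>m (\<lambda>z'. (a z' *\<^sub>R (Dx u z', Dy u z')) \<bullet> nrm z) z = gG z"
    and P: "P \<in> \<Gamma>" "P = (r t0, s t0)"
    and param: "local_param \<Gamma> r s J t0"
    and orient: "\<forall>t\<in>J. \<exists>\<kappa>>0. (deriv s t, - deriv r t) = \<kappa> *\<^sub>R nrm (r t, s t)"
    and g_reg: "uc_derivs 5 J (\<lambda>t. g (r t, s t))" "uc_derivs 4 J (\<lambda>t. gG (r t, s t))"
  shows "\<exists>K h0. h0 > 0 \<and>
    (\<forall>(N1::nat) (i::int) (j::int) h z v0 w0 (c :: int \<times> int \<Rightarrow> nat \<Rightarrow> real) IP IM.
       N1 > 0 \<and> h = (l2 - l1) / real N1 \<and> h < h0 \<and>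
       z = (l1 + real_of_int i * h, l3 + real_of_int j * h) \<and>
       z = (fst P + v0 * h, snd P + w0 * h) \<and>
       -1 < v0 \<and> v0 < 1 \<and> -1 < w0 \<and> w0 < 1 \<and>
       z \<in> \<Omega> \<and> (\<forall>kl\<in>stencil. shift h z kl \<in> closure \<Omega>) \<and>
       irregular \<psi> h z \<and>
       IP = Ipoly \<Omega>p a P (dp' \<psi> h z) v0 w0 c \<and>
       IM = Ipoly \<Omega>m a P (dm' \<psi> h z) v0 w0 c \<and>
       nontrivial c \<and> coeff_system IP IM (Tu \<Omega>p \<Omega>m a r s t0) \<and>
       (\<forall>kl\<in>stencil. \<forall>p\<le>5. \<bar>c kl p\<bar> \<le> M)
       \<longrightarrow>
       \<bar>inverse h * Lh h c (exact_val \<Omega>p \<Omega>m \<psi> u h z)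
        - ((\<Sum>(m, n)\<in>Lam 3. side_deriv \<Omega>p f P m n *
              Jf h (Hpoly \<Omega>p a P (dp' \<psi> h z) v0 w0 c) IM (Tp \<Omega>p \<Omega>m a r s t0) m n)
           + (\<Sum>(m, n)\<in>Lam 3. side_deriv \<Omega>m f P m n *
              Jf h (Hpoly \<Omega>m a P (dm' \<psi> h z) v0 w0 c) IM (Tm \<Omega>p \<Omega>m a r s t0) m n)
           + (\<Sum>p=0..5. g_coef r s t0 g p * Jg h IM (Tg \<Omega>p \<Omega>m a r s t0) p)
           + (\<Sum>p=0..4. gG_coef r s t0 gG p * Jg h IM (TgG \<Omega>p \<Omega>m a r s t0) p))\<bar>
       \<le> K * h ^ 5)"
proof -
  have cont: "continuous_on UNIV \<psi>"
    using \<psi> unfolding smooth_fun_def by (metis has_partials.simps(1))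
  have open\<Omega>: "open \<Omega>" unfolding \<Omega> by (intro open_Times open_greaterThanLessThan)
  have "open {z. 0 < \<psi> z}" "open {z. \<psi> z < 0}"
    using cont by (auto intro!: open_Collect_less continuous_on_const)
  then have op: "open \<Omega>p" and om: "open \<Omega>m"
    using open\<Omega> unfolding \<Omega>p \<Omega>m Collect_conj_eq by auto
  have cl: "z \<in> closure \<Omega>p" "z \<in> closure \<Omega>m" if "z \<in> \<Gamma>" for z
    using closure_of_normal[OF nrm[rule_format, OF that]] .
  have bp: "boundary_point \<Omega>p z" and bm: "boundary_point \<Omega>m z" if "z \<in> \<Gamma>" for z
    using that cl op om unfolding boundary_point_def \<Gamma> \<Omega>p \<Omega>m by auto
  have J: "open J" "t0 \<in> J" using param by (auto simp: local_param_def)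
  have in\<Gamma>: "(r t, s t) \<in> \<Gamma>" if "t \<in> J" for t by (rule local_param_in[OF param that])
  have accp: "axis_accessible \<Omega>p (r t0, s t0)"
    unfolding \<Omega>p by (rule axis_accessible_side[OF cont open\<Omega> \<Gamma>(1) param])
  \<comment> \<open>The minus side is the positive side of \<open>- \<psi>\<close>, with the same
    zero set.\<close>
  have "axis_accessible {z \<in> \<Omega>. - \<psi> z > 0} (r t0, s t0)"
    by (rule axis_accessible_side[OF continuous_on_minus[OF cont] open\<Omega> _ param]) (simp add: \<Gamma>)
  then have accm: "axis_accessible \<Omega>m (r t0, s t0)" unfolding \<Omega>m by simp
  have uc0: "uc_partials 0 \<Omega>p a" "uc_partials 0 \<Omega>m a" "uc_partials 1 \<Omega>p u" "uc_partials 1 \<Omega>m u"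
    by (rule uc_partials_le[OF a_reg(1)] uc_partials_le[OF a_reg(2)] uc_partials_le[OF u_reg(1)] uc_partials_le[OF u_reg(2)], simp)+
  have scale: "side_flux S a u z (\<kappa> *\<^sub>R v) = \<kappa> * side_flux S a u z v" for S z \<kappa> v
    by (simp add: side_flux_def algebra_simps)
  have flux: "side_flux \<Omega>p a u (r t, s t) (deriv s t, - deriv r t) - side_flux \<Omega>m a u (r t, s t) (deriv s t, - deriv r t)
      = gG (r t, s t) * sqrt ((deriv r t)\<^sup>2 + (deriv s t)\<^sup>2)"
    and reg: "(deriv r t)\<^sup>2 + (deriv s t)\<^sup>2 > 0" if t: "t \<in> J" for t
  proof -
    let ?z = "(r t, s t)"
    obtain \<kappa> where \<kappa>: "\<kappa> > 0" "(deriv s t, - deriv r t) = \<kappa> *\<^sub>R nrm ?z" using orient t by blast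
    have "norm (nrm ?z) = 1" using nrm in\<Gamma>[OF t] by (auto simp: unit_normal_towards_def)
    then have "norm (deriv s t, - deriv r t) = \<kappa>" using \<kappa> by simp
    \<comment> \<open>As \<open>nrm\<close> has length one, \<open>\<kappa>\<close> is the arc
      length factor; it converts the jump for the unit normal into the one for
      \<open>(deriv s t, - deriv r t)\<close>.\<close>
    then have sq: "sqrt ((deriv r t)\<^sup>2 + (deriv s t)\<^sup>2) = \<kappa>" by (simp add: norm_Pair add.commute)
    then show "(deriv r t)\<^sup>2 + (deriv s t)\<^sup>2 > 0" using \<kappa>(1) real_sqrt_gt_0_iff by metis
    have "gG ?z = side_flux \<Omega>p a u ?z (nrm ?z) - side_flux \<Omega>m a u ?z (nrm ?z)"
      using jump_flux[rule_format, OF in\<Gamma>[OF t]]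
      unfolding interface_jump_def boundary_point.side_val_flux[OF bp[OF in\<Gamma>[OF t]] uc0(1,3)]
        boundary_point.side_val_flux[OF bm[OF in\<Gamma>[OF t]] uc0(2,4)] by simp
    then show "side_flux \<Omega>p a u ?z (deriv s t, - deriv r t) - side_flux \<Omega>m a u ?z (deriv s t, - deriv r t)
      = gG ?z * sqrt ((deriv r t)\<^sup>2 + (deriv s t)\<^sup>2)"
      unfolding \<kappa>(2) scale sq by (simp add: right_diff_distrib mult.commute)
  qed
  interpret D: interface_data \<Omega>p \<Omega>m a r s t0 J u f g gG
  proof (intro interface_data.intro accessible_boundary_point.intro accessible_boundary_point_axioms.intro
      transmission.intro interface_data_axioms.intro J accp accm a_reg u_reg f_reg flux reg)
    show "boundary_point \<Omega>p (r t0, s t0)" "boundary_point \<Omega>m (r t0, s t0)" using bp bm in\<Gamma> J by auto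
    show "Ck_on 5 J r" "Ck_on 5 J s" using local_param_Ck_on[OF param] by auto
    show "deriv r t0 \<noteq> 0 \<or> deriv s t0 \<noteq> 0" using param by (auto simp: local_param_def)
    show "side_deriv \<Omega>m a (r t0, s t0) 0 0 \<noteq> 0" using a_pos(2) in\<Gamma>[OF J(2)] by (force simp: side_deriv_def)
    show "side_val \<Omega>p a (r t0, s t0) \<noteq> 0" using a_pos(1) in\<Gamma>[OF J(2)] by force
    show "a z \<noteq> 0" if "z \<in> \<Omega>p \<union> \<Omega>m" for z
      using that a_pos by (force simp: side_val_def)
    show "- (Dx (\<lambda>z. a z * Dx u z) z + Dy (\<lambda>z. a z * Dy u z) z) = f z" if "z \<in> \<Omega>p \<union> \<Omega>m" for z
      using pde that unfolding \<Omega>p \<Omega>m \<Gamma> by auto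
    show "(r t, s t) \<in> closure \<Omega>p" "(r t, s t) \<in> closure \<Omega>m" if "t \<in> J" for t using cl in\<Gamma> that by auto
    show "side_val \<Omega>p u (r t, s t) - side_val \<Omega>m u (r t, s t) = g (r t, s t)" if "t \<in> J" for t
      using jump_u in\<Gamma>[OF that] unfolding interface_jump_def by blast
    show "Ck_on 5 J (\<lambda>t. g (r t, s t))" "Ck_on 4 J (\<lambda>t. gG (r t, s t))"
      using g_reg uc_derivs_Ck_on[OF J(1)] by auto
  qed
  have uc6: "uc_partials (Suc 5) \<Omega>p u" "uc_partials (Suc 5) \<Omega>m u"
    by (rule uc_partials_le[OF u_reg(1)] uc_partials_le[OF u_reg(2)], simp)+
  obtain C1 \<delta>1 where C1: "\<delta>1 > 0" "C1 \<ge> 0" "\<And>z. z \<in> closure \<Omega>p \<Longrightarrow> taxi P z < \<delta>1 \<Longrightarrow>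
      \<bar>side_val \<Omega>p u z - taylor_poly 5 (side_deriv \<Omega>p u P) (z - P)\<bar> \<le> C1 * taxi P z ^ 6"
    using D.pl.taylor_bound_closure[OF uc6(1)] unfolding P(2)[symmetric] by auto
  obtain C2 \<delta>2 where C2: "\<delta>2 > 0" "C2 \<ge> 0" "\<And>z. z \<in> closure \<Omega>m \<Longrightarrow> taxi P z < \<delta>2 \<Longrightarrow>
      \<bar>side_val \<Omega>m u z - taylor_poly 5 (side_deriv \<Omega>m u P) (z - P)\<bar> \<le> C2 * taxi P z ^ 6"
    using D.mi.taylor_bound_closure[OF uc6(2)] unfolding P(2)[symmetric] by auto
  define C where "C = max C1 C2"
  define \<delta> where "\<delta> = min \<delta>1 \<delta>2"
  have C: "0 \<le> C" "0 < \<delta>" using C1 C2 by (auto simp: C_def \<delta>_def)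
  have le: "C1 * taxi P z ^ 6 \<le> C * taxi P z ^ 6" "C2 * taxi P z ^ 6 \<le> C * taxi P z ^ 6" for z
    by (auto simp: C_def intro!: mult_right_mono)
  have Cp: "\<bar>side_val \<Omega>p u z - taylor_poly 5 (side_deriv \<Omega>p u P) (z - P)\<bar> \<le> C * taxi P z ^ 6"
    if "z \<in> closure \<Omega>p" "taxi P z < \<delta>" for z
    using C1(3)[of z] that le(1)[of z] by (simp add: \<delta>_def)
  have Cm: "\<bar>side_val \<Omega>m u z - taylor_poly 5 (side_deriv \<Omega>m u P) (z - P)\<bar> \<le> C * taxi P z ^ 6"
    if "z \<in> closure \<Omega>m" "taxi P z < \<delta>" for z
    using C2(3)[of z] that le(2)[of z] by (simp add: \<delta>_def)
  obtain K where K: "\<And>h z v0 w0 c D1 D2 val. \<lbrakk>0 < h; h \<le> 1; 6 * h < \<delta>; z = (fst P + v0 * h, snd P + w0 * h);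
      \<bar>v0\<bar> \<le> 1; \<bar>w0\<bar> \<le> 1; D1 \<union> D2 = stencil; D1 \<inter> D2 = {};
      \<forall>kl\<in>D1. shift h z kl \<in> closure \<Omega>p \<and> val kl = side_val \<Omega>p u (shift h z kl);
      \<forall>kl\<in>D2. shift h z kl \<in> closure \<Omega>m \<and> val kl = side_val \<Omega>m u (shift h z kl);
      coeff_system (Ipoly \<Omega>p a P D1 v0 w0 c) (Ipoly \<Omega>m a P D2 v0 w0 c) (Tu \<Omega>p \<Omega>m a r s t0);
      \<forall>kl\<in>stencil. \<forall>p\<le>5. \<bar>c kl p\<bar> \<le> M\<rbrakk> \<Longrightarrow>
      \<bar>inverse h * Lh h c val - scheme_rhs \<Omega>p \<Omega>m a r s t0 P f g gG h D1 D2 v0 w0 c\<bar> \<le> K * h ^ 5"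
    by (rule D.consistency[OF C, folded P(2), OF Cp Cm]) blast+
  have "P \<in> \<Omega>" using P(1) \<Gamma>(1) by simp
  then obtain \<rho> where \<rho>: "\<rho> > 0" "\<And>x y. \<bar>x - fst P\<bar> < \<rho> \<Longrightarrow> \<bar>y - snd P\<bar> < \<rho> \<Longrightarrow> (x, y) \<in> \<Omega>"
    using open_square[OF open\<Omega>, of "fst P" "snd P"] by auto
  show ?thesis
  \<comment> \<open>The bound 1 is for comparing powers of \<open>h\<close>;
    \<open>\<delta> / 6\<close> brings the stencil, at \<open>taxi\<close> distance at most
    \<open>6 * h\<close> from \<open>P\<close>, into the range of the Taylor estimates;
    \<open>\<rho> / 3\<close> keeps coordinate offsets, at most \<open>3 * h\<close>, within a box
    inside \<open>\<Omega>\<close>.\<close>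
  proof (rule exI[of _ K], rule exI[of _ "min 1 (min (\<delta> / 6) (\<rho> / 3))"], intro conjI allI impI, goal_cases)
    case 1
    then show ?case using C(2) \<rho>(1) by simp
  next
    case (2 N1 i j h z v0 w0 c IP IM)
    then have N1: "N1 > 0" "h = (l2 - l1) / real N1" and hlt: "h < min 1 (min (\<delta> / 6) (\<rho> / 3))"
      and zP: "z = (fst P + v0 * h, snd P + w0 * h)" and vw: "-1 < v0 \<and> v0 < 1 \<and> -1 < w0 \<and> w0 < 1"
      and IP: "IP = Ipoly \<Omega>p a P (dp' \<psi> h z) v0 w0 c" and IM: "IM = Ipoly \<Omega>m a P (dm' \<psi> h z) v0 w0 c"
      and sys: "coeff_system IP IM (Tu \<Omega>p \<Omega>m a r s t0)" and M: "\<forall>kl\<in>stencil. \<forall>p\<le>5. \<bar>c kl p\<bar> \<le> M"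
      by blast+
    have h: "0 < h" "h \<le> 1" "6 * h < \<delta>" "3 * h < \<rho>"
    proof -
      show "0 < h" using N1 dom(1) by simp
      show "h \<le> 1" "6 * h < \<delta>" "3 * h < \<rho>" using hlt by simp_all
    qed
    have v: "\<bar>v0\<bar> \<le> 1" "\<bar>w0\<bar> \<le> 1" using vw by auto
    have near: "shift h z kl \<in> \<Omega>" if "kl \<in> stencil" for kl
    proof -
      have b: "\<bar>real_of_int (fst kl)\<bar> \<le> 2" "\<bar>real_of_int (snd kl)\<bar> \<le> 2"
        using stencil_bound[of "fst kl" "snd kl"] that by auto
      have sm: "\<bar>x * h\<bar> < \<rho>" if "\<bar>x\<bar> \<le> 3" for x
      proof -
        have "\<bar>x\<bar> * h \<le> 3 * h" using that h(1) by (intro mult_right_mono) auto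
        then have "\<bar>x\<bar> * h < \<rho>" using h(4) by linarith
        then show ?thesis using h(1) by (simp add: abs_mult)
      qed
      have "\<bar>v0 + real_of_int (fst kl)\<bar> \<le> 3" "\<bar>w0 + real_of_int (snd kl)\<bar> \<le> 3"
        using b v by linarith+
      then have "\<bar>(v0 + real_of_int (fst kl)) * h\<bar> < \<rho>" "\<bar>(w0 + real_of_int (snd kl)) * h\<bar> < \<rho>"
        using sm by blast+
      then show ?thesis unfolding shift_def zP by (intro \<rho>(2)) (simp_all add: algebra_simps)
    qed
    have d1: "\<forall>kl\<in>dp' \<psi> h z. shift h z kl \<in> closure \<Omega>p \<and> exact_val \<Omega>p \<Omega>m \<psi> u h z kl = side_val \<Omega>p u (shift h z kl)"
    proof
      fix kl assume kl: "kl \<in> dp' \<psi> h z"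
      then have "shift h z kl \<in> \<Omega>p" using near by (auto simp: stencil_split(3) \<Omega>p)
      then show "shift h z kl \<in> closure \<Omega>p \<and> exact_val \<Omega>p \<Omega>m \<psi> u h z kl = side_val \<Omega>p u (shift h z kl)"
        using kl closure_subset by (auto simp: exact_val_def)
    qed
    have d2: "\<forall>kl\<in>dm' \<psi> h z. shift h z kl \<in> closure \<Omega>m \<and> exact_val \<Omega>p \<Omega>m \<psi> u h z kl = side_val \<Omega>m u (shift h z kl)"
    proof
      fix kl assume kl: "kl \<in> dm' \<psi> h z"
      then have "shift h z kl \<in> \<Omega>" "\<psi> (shift h z kl) \<le> 0" using near by (auto simp: stencil_split(4))
      \<comment> \<open>Stencil points on the interface count to the minus side; they take their
        value as a limit and are covered because \<open>\<Gamma>\<close> lies in the closure of that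
        side.\<close>
      then have "shift h z kl \<in> \<Omega>m \<or> shift h z kl \<in> \<Gamma>" by (auto simp: \<Omega>m \<Gamma>)
      then have "shift h z kl \<in> closure \<Omega>m" using cl(2) closure_subset by blast
      moreover have "kl \<notin> dp' \<psi> h z" using kl stencil_split(2) by blast
      ultimately show "shift h z kl \<in> closure \<Omega>m \<and> exact_val \<Omega>p \<Omega>m \<psi> u h z kl = side_val \<Omega>m u (shift h z kl)"
        by (simp add: exact_val_def)
    qed
    show ?case
      using K[OF h(1-3) zP v stencil_split(1)[symmetric] stencil_split(2) d1 d2 sys[unfolded IP IM] M]
      by (simp only: scheme_rhs_def Let_def IM)
  qed
qed

end
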